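(* Let $p>1$, $\alpha\ge0$. Assume that $\{S_t=u_tC_{\phi_t}:t\in\,]0,1[\}$ is a family of weighted composition operators on $A^p_\alpha$ that has the directions $-1$ and $1$ and satisfies condition $(W_{-1,1})$. Let $\theta\in[0,1]$ and let $$\Theta_t(1)=\Big(\frac{\theta^p}{\theta^p+(1-\theta)^p}\Big)^{1/p}\frac{u_t(1)}{\phi_t'(1)^{(2+\alpha)/p}},\qquad \Theta_t(-1)=\Big(\frac{(1-\theta)^p}{\theta^p+(1-\theta)^p}\Big)^{1/p}\frac{u_t(-1)}{\phi_t'(-1)^{(2+\alpha)/p}} .$$ Then $$\lim_c\Big\|\int_0^1S_tg_{c,\theta}\,dt\Big\|_{A^p_\alpha}=\lim_c\int_0^1\|S_tg_{c,\theta}\|_{A^p_\alpha}\,dt$$ if and only if there is a set $M\subset\,]0,1[$ of full measure such that for every $t_0\in M$, either $$\begin{pmatrix}\Theta_t(-1)\\ \Theta_t(1)\end{pmatrix}=\lambda_t\begin{pmatrix}\Theta_{t_0}(-1)\\ \Theta_{t_0}(1)\end{pmatrix}\ \text{ for all } t\in M \text{ and some } \lambda_t\ge0,\qquad\text{or}\qquad \begin{pmatrix}\Theta_{t_0}(-1)\\ \Theta_{t_0}(1)\end{pmatrix}=\begin{pmatrix}0\\0\end{pmatrix}.$$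
   Context: $\mathbb D$ is the open unit disk in $\mathbb C$, $\mathcal H(\mathbb D)$ the holomorphic functions on $\mathbb D$, $B(z,r)$ the open disk with center $z$ and radius $r$, $dA(x+iy)=dx\,dy/\pi$, $dA_\alpha(z)=(1+\alpha)(1-|z|^2)^\alpha dA(z)$. For $p>1$, $\alpha\ge0$, $A^p_\alpha=\{f\in\mathcal H(\mathbb D):\|f\|^p_{A^p_\alpha}=\int_{\mathbb D}|f|^p\,dA_\alpha<\infty\}$; $\mathcal L(X)$ denotes the bounded linear operators on $X$. For holomorphic $\phi_t:\mathbb D\to\mathbb D$ and $u_t\in A^p_\alpha$, $S_t=u_tC_{\phi_t}:A^p_\alpha\to A^p_\alpha$, $f\mapsto u_t\,(f\circ\phi_t)$. Integrals $\int_0^1S_tf\,dt$ are vector-valued integrals in $A^p_\alpha$. For $\epsilon>0$ put $U_\epsilon=B(1,\epsilon)\cup B(-1,\epsilon)$. The family has the directions $-1$ and $1$ if for every $t\in\,]0,1[$: (a) $\phi_t\in\mathcal H(\mathbb D)$ and $\phi_t'$ extends continuously to $\overline{\mathbb D}\cap U_\epsilon$ for some $\epsilon=\epsilon(t)>0$; (b) $\phi_t(1)=1$ and $\phi_t(-1)=-1$; (c) $\overline{\phi_t(\mathbb D\setminus U_\epsilon)}\cap\partial\mathbb D=\emptyset$ for every $\epsilon>0$; (d) for every $\epsilon>0$ the set $\overline{\phi_t(U_\epsilon\cap\mathbb D)}$ contains a horocycle touching $1$ and a horocycle touching $-1$ (a horocycle touching $\xi$ is a circle in $\overline{\mathbb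 D}$ internally tangent to $\partial\mathbb D$ at $\xi$); (e) $u_t$ extends continuously to $\overline{\mathbb D}\cap U_\epsilon$ for some $\epsilon=\epsilon(t)>0$. Values at $\pm1$ are those of the continuous extensions; one has $\phi_t'(\pm1)>0$. Condition $(W_{-1,1})$: $\int_0^1\|S_t\|_{\mathcal L(A^p_\alpha)}\,dt<\infty$, and for every $t_0\in\,]0,1[$: (i) $\lim_{t\to t_0}\sup_{z\in\mathbb D}|\phi_t(z)-\phi_{t_0}(z)|=0$; (ii) for every $\epsilon'>0$, $\lim_{t\to t_0}\int_{\mathbb D\setminus U_{\epsilon'}}|u_t-u_{t_0}|^p\,dA_\alpha=0$; (iii) for some $\epsilon'>0$, $\sup_{|t-t_0|<\epsilon'}\sup_{z\in U_{\epsilon'}\cap\mathbb D}|u_t(z)|<\infty$; (iv) for some $\epsilon'>0$, $\inf_{|t-t_0|<\epsilon'}\inf_{z\in U_{\epsilon'}\cap\mathbb D}|\phi_t'(z)|>0$. For $0<c<(2+\alpha)/p$ and $\theta\in[0,1]$, $g_{c,\theta}=\hat g_{c,\theta}/\|\hat g_{c,\theta}\|_{A^p_\alpha}$ with $\hat g_{c,\theta}(z)=\theta(1-z)^{-c}+(1-\theta)(1+z)^{-c}$ (principal branches), and $\lim_c$ is the limit as $c\to(2+\alpha)/p$ from below. *)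

theory Defs
  imports "HOL-Analysis.Analysis"
begin

text \<open>
  Elements of the Bergman space are represented by total functions of which only the restriction
  to the disk matters: the norm, and every notion below, ignores the values outside the disk.
\<close>

abbreviation disk :: "complex set" where
  "disk \<equiv> ball 0 1"

definition dA :: "real \<Rightarrow> complex measure" where
  "dA \<alpha> = density (restrict_space lborel disk)
            (\<lambda>z. ennreal ((1 + \<alpha>) * (1 - (cmod z)\<^sup>2) powr \<alpha> / pi))"

definition bergman_space :: "real \<Rightarrow> real \<Rightarrow> (complex \<Rightarrow> complex) set" where
  "bergman_space p \<alpha> =
     {f. f holomorphic_on disk \<and> integrable (dA \<alpha>) (\<lambda>z. cmod (f z) powr p)}"

definition bergman_norm :: "real \<Rightarrow> real \<Rightarrow> (complex \<Rightarrow> complex) \<Rightarrow> real" where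
  "bergman_norm p \<alpha> f = (LINT z|dA \<alpha>. cmod (f z) powr p) powr (1 / p)"

definition bounded_operators ::
    "real \<Rightarrow> real \<Rightarrow> ((complex \<Rightarrow> complex) \<Rightarrow> complex \<Rightarrow> complex) set" where
  "bounded_operators p \<alpha> =
     {T. (\<forall>f\<in>bergman_space p \<alpha>. T f \<in> bergman_space p \<alpha>) \<and>
         (\<forall>f\<in>bergman_space p \<alpha>. \<forall>g\<in>bergman_space p \<alpha>. \<forall>a b. \<forall>z\<in>disk.
            T (\<lambda>w. a * f w + b * g w) z = a * T f z + b * T g z) \<and>
         (\<exists>K. \<forall>f\<in>bergman_space p \<alpha>. bergman_norm p \<alpha> (T f) \<le> K * bergman_norm p \<alpha> f)}"

definition operator_norm ::
    "real \<Rightarrow> real \<Rightarrow> ((complex \<Rightarrow> complex) \<Rightarrow> complex \<Rightarrow> complex) \<Rightarrow> real" where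
  "operator_norm p \<alpha> T =
     (SUP f\<in>{f \<in> bergman_space p \<alpha>. bergman_norm p \<alpha> f \<le> 1}. bergman_norm p \<alpha> (T f))"

definition weighted_comp ::
    "(complex \<Rightarrow> complex) \<Rightarrow> (complex \<Rightarrow> complex) \<Rightarrow> (complex \<Rightarrow> complex) \<Rightarrow> complex \<Rightarrow> complex" where
  "weighted_comp u \<phi> f = (\<lambda>z. u z * f (\<phi> z))"

text \<open>
  Bochner integral over the unit interval of a function with values in the Bergman space. The
  parameters of the space are terms, so it is not a type and the library's
  \<^const>\<open>has_bochner_integral\<close> does not apply; the definition is the usual one by approximation
  in the mean with simple functions.
\<close>

abbreviation unit_interval :: "real measure" where
  "unit_interval \<equiv> lebesgue_on {0<..<1}"

definition simple_integral :: "(real \<Rightarrow> complex \<Rightarrow> complex) \<Rightarrow> complex \<Rightarrow> complex" where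
  "simple_integral s = (\<lambda>z. \<Sum>g\<in>s ` {0<..<1}.
     complex_of_real (measure unit_interval {t \<in> {0<..<1}. s t = g}) * g z)"

definition has_bergman_integral ::
    "real \<Rightarrow> real \<Rightarrow> (real \<Rightarrow> complex \<Rightarrow> complex) \<Rightarrow> (complex \<Rightarrow> complex) \<Rightarrow> bool" where
  "has_bergman_integral p \<alpha> F G \<longleftrightarrow>
     G \<in> bergman_space p \<alpha> \<and>
     (\<forall>t\<in>{0<..<1}. F t \<in> bergman_space p \<alpha>) \<and>
     (\<exists>s :: nat \<Rightarrow> real \<Rightarrow> complex \<Rightarrow> complex.
        (\<forall>n. simple_function unit_interval (s n) \<and> s n ` {0<..<1} \<subseteq> bergman_space p \<alpha>) \<and>
        (\<forall>n. integrable unit_interval (\<lambda>t. bergman_norm p \<alpha> (\<lambda>z. F t z - s n t z))) \<and>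
        (\<lambda>n. LINT t|unit_interval. bergman_norm p \<alpha> (\<lambda>z. F t z - s n t z)) \<longlonglongrightarrow> 0 \<and>
        (\<lambda>n. bergman_norm p \<alpha> (\<lambda>z. simple_integral (s n) z - G z)) \<longlonglongrightarrow> 0)"

text \<open>The integral is determined on the disk only, hence \<open>SOME\<close> rather than \<open>THE\<close>.\<close>

definition bergman_integral ::
    "real \<Rightarrow> real \<Rightarrow> (real \<Rightarrow> complex \<Rightarrow> complex) \<Rightarrow> complex \<Rightarrow> complex" where
  "bergman_integral p \<alpha> F = (SOME G. has_bergman_integral p \<alpha> F G)"

definition U :: "real \<Rightarrow> complex set" where
  "U \<epsilon> = ball 1 \<epsilon> \<union> ball (-1) \<epsilon>"

definition extends_near_pm1 :: "(complex \<Rightarrow> complex) \<Rightarrow> bool" where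
  "extends_near_pm1 f \<longleftrightarrow>
     (\<exists>\<epsilon>>0. \<exists>h. continuous_on (cball 0 1 \<inter> U \<epsilon>) h \<and> (\<forall>z\<in>disk \<inter> U \<epsilon>. h z = f z))"

text \<open>
  When \<open>f\<close> extends continuously from the disk to the boundary point \<open>\<xi>\<close>, this is the value of the
  extension there.
\<close>

definition bval :: "(complex \<Rightarrow> complex) \<Rightarrow> complex \<Rightarrow> complex" where
  "bval f \<xi> = Lim (at \<xi> within disk) f"

definition horocycle :: "complex \<Rightarrow> complex set \<Rightarrow> bool" where
  "horocycle \<xi> H \<longleftrightarrow> (\<exists>r. 0 < r \<and> r < 1 \<and> H = sphere (complex_of_real (1 - r) * \<xi>) r)"

definition weighted_comp_family ::
    "real \<Rightarrow> real \<Rightarrow> (real \<Rightarrow> complex \<Rightarrow> complex) \<Rightarrow> (real \<Rightarrow> complex \<Rightarrow> complex) \<Rightarrow> bool" where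
  "weighted_comp_family p \<alpha> u \<phi> \<longleftrightarrow>
     (\<forall>t\<in>{0<..<1}. \<phi> t holomorphic_on disk \<and> \<phi> t ` disk \<subseteq> disk \<and> u t \<in> bergman_space p \<alpha> \<and>
        weighted_comp (u t) (\<phi> t) \<in> bounded_operators p \<alpha>)"

definition has_directions_pm1 ::
    "(real \<Rightarrow> complex \<Rightarrow> complex) \<Rightarrow> (real \<Rightarrow> complex \<Rightarrow> complex) \<Rightarrow> bool" where
  "has_directions_pm1 u \<phi> \<longleftrightarrow>
     (\<forall>t\<in>{0<..<1}.
        \<phi> t holomorphic_on disk \<and> extends_near_pm1 (deriv (\<phi> t)) \<and>
        (\<phi> t \<longlongrightarrow> 1) (at 1 within disk) \<and> (\<phi> t \<longlongrightarrow> -1) (at (-1) within disk) \<and>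
        (\<forall>\<epsilon>>0. closure (\<phi> t ` (disk - U \<epsilon>)) \<inter> sphere 0 1 = {}) \<and>
        (\<forall>\<epsilon>>0. (\<exists>H. horocycle 1 H \<and> H \<subseteq> closure (\<phi> t ` (U \<epsilon> \<inter> disk))) \<and>
                (\<exists>H. horocycle (-1) H \<and> H \<subseteq> closure (\<phi> t ` (U \<epsilon> \<inter> disk)))) \<and>
        extends_near_pm1 (u t))"

definition condition_W ::
    "real \<Rightarrow> real \<Rightarrow> (real \<Rightarrow> complex \<Rightarrow> complex) \<Rightarrow> (real \<Rightarrow> complex \<Rightarrow> complex) \<Rightarrow> bool" where
  "condition_W p \<alpha> u \<phi> \<longleftrightarrow>
     integrable unit_interval (\<lambda>t. operator_norm p \<alpha> (weighted_comp (u t) (\<phi> t))) \<and>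
     (\<forall>t0\<in>{0<..<1}.
        ((\<lambda>t. SUP z\<in>disk. cmod (\<phi> t z - \<phi> t0 z)) \<longlongrightarrow> 0) (at t0) \<and>
        (\<forall>\<epsilon>>0. ((\<lambda>t. LINT z:(disk - U \<epsilon>)|dA \<alpha>. cmod (u t z - u t0 z) powr p) \<longlongrightarrow> 0) (at t0)) \<and>
        (\<exists>\<epsilon>>0. (SUP t\<in>{0<..<1} \<inter> ball t0 \<epsilon>. SUP z\<in>U \<epsilon> \<inter> disk. ereal (cmod (u t z))) < \<infinity>) \<and>
        (\<exists>\<epsilon>>0. (INF t\<in>{0<..<1} \<inter> ball t0 \<epsilon>. INF z\<in>U \<epsilon> \<inter> disk. ereal (cmod (deriv (\<phi> t) z))) > 0))"

definition g_hat :: "real \<Rightarrow> real \<Rightarrow> complex \<Rightarrow> complex" where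
  "g_hat c \<theta> z =
     of_real \<theta> * (1 - z) powr (- of_real c) + of_real (1 - \<theta>) * (1 + z) powr (- of_real c)"

definition g_test :: "real \<Rightarrow> real \<Rightarrow> real \<Rightarrow> real \<Rightarrow> complex \<Rightarrow> complex" where
  "g_test p \<alpha> c \<theta> z = g_hat c \<theta> z / of_real (bergman_norm p \<alpha> (g_hat c \<theta>))"

text \<open>
  The boundary derivatives are positive reals, so the complex principal powers below are the real
  ones.
\<close>

definition Theta_pos ::
    "real \<Rightarrow> real \<Rightarrow> real \<Rightarrow> (complex \<Rightarrow> complex) \<Rightarrow> (complex \<Rightarrow> complex) \<Rightarrow> complex" where
  "Theta_pos p \<alpha> \<theta> u \<phi> =
     of_real ((\<theta> powr p / (\<theta> powr p + (1 - \<theta>) powr p)) powr (1 / p)) *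
     (bval u 1 / bval (deriv \<phi>) 1 powr of_real ((2 + \<alpha>) / p))"

definition Theta_neg ::
    "real \<Rightarrow> real \<Rightarrow> real \<Rightarrow> (complex \<Rightarrow> complex) \<Rightarrow> (complex \<Rightarrow> complex) \<Rightarrow> complex" where
  "Theta_neg p \<alpha> \<theta> u \<phi> =
     of_real (((1 - \<theta>) powr p / (\<theta> powr p + (1 - \<theta>) powr p)) powr (1 / p)) *
     (bval u (-1) / bval (deriv \<phi>) (-1) powr of_real ((2 + \<alpha>) / p))"

end

theory Submission
  imports Defs "HOL-Complex_Analysis.Complex_Analysis"
begin

text \<open>
  As \<open>c\<close> increases to \<open>(2 + \<alpha>) / p\<close>, the norm of \<open>(1 - z) powr - c\<close> tends to infinity, so the
  normalised kernels \<open>e\<^sub>1\<close>, \<open>e\<^sub>2\<close> at \<open>1\<close> and \<open>-1\<close> concentrate at their singularities. Only the boundary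
  values of \<open>u\<^sub>t\<close> and \<open>\<phi>\<^sub>t'\<close> then matter: for fixed \<open>t\<close> the image of the test function under \<open>S\<^sub>t\<close>
  differs from \<open>\<Theta>\<^sub>t(1) e\<^sub>1 + \<Theta>\<^sub>t(-1) e\<^sub>2\<close> by \<open>o(1)\<close> in norm, and the norm of \<open>a e\<^sub>1 + b e\<^sub>2\<close> tends to
  the \<open>p\<close>-norm of \<open>(a, b)\<close>. As the operator norms are integrable, dominated convergence shows that
  the two limits are the \<open>p\<close>-norm of the integral of \<open>\<Theta>\<close> and the integral of the \<open>p\<close>-norm of \<open>\<Theta>\<close>.
  By strict convexity of the \<open>p\<close>-norm they agree exactly when almost all \<open>\<Theta>\<^sub>t\<close> lie on one ray.
  Strong measurability of the integrand comes from approximating the test functions by functions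
  continuous on the closed disk, whose images depend continuously on \<open>t\<close>.
\<close>

section \<open>The Lebesgue seminorm of the weighted measure\<close>

text \<open>The norms of the kernels are never computed. Their blow-up comes from self-similarity
  under a contraction towards the boundary point, and kernels are compared up to errors of one
  shape: a small multiple of the kernel plus one fixed p-integrable function. Such errors involve
  moduli of kernels and functions cut off at the imaginary axis, which are not holomorphic. The
  seminorm is therefore studied on all p-integrable functions, and holomorphy enters where it gives
  bounded point evaluations and completeness. No limit of the test functions in the space is used.
  The comparison takes place in a two-dimensional subspace that moves with \<open>c\<close>, with
  coefficients that depend on \<open>t\<close> alone, so integration over \<open>t\<close> acts on
  the coefficients only. Condition W compares the symbols of the operators: it bounds the operator
  norms in the mean but not the norms of differences of operators, hence the detour through
  functions on which the dependence on \<open>t\<close> is continuous. Reflection in the origin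
  preserves the measure, so only the kernel at \<open>1\<close> needs an analysis of its
  own.\<close>

lemma powr_convex_combination:
  fixes p x y a b :: real
  assumes "p \<ge> 1" "x \<ge> 0" "y \<ge> 0" "a > 0" "b > 0" "a + b = 1"
  shows "(a * x + b * y) powr p \<le> a * x powr p + b * y powr p"
proof -
  \<comment> \<open>Zero arguments, which occur where a function vanishes, are split off and rest on
    \<open>c powr p \<le> c\<close> for \<open>c\<close> in (0,1]. The remaining case is convexity
    of the power on the positive half-line.\<close>
  have one: "(c * z) powr p \<le> c * z powr p" if "0 < c" "c \<le> 1" "z \<ge> 0" for c z :: real
  proof -
    have "c powr p \<le> c powr 1"
      using that assms(1) by (intro powr_mono') auto
    then show ?thesis
      using that by (simp add: powr_mult mult_right_mono)
  qed
  show ?thesis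
  proof (cases "x = 0 \<or> y = 0")
    case True
    then show ?thesis
      using one[of a x] one[of b y] assms by auto
  next
    case False
    have a: "a = 1 - b"
      using assms by simp
    show ?thesis
      using convex_onD[OF powr_convex[OF assms(1)], of b x y] assms False
      unfolding a by simp
  qed
qed

section \<open>The weighted area measure on the disk\<close>

lemma space_dA [simp]: "space (dA \<alpha>) = disk"
  by (simp add: dA_def space_restrict_space)

lemma sets_dA [measurable_cong]: "sets (dA \<alpha>) = sets (restrict_space borel disk)"
  by (simp add: dA_def cong: sets_restrict_space_cong)

lemma measurable_dA_of_continuous [intro]:
  assumes "continuous_on disk f"
  shows "f \<in> borel_measurable (dA \<alpha>)"
  using borel_measurable_continuous_on_restrict[OF assms] measurable_cong_sets[OF sets_dA refl]
  by blast

lemma measurable_dA_of_borel [intro]: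
  "f \<in> borel_measurable borel \<Longrightarrow> f \<in> borel_measurable (dA \<alpha>)"
  using measurable_restrict_space1[of f borel borel disk] measurable_cong_sets[OF sets_dA refl]
  by blast

text \<open>Kept as a function on the whole plane, so that integrals over the disk become integrals
  over the plane with an indicator, where Fubini and affine substitutions apply.\<close>

definition dA_weight :: "real \<Rightarrow> complex \<Rightarrow> real" where
  "dA_weight \<alpha> z = (1 + \<alpha>) * (1 - (cmod z)\<^sup>2) powr \<alpha> / pi"

lemma dA_weight_measurable [measurable]: "dA_weight \<alpha> \<in> borel_measurable borel"
  unfolding dA_weight_def by measurable

lemma nn_integral_dA:
  assumes "f \<in> borel_measurable (dA \<alpha>)"
  shows "(\<integral>\<^sup>+z. f z \<partial>dA \<alpha>) = (\<integral>\<^sup>+z. ennreal (dA_weight \<alpha> z) * f z * indicator disk z \<partial>lborel)"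
proof -
  have f: "f \<in> borel_measurable (restrict_space lborel disk)"
    using assms measurable_cong_sets[OF sets_dA refl]
    by (metis measurable_lborel1 sets_lborel sets_restrict_space_cong measurable_cong_sets)
  have w: "(\<lambda>z. ennreal (dA_weight \<alpha> z)) \<in> borel_measurable (restrict_space lborel disk)"
    by (intro measurable_restrict_space1) measurable
  show ?thesis
    unfolding dA_def dA_weight_def[symmetric]
    using f w by (simp add: nn_integral_density nn_integral_restrict_space)
qed

lemma dA_weight_nonneg:
  assumes "\<alpha> \<ge> 0"
  shows "dA_weight \<alpha> z \<ge> 0"
  using assms by (simp add: dA_weight_def)

lemma dA_weight_le:
  assumes "\<alpha> \<ge> 0" "z \<in> disk"
  shows "dA_weight \<alpha> z \<le> 1 + \<alpha>"
proof -
  have "(1 - (cmod z)\<^sup>2) powr \<alpha> \<le> 1 powr \<alpha>"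
    using assms by (intro powr_mono2) (auto simp: power_le_one)
  then have "(1 + \<alpha>) * (1 - (cmod z)\<^sup>2) powr \<alpha> \<le> (1 + \<alpha>) * 1"
    using assms by (intro mult_left_mono) auto
  also have "\<dots> \<le> (1 + \<alpha>) * pi"
    using pi_ge_two assms by (intro mult_left_mono) auto
  finally show ?thesis
    by (simp add: dA_weight_def divide_le_eq)
qed

lemma emeasure_disk_finite: "emeasure lborel disk < \<infinity>"
  by (simp add: emeasure_ball)

lemma finite_measure_dA:
  assumes "\<alpha> \<ge> 0"
  shows "finite_measure (dA \<alpha>)"
proof
  have "emeasure (dA \<alpha>) (space (dA \<alpha>)) = (\<integral>\<^sup>+z. 1 \<partial>dA \<alpha>)"
    by simp
  also have "\<dots> = (\<integral>\<^sup>+z. ennreal (dA_weight \<alpha> z) * 1 * indicator disk z \<partial>lborel)"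
    by (rule nn_integral_dA) simp
  also have "\<dots> \<le> (\<integral>\<^sup>+z. ennreal (1 + \<alpha>) * indicator disk z \<partial>lborel)"
    using assms dA_weight_le by (intro nn_integral_mono) (auto simp: indicator_def simp del: ennreal_plus intro!: ennreal_leI)
  also have "\<dots> = ennreal (1 + \<alpha>) * emeasure lborel disk"
    by (subst nn_integral_cmult_indicator) auto
  also have "\<dots> < \<infinity>"
    using emeasure_disk_finite by (simp add: ennreal_mult_less_top)
  finally show "emeasure (dA \<alpha>) (space (dA \<alpha>)) \<noteq> \<infinity>"
    by simp
qed

text \<open>For a measurable function whose p-th power is not integrable,
  \<open>bergman_norm\<close> is 0, since the integral then takes its default value. Inequalities
  that bound a norm therefore have to come with membership in this set.\<close>

definition Lp :: "real \<Rightarrow> real \<Rightarrow> (complex \<Rightarrow> complex) set" where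
  "Lp p \<alpha> = {f. f \<in> borel_measurable (dA \<alpha>) \<and> integrable (dA \<alpha>) (\<lambda>z. cmod (f z) powr p)}"

lemma bergman_subset_Lp: "bergman_space p \<alpha> \<subseteq> Lp p \<alpha>"
  by (auto simp: bergman_space_def Lp_def intro: holomorphic_on_imp_continuous_on)

lemma LpD:
  assumes "f \<in> Lp p \<alpha>"
  shows "f \<in> borel_measurable (dA \<alpha>)" "integrable (dA \<alpha>) (\<lambda>z. cmod (f z) powr p)"
  using assms by (auto simp: Lp_def)

lemma bergman_norm_nonneg [simp]: "bergman_norm p \<alpha> f \<ge> 0"
  by (simp add: bergman_norm_def)

lemma bergman_norm_cong:
  assumes "\<And>z. z \<in> disk \<Longrightarrow> cmod (f z) = cmod (g z)"
  shows "bergman_norm p \<alpha> f = bergman_norm p \<alpha> g"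
  unfolding bergman_norm_def using assms by (auto intro!: Bochner_Integration.integral_cong arg_cong[where f="\<lambda>x. x powr _"])

section \<open>Minkowski's inequality and convergence theorems for the seminorm\<close>

locale bergman =
  fixes p \<alpha> :: real
  assumes p: "p > 1" and \<alpha>: "\<alpha> \<ge> 0"
begin

abbreviation "\<mu> \<equiv> dA \<alpha>"
abbreviation "N \<equiv> bergman_norm p \<alpha>"
abbreviation "A \<equiv> bergman_space p \<alpha>"
abbreviation "L \<equiv> Lp p \<alpha>"

sublocale finite_measure \<mu>
  using \<alpha> by (rule finite_measure_dA)

lemma A_L: "f \<in> A \<Longrightarrow> f \<in> L"
  using bergman_subset_Lp by auto

lemma N_powr: "N f powr p = (LINT z|\<mu>. cmod (f z) powr p)"
  using p by (simp add: bergman_norm_def powr_powr)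

lemma N_le_iff:
  assumes "B \<ge> 0"
  shows "N f \<le> B \<longleftrightarrow> (LINT z|\<mu>. cmod (f z) powr p) \<le> B powr p"
  using p assms N_powr[of f] powr_mono2[of p "N f" B] powr_less_mono2[of p B "N f"] by fastforce

lemma N_mono:
  assumes "f \<in> borel_measurable \<mu>" "g \<in> L" "\<And>z. z \<in> disk \<Longrightarrow> cmod (f z) \<le> cmod (g z)"
  shows "f \<in> L" "N f \<le> N g"
proof -
  have *: "integrable \<mu> (\<lambda>z. cmod (f z) powr p)"
    using assms p by (intro Bochner_Integration.integrable_bound[OF LpD(2)[OF assms(2)]])
      (auto intro!: powr_mono2)
  then show "f \<in> L"
    using assms(1) by (simp add: Lp_def)
  have "(LINT z|\<mu>. cmod (f z) powr p) \<le> (LINT z|\<mu>. cmod (g z) powr p)"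
    using assms p * LpD(2)[OF assms(2)] by (intro integral_mono) (auto intro!: powr_mono2)
  then show "N f \<le> N g"
    using p unfolding bergman_norm_def by (intro powr_mono2) (auto intro!: integral_nonneg_AE)
qed

lemma L_cmult:
  assumes "f \<in> L"
  shows "(\<lambda>z. c * f z) \<in> L"
  using assms LpD[OF assms] unfolding Lp_def by (auto simp: norm_mult powr_mult)

lemma N_cmult: "N (\<lambda>z. c * f z) = cmod c * N f"
proof -
  have "(LINT z|\<mu>. cmod (c * f z) powr p) = cmod c powr p * (LINT z|\<mu>. cmod (f z) powr p)"
    by (simp add: norm_mult powr_mult)
  then show ?thesis
    using p by (simp add: bergman_norm_def powr_mult powr_powr)
qed

lemma N_zero [simp]: "N (\<lambda>z. 0) = 0"
  by (simp add: bergman_norm_def)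

text \<open>Minkowski's inequality by convexity: the sum divided by \<open>a + b\<close> is a convex
  combination of \<open>f z / a\<close> and \<open>g z / b\<close> with weights
  \<open>a / (a + b)\<close> and \<open>b / (a + b)\<close>, and both rescaled functions have norm
  below one. Strict bounds keep the divisors positive even when a norm is zero.\<close>

lemma L_add_aux:
  assumes f: "f \<in> L" and g: "g \<in> L" and ab: "a > N f" "b > N g"
  shows "(\<lambda>z. f z + g z) \<in> L \<and> N (\<lambda>z. f z + g z) \<le> a + b"
proof -
  have pos: "a > 0" "b > 0"
    using ab bergman_norm_nonneg[of p \<alpha> f] bergman_norm_nonneg[of p \<alpha> g] by linarith+
  note [measurable] = LpD(1)[OF f] LpD(1)[OF g]
  let ?h = "\<lambda>z. (a + b) powr p * (a / (a + b) * (cmod (f z) powr p / a powr p)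
                + b / (a + b) * (cmod (g z) powr p / b powr p))"
  have h_int: "integrable \<mu> ?h"
    using LpD(2)[OF f] LpD(2)[OF g] by (intro Bochner_Integration.integrable_add integrable_mult_right integrable_divide)
  have le: "cmod (f z + g z) powr p \<le> ?h z" for z
  proof -
    have eq: "(a + b) * (a / (a + b) * (x / a) + b / (a + b) * (y / b)) = x + y" for x y
    proof -
      have "a / (a + b) * (x / a) + b / (a + b) * (y / b) = (x + y) / (a + b)"
        using pos by (simp add: add_divide_distrib)
      then show ?thesis using pos by simp
    qed
    have "cmod (f z + g z) powr p \<le> ((a + b) * (a / (a + b) * (cmod (f z) / a) + b / (a + b) * (cmod (g z) / b))) powr p"
      using p norm_triangle_ineq[of "f z" "g z"] unfolding eq by (intro powr_mono2) auto
    also have "\<dots> = (a + b) powr p * (a / (a + b) * (cmod (f z) / a) + b / (a + b) * (cmod (g z) / b)) powr p"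
      using pos by (intro powr_mult)
    also have "\<dots> \<le> (a + b) powr p * (a / (a + b) * (cmod (f z) / a) powr p + b / (a + b) * (cmod (g z) / b) powr p)"
      using pos p by (intro mult_left_mono powr_convex_combination) (auto simp: add_divide_distrib[symmetric])
    finally show ?thesis
      using pos by (simp add: powr_divide)
  qed
  have int: "integrable \<mu> (\<lambda>z. cmod (f z + g z) powr p)"
  proof (intro Bochner_Integration.integrable_bound[OF h_int] AE_I2)
    fix z
    have "norm (cmod (f z + g z) powr p) = cmod (f z + g z) powr p"
      by simp
    then show "norm (cmod (f z + g z) powr p) \<le> norm (?h z)"
      unfolding real_norm_def[of "?h z"] using order_trans[OF le abs_ge_self] by presburger
  qed measurable
  have "(LINT z|\<mu>. cmod (f z + g z) powr p) \<le> (LINT z|\<mu>. ?h z)"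
    using le by (intro integral_mono int h_int) auto
  also have "\<dots> = (a + b) powr p * (a / (a + b) * (N f powr p / a powr p) + b / (a + b) * (N g powr p / b powr p))"
    using LpD(2)[OF f] LpD(2)[OF g] by (simp add: N_powr)
  also have "\<dots> \<le> (a + b) powr p * (a / (a + b) * 1 + b / (a + b) * 1)"
    using pos p ab by (intro mult_left_mono add_mono) (auto intro!: powr_mono2)
  also have "\<dots> = (a + b) powr p"
    using pos by (simp add: add_divide_distrib[symmetric])
  finally show ?thesis
    using int pos by (subst N_le_iff) (auto simp: Lp_def)
qed

lemma L_add:
  assumes "f \<in> L" "g \<in> L"
  shows "(\<lambda>z. f z + g z) \<in> L"
  using L_add_aux[OF assms, of "N f + 1" "N g + 1"] by auto

lemma N_triangle:
  assumes "f \<in> L" "g \<in> L"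
  shows "N (\<lambda>z. f z + g z) \<le> N f + N g"
proof (rule field_le_epsilon)
  fix e :: real assume "e > 0"
  then show "N (\<lambda>z. f z + g z) \<le> N f + N g + e"
    using L_add_aux[OF assms, of "N f + e/2" "N g + e/2"] by auto
qed

lemma L_diff:
  assumes "f \<in> L" "g \<in> L"
  shows "(\<lambda>z. f z - g z) \<in> L"
  using L_add[OF assms(1) L_cmult[OF assms(2), of "-1"]] by simp

lemma N_minus_commute: "N (\<lambda>z. f z - g z) = N (\<lambda>z. g z - f z)"
  by (rule bergman_norm_cong) (simp add: norm_minus_commute)

lemma N_triangle_diff:
  assumes "f \<in> L" "g \<in> L" "h \<in> L"
  shows "N (\<lambda>z. f z - h z) \<le> N (\<lambda>z. f z - g z) + N (\<lambda>z. g z - h z)"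
  using N_triangle[OF L_diff[OF assms(1,2)] L_diff[OF assms(2,3)]] by simp

lemma N_diff_le:
  assumes "f \<in> L" "g \<in> L"
  shows "N (\<lambda>z. f z - g z) \<le> N f + N g"
  using N_triangle[OF assms(1) L_cmult[OF assms(2), of "-1"]] N_cmult[of "-1" g] by simp

lemma N_abs_diff:
  assumes "f \<in> L" "g \<in> L"
  shows "\<bar>N f - N g\<bar> \<le> N (\<lambda>z. f z - g z)"
  using N_triangle[OF L_diff[OF assms] assms(2)] N_triangle[OF L_diff[OF assms(2,1)] assms(1)]
    N_minus_commute[of f g] by simp

lemma L_zero [simp]: "(\<lambda>z. 0) \<in> L"
  by (simp add: Lp_def)

lemma L_const [simp]: "(\<lambda>z. c) \<in> L"
  by (simp add: Lp_def)

lemma L_sum: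
  assumes "\<And>i. i \<in> I \<Longrightarrow> f i \<in> L"
  shows "(\<lambda>z. \<Sum>i\<in>I. f i z) \<in> L"
  using assms by (induction I rule: infinite_finite_induct) (auto intro!: L_add)

lemma N_sum:
  assumes "\<And>i. i \<in> I \<Longrightarrow> f i \<in> L"
  shows "N (\<lambda>z. \<Sum>i\<in>I. f i z) \<le> (\<Sum>i\<in>I. N (f i))"
  using assms
proof (induction I rule: infinite_finite_induct)
  case (insert i I)
  then have "N (\<lambda>z. f i z + (\<Sum>i\<in>I. f i z)) \<le> N (f i) + N (\<lambda>z. \<Sum>i\<in>I. f i z)"
    by (intro N_triangle L_sum) auto
  with insert show ?case by (simp add: insert_commute)
qed auto

lemma L_bounded_mult:
  assumes "f \<in> L" "h \<in> borel_measurable \<mu>" "B \<ge> 0" "\<And>z. z \<in> disk \<Longrightarrow> cmod (h z) \<le> B"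
  shows "(\<lambda>z. h z * f z) \<in> L" "N (\<lambda>z. h z * f z) \<le> B * N f"
proof -
  note [measurable] = LpD(1)[OF assms(1)] assms(2)
  have *: "cmod (h z * f z) \<le> cmod (of_real B * f z)" if "z \<in> disk" for z
    using assms(3) assms(4)[of z] that by (auto simp: norm_mult intro!: mult_right_mono)
  have m: "(\<lambda>z. h z * f z) \<in> borel_measurable \<mu>"
    by measurable
  show "(\<lambda>z. h z * f z) \<in> L"
    by (rule N_mono(1)[OF m L_cmult[OF assms(1), of "of_real B"] *])
  have "N (\<lambda>z. h z * f z) \<le> N (\<lambda>z. of_real B * f z)"
    by (rule N_mono(2)[OF m L_cmult[OF assms(1), of "of_real B"] *])
  then show "N (\<lambda>z. h z * f z) \<le> B * N f"
    using assms(3) by (simp add: N_cmult)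
qed

lemma N_tendsto_0_dominated:
  fixes f :: "nat \<Rightarrow> complex \<Rightarrow> complex"
  assumes "\<And>n. f n \<in> borel_measurable \<mu>" "g \<in> L"
    and "\<And>n z. z \<in> disk \<Longrightarrow> cmod (f n z) \<le> cmod (g z)"
    and "\<And>z. z \<in> disk \<Longrightarrow> (\<lambda>n. f n z) \<longlonglongrightarrow> 0"
  shows "(\<lambda>n. N (f n)) \<longlonglongrightarrow> 0"
proof -
  note [measurable] = assms(1) LpD(1)[OF assms(2)]
  have "(\<lambda>n. LINT z|\<mu>. cmod (f n z) powr p) \<longlonglongrightarrow> (LINT z|\<mu>. 0)"
  proof (rule integral_dominated_convergence)
    show "integrable \<mu> (\<lambda>z. cmod (g z) powr p)"
      by (rule LpD(2)[OF assms(2)])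
    have "(\<lambda>n. cmod (f n z) powr p) \<longlonglongrightarrow> 0 powr p" if "z \<in> disk" for z
      using p by (intro tendsto_powr' tendsto_norm_zero assms(4)[OF that] tendsto_const) auto
    then show "AE z in \<mu>. (\<lambda>n. cmod (f n z) powr p) \<longlonglongrightarrow> 0"
      by (intro AE_I2) simp
    show "AE z in \<mu>. norm (cmod (f n z) powr p) \<le> cmod (g z) powr p" for n
      using assms(3) p by (intro AE_I2) (auto intro!: powr_mono2)
  qed measurable
  then have "(\<lambda>n. (LINT z|\<mu>. cmod (f n z) powr p) powr (1/p)) \<longlonglongrightarrow> 0 powr (1/p)"
    using p by (intro tendsto_powr' tendsto_const) (auto intro!: integral_nonneg_AE)
  then show ?thesis
    by (simp add: bergman_norm_def)
qed

text \<open>Carries a norm bound over to a pointwise limit. Completeness applies it to the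
  differences between members of a Cauchy sequence, whose pointwise limit is the distance to the
  limit function.\<close>

lemma N_fatou:
  fixes f :: "nat \<Rightarrow> complex \<Rightarrow> complex"
  assumes "\<And>n. f n \<in> L" "\<And>n. N (f n) \<le> B" "B \<ge> 0" "g \<in> borel_measurable \<mu>"
    and "\<And>z. z \<in> disk \<Longrightarrow> (\<lambda>n. f n z) \<longlonglongrightarrow> g z"
  shows "g \<in> L" "N g \<le> B"
proof -
  note [measurable] = LpD(1)[OF assms(1)] assms(4)
  have "(\<integral>\<^sup>+z. ennreal (cmod (g z) powr p) \<partial>\<mu>) = (\<integral>\<^sup>+z. liminf (\<lambda>n. ennreal (cmod (f n z) powr p)) \<partial>\<mu>)"
  proof (rule nn_integral_cong)
    fix z assume "z \<in> space \<mu>"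
    then have "(\<lambda>n. ennreal (cmod (f n z) powr p)) \<longlonglongrightarrow> ennreal (cmod (g z) powr p)"
      using assms(5) p by (intro tendsto_ennrealI tendsto_powr' tendsto_norm tendsto_const) auto
    then show "ennreal (cmod (g z) powr p) = liminf (\<lambda>n. ennreal (cmod (f n z) powr p))"
      by (rule lim_imp_Liminf[OF trivial_limit_sequentially, symmetric])
  qed
  also have "\<dots> \<le> liminf (\<lambda>n. \<integral>\<^sup>+z. ennreal (cmod (f n z) powr p) \<partial>\<mu>)"
    by (rule nn_integral_liminf) measurable
  also have "\<dots> \<le> ennreal (B powr p)"
  proof (rule Liminf_le)
    show "\<forall>\<^sub>F n in sequentially. (\<integral>\<^sup>+z. ennreal (cmod (f n z) powr p) \<partial>\<mu>) \<le> ennreal (B powr p)"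
      using assms(2,3) LpD(2)[OF assms(1)]
      by (intro always_eventually allI) (subst nn_integral_eq_integral, auto intro!: ennreal_leI simp: N_le_iff)
  qed simp
  finally have *: "(\<integral>\<^sup>+z. ennreal (cmod (g z) powr p) \<partial>\<mu>) \<le> ennreal (B powr p)" .
  then have int: "integrable \<mu> (\<lambda>z. cmod (g z) powr p)"
    by (intro integrableI_nonneg) (auto simp: top_unique less_top order_le_less_trans)
  then show "g \<in> L"
    by (simp add: Lp_def)
  show "N g \<le> B"
    using * int by (subst N_le_iff[OF assms(3)]) (subst (asm) nn_integral_eq_integral, auto)
qed

lemma A_add_scale:
  assumes "f \<in> A" "g \<in> A"
  shows "(\<lambda>z. a * f z + b * g z) \<in> A"
  using assms L_add[OF L_cmult[OF A_L[OF assms(1)], of a] L_cmult[OF A_L[OF assms(2)], of b]]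
  by (auto simp: bergman_space_def Lp_def intro!: holomorphic_intros)

lemma A_diff: "f \<in> A \<Longrightarrow> g \<in> A \<Longrightarrow> (\<lambda>z. f z - g z) \<in> A"
  using A_add_scale[of f g 1 "-1"] by simp

lemma A_cmult: "f \<in> A \<Longrightarrow> (\<lambda>z. a * f z) \<in> A"
  using A_add_scale[of f f a 0] by simp

lemma A_iff_L: "f \<in> A \<longleftrightarrow> f holomorphic_on disk \<and> f \<in> L"
  by (auto simp: bergman_space_def Lp_def intro: holomorphic_on_imp_continuous_on)

lemma A_zero [simp]: "(\<lambda>z. 0) \<in> A"
  by (simp add: A_iff_L)

end

section \<open>Rotation invariance and the mean value property\<close>

lemma lborel_complex_eq_distr:
  "distr (lborel \<Otimes>\<^sub>M lborel) borel (\<lambda>(x, y). Complex x y) = lborel"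
proof (rule lborel_eqI[symmetric])
  have [measurable]: "(\<lambda>(x, y). Complex x y) \<in> borel_measurable (lborel \<Otimes>\<^sub>M lborel)"
    unfolding lborel_prod measurable_lborel2 case_prod_unfold
    by (intro borel_measurable_continuous_onI continuous_intros)
  fix l u :: complex
  assume le: "\<And>b. b \<in> Basis \<Longrightarrow> l \<bullet> b \<le> u \<bullet> b"
  have le': "Re l \<le> Re u" "Im l \<le> Im u"
    using le[of 1] le[of \<i>] by (auto simp: Basis_complex_def)
  have "(\<lambda>(x, y). Complex x y) -` box l u \<inter> space (lborel \<Otimes>\<^sub>M lborel)
        = {Re l<..<Re u} \<times> {Im l<..<Im u}"
    by (auto simp: box_def Basis_complex_def space_pair_measure)
  then show "emeasure (distr (lborel \<Otimes>\<^sub>M lborel) borel (\<lambda>(x, y). Complex x y)) (box l u)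
      = ennreal (\<Prod>b\<in>Basis. (u - l) \<bullet> b)"
    using le' by (simp add: emeasure_distr lborel.emeasure_pair_measure_Times Basis_complex_def ennreal_mult)
qed simp

lemma nn_integral_lborel_complex:
  fixes f :: "complex \<Rightarrow> ennreal"
  assumes [measurable]: "f \<in> borel_measurable borel"
  shows "(\<integral>\<^sup>+z. f z \<partial>lborel) = (\<integral>\<^sup>+x. \<integral>\<^sup>+y. f (Complex x y) \<partial>lborel \<partial>lborel)"
    and "(\<integral>\<^sup>+z. f z \<partial>lborel) = (\<integral>\<^sup>+y. \<integral>\<^sup>+x. f (Complex x y) \<partial>lborel \<partial>lborel)"
proof -
  have [measurable]: "(\<lambda>(x, y). Complex x y) \<in> borel_measurable (lborel \<Otimes>\<^sub>M lborel)"
    unfolding lborel_prod measurable_lborel2 case_prod_unfold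
    by (intro borel_measurable_continuous_onI continuous_intros)
  have m: "(\<lambda>(x, y). f (Complex x y)) \<in> borel_measurable (lborel \<Otimes>\<^sub>M lborel)"
    using measurable_compose[OF \<open>(\<lambda>(x, y). Complex x y) \<in> _\<close> assms] by (simp add: case_prod_unfold)
  have "(\<integral>\<^sup>+z. f z \<partial>lborel) = (\<integral>\<^sup>+q. (case q of (x, y) \<Rightarrow> f (Complex x y)) \<partial>(lborel \<Otimes>\<^sub>M lborel))"
    by (subst lborel_complex_eq_distr[symmetric], subst nn_integral_distr) (simp_all add: case_prod_unfold)
  then show "(\<integral>\<^sup>+z. f z \<partial>lborel) = (\<integral>\<^sup>+x. \<integral>\<^sup>+y. f (Complex x y) \<partial>lborel \<partial>lborel)"
    and "(\<integral>\<^sup>+z. f z \<partial>lborel) = (\<integral>\<^sup>+y. \<integral>\<^sup>+x. f (Complex x y) \<partial>lborel \<partial>lborel)"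
    using lborel.nn_integral_fst[OF m] lborel_pair.nn_integral_snd[OF m] by simp_all
qed

text \<open>On every line parallel to its axis a shear is a translation. Fubini, in the order that
  integrates along these lines first, reduces the claim to translation invariance on the real
  line.\<close>

lemma lborel_distr_shear:
  "distr lborel borel (\<lambda>z. Complex (Re z + a * Im z) (Im z)) = lborel" (is "distr _ _ ?f = _")
  "distr lborel borel (\<lambda>z. Complex (Re z) (Im z + a * Re z)) = lborel" (is "distr _ _ ?g = _")
proof -
  have m [measurable]: "?f \<in> borel_measurable borel" "?g \<in> borel_measurable borel"
    by (intro borel_measurable_continuous_onI continuous_intros)+
  show "distr lborel borel ?f = lborel"
  proof (rule measure_eqI)
    fix B assume "B \<in> sets (distr lborel borel ?f)"
    then have B [measurable]: "B \<in> sets borel" by simp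
    have "emeasure (distr lborel borel ?f) B = (\<integral>\<^sup>+z. indicator B z \<partial>distr lborel borel ?f)"
      using B by simp
    also have "\<dots> = (\<integral>\<^sup>+z. indicator B (?f z) \<partial>lborel)"
      by (rule nn_integral_distr) auto
    also have "\<dots> = (\<integral>\<^sup>+y. \<integral>\<^sup>+x. indicator B (Complex (x + a * y) y) \<partial>lborel \<partial>lborel)"
      by (subst nn_integral_lborel_complex(2)) simp_all
    also have "\<dots> = (\<integral>\<^sup>+y. \<integral>\<^sup>+x. indicator B (Complex x y) \<partial>lborel \<partial>lborel)"
    proof (rule nn_integral_cong)
      fix y
      have [measurable]: "(\<lambda>x. Complex x y) \<in> borel_measurable borel"
        by (intro borel_measurable_continuous_onI continuous_intros)
      show "(\<integral>\<^sup>+x. indicator B (Complex (x + a * y) y) \<partial>lborel) = (\<integral>\<^sup>+x. indicator B (Complex x y) \<partial>lborel)"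
        by (subst nn_integral_real_affine[where c=1 and t="a * y"]) (simp_all add: add.commute)
    qed
    also have "\<dots> = emeasure lborel B"
      by (subst nn_integral_lborel_complex(2)[symmetric]) simp_all
    finally show "emeasure (distr lborel borel ?f) B = emeasure lborel B" .
  qed simp
  show "distr lborel borel ?g = lborel"
  proof (rule measure_eqI)
    fix B assume "B \<in> sets (distr lborel borel ?g)"
    then have B [measurable]: "B \<in> sets borel" by simp
    have "emeasure (distr lborel borel ?g) B = (\<integral>\<^sup>+z. indicator B z \<partial>distr lborel borel ?g)"
      using B by simp
    also have "\<dots> = (\<integral>\<^sup>+z. indicator B (?g z) \<partial>lborel)"
      by (rule nn_integral_distr) auto
    also have "\<dots> = (\<integral>\<^sup>+x. \<integral>\<^sup>+y. indicator B (Complex x (y + a * x)) \<partial>lborel \<partial>lborel)"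
      by (subst nn_integral_lborel_complex(1)) simp_all
    also have "\<dots> = (\<integral>\<^sup>+x. \<integral>\<^sup>+y. indicator B (Complex x y) \<partial>lborel \<partial>lborel)"
    proof (rule nn_integral_cong)
      fix x
      have [measurable]: "(\<lambda>y. Complex x y) \<in> borel_measurable borel"
        by (intro borel_measurable_continuous_onI continuous_intros)
      show "(\<integral>\<^sup>+y. indicator B (Complex x (y + a * x)) \<partial>lborel) = (\<integral>\<^sup>+y. indicator B (Complex x y) \<partial>lborel)"
        by (subst nn_integral_real_affine[where c=1 and t="a * x"]) (simp_all add: add.commute)
    qed
    also have "\<dots> = emeasure lborel B"
      by (subst nn_integral_lborel_complex(1)[symmetric]) simp_all
    finally show "emeasure (distr lborel borel ?g) B = emeasure lborel B" .
  qed simp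
qed

text \<open>A rotation by an angle that is not a multiple of \<open>\<pi>\<close> is a product of three shears.\<close>

lemma lborel_distr_rotation:
  assumes "sin t \<noteq> 0"
  shows "distr lborel borel ((*) (cis t)) = lborel"
proof -
  \<comment> \<open>This is \<open>- tan (t / 2)\<close>. Shearing by \<open>a\<close>, by
    \<open>sin t\<close> and by \<open>a\<close> again gives the rotation once
    \<open>1 + a * sin t = cos t\<close> and \<open>a * (1 + cos t) = - sin t\<close>.\<close>
  define a where "a = (cos t - 1) / sin t"
  let ?f = "\<lambda>z. Complex (Re z + a * Im z) (Im z)" and ?g = "\<lambda>z. Complex (Re z) (Im z + sin t * Re z)"
  have m [measurable]: "?f \<in> borel_measurable borel" "?g \<in> borel_measurable borel"
    by (intro borel_measurable_continuous_onI continuous_intros)+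
  have as: "1 + a * sin t = cos t"
    using assms by (simp add: a_def)
  have "(cos t - 1) * (1 + cos t) = - sin t * sin t"
    using sin_cos_squared_add[of t] by (simp add: power2_eq_square algebra_simps)
  then have "a * (1 + cos t) = - sin t * sin t / sin t"
    by (metis a_def times_divide_eq_left)
  then have a2: "a * (1 + cos t) = - sin t"
    using assms by simp
  have "(*) (cis t) = ?f \<circ> (?g \<circ> ?f)"
  proof
    fix z
    have "Re z + a * Im z + a * (Im z + sin t * (Re z + a * Im z))
        = (1 + a * sin t) * Re z + a * (1 + (1 + a * sin t)) * Im z"
      by (simp add: algebra_simps)
    also have "\<dots> = cos t * Re z - sin t * Im z"
      unfolding as a2 by simp
    finally have 1: "Re z + a * Im z + a * (Im z + sin t * (Re z + a * Im z)) = cos t * Re z - sin t * Im z" .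
    have "Im z + sin t * (Re z + a * Im z) = (1 + a * sin t) * Im z + sin t * Re z"
      by (simp add: algebra_simps)
    then have 2: "Im z + sin t * (Re z + a * Im z) = cos t * Im z + sin t * Re z"
      unfolding as .
    show "cis t * z = (?f \<circ> (?g \<circ> ?f)) z"
      using 1 2 by (simp add: complex_eq_iff)
  qed
  then have "distr lborel borel ((*) (cis t)) = distr (distr (distr lborel borel ?f) borel ?g) borel ?f"
    by (simp add: distr_distr)
  then show ?thesis
    by (simp add: lborel_distr_shear)
qed

lemma lborel_distr_uminus_complex: "distr lborel borel (uminus :: complex \<Rightarrow> complex) = lborel"
  using lborel_affine[of "-1" "0::complex"] by (simp add: density_1)

section \<open>The mean value property over disks\<close>

lemma emeasure_ball_complex:
  assumes "r \<ge> 0"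
  shows "emeasure lborel (ball (a::complex) r) = ennreal (pi * r\<^sup>2)"
  using assms by (simp add: emeasure_ball unit_ball_vol_2)

text \<open>The rotation by \<open>pi / (2 * n)\<close> preserves the ball and multiplies
  \<open>w ^ n\<close> by \<open>\<i>\<close>, so the integral equals \<open>\<i>\<close> times
  itself. This angle is never a multiple of \<open>pi\<close>, as the decomposition into shears
  requires.\<close>

lemma integral_ball_power_eq_0:
  assumes "n > 0"
  shows "(LINT w|lborel. indicator (ball 0 r) w *\<^sub>R (w::complex) ^ n) = 0" (is "?J = 0")
proof -
  define \<omega> where "\<omega> = cis (pi / (2 * real n))"
  have n: "pi / (2 * real n) > 0" "pi / (2 * real n) < pi"
    using assms by (auto simp: field_simps)
  have inv: "distr lborel borel ((*) \<omega>) = lborel"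
    unfolding \<omega>_def using sin_gt_zero[OF n] by (intro lborel_distr_rotation) simp
  have "real n * (pi / (2 * real n)) = pi / 2"
    using assms by simp
  then have wn: "\<omega> ^ n = \<i>"
    unfolding \<omega>_def Complex.DeMoivre by (simp only: cis_pi_half)
  have "(\<lambda>w::complex. w ^ n) \<in> borel_measurable borel"
    by (intro borel_measurable_continuous_onI continuous_intros)
  then have m: "(\<lambda>w::complex. indicator (ball 0 r) w *\<^sub>R w ^ n) \<in> borel_measurable borel"
    by (intro borel_measurable_scaleR borel_measurable_indicator) auto
  have [measurable]: "(*) \<omega> \<in> borel_measurable borel"
    by measurable
  have "?J = (LINT w|distr lborel borel ((*) \<omega>). indicator (ball 0 r) w *\<^sub>R w ^ n)"
    by (simp add: inv)
  also have "\<dots> = (LINT w|lborel. indicator (ball 0 r) (\<omega> * w) *\<^sub>R (\<omega> * w) ^ n)"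
    by (rule integral_distr) (use m in auto)
  also have "\<dots> = (LINT w|lborel. \<i> * (indicator (ball 0 r) w *\<^sub>R w ^ n))"
    by (intro Bochner_Integration.integral_cong)
       (auto simp: indicator_def norm_mult \<omega>_def power_mult_distrib wn[unfolded \<omega>_def])
  also have "\<dots> = \<i> * ?J"
    by (rule integral_mult_right_zero)
  finally have "(1 - \<i>) * ?J = 0"
    by (simp add: algebra_simps)
  then show ?thesis
    by (auto simp: complex_eq_iff)
qed

text \<open>The Taylor series is integrated term by term, and only the constant term survives. The
  room between \<open>r\<close> and \<open>R\<close> makes the series converge absolutely at radius
  \<open>r\<close>, which justifies the exchange of sum and integral.\<close>

lemma mean_value_ball_0:
  assumes f: "f holomorphic_on ball 0 R" and r: "0 < r" "r < R"
  shows "(LINT w|lborel. indicator (ball 0 r) w *\<^sub>R f w) = of_real (pi * r\<^sup>2) * f 0"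
proof -
  define a where "a n = (deriv ^^ n) f 0 / fact n" for n
  have sums: "(\<lambda>n. a n * w ^ n) sums f w" if "w \<in> ball 0 R" for w
    using holomorphic_power_series[OF f that] by (simp add: a_def)
  define \<rho> where "\<rho> = (r + R) / 2"
  have \<rho>: "r < \<rho>" "\<rho> < R" "0 < \<rho>"
    using r by (auto simp: \<rho>_def)
  have "summable (\<lambda>n. a n * of_real \<rho> ^ n)"
    using sums[of "of_real \<rho>"] \<rho> by (auto intro: sums_summable)
  then have "summable (\<lambda>n. norm (a n * of_real r ^ n))"
    by (rule powser_insidea) (use r \<rho> in auto)
  then have summ: "summable (\<lambda>n. cmod (a n) * r ^ n)"
    using r by (simp add: norm_mult norm_power)
  let ?g = "\<lambda>n w. indicator (ball 0 r) w *\<^sub>R (a n * w ^ n)"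
  have int: "integrable lborel (?g n)" for n
  proof -
    have "integrable lborel (\<lambda>w::complex. indicator (ball 0 r) w *\<^sub>R (cmod (a n) * r ^ n))"
      using emeasure_ball_complex[of r 0] r by (intro integrable_mult_right integrable_real_indicator integrable_scaleR_left) auto
    then show ?thesis
    proof (rule Bochner_Integration.integrable_bound)
      show "AE w in lborel. norm (?g n w) \<le> norm (indicator (ball 0 r) w *\<^sub>R (cmod (a n) * r ^ n))"
        using r by (intro AE_I2) (auto simp: indicator_def norm_mult norm_power intro!: mult_left_mono power_mono)
      have "(\<lambda>w. a n * w ^ n) \<in> borel_measurable lborel"
        unfolding measurable_lborel2 by (intro borel_measurable_continuous_onI continuous_intros)
      then show "?g n \<in> borel_measurable lborel"
        by (intro borel_measurable_scaleR borel_measurable_indicator) auto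
    qed
  qed
  have le: "norm (?g n w) \<le> cmod (a n) * r ^ n" for n w
    using r by (auto simp: indicator_def norm_mult norm_power intro!: mult_left_mono power_mono)
  have summ2: "summable (\<lambda>n. LINT w|lborel. norm (?g n w))"
  proof (rule summable_comparison_test')
    show "summable (\<lambda>n. cmod (a n) * r ^ n * (pi * r\<^sup>2))"
      by (intro summable_mult2 summ)
    fix n
    have "(LINT w|lborel. norm (?g n w)) \<le> (LINT w|lborel. indicator (ball 0 r) (w::complex) * (cmod (a n) * r ^ n))"
    proof (rule integral_mono)
      show "integrable lborel (\<lambda>w::complex. indicator (ball 0 r) w * (cmod (a n) * r ^ n))"
        using emeasure_ball_complex[of r 0] r by (intro integrable_mult_left integrable_real_indicator) auto
      show "integrable lborel (\<lambda>w. norm (?g n w))"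
        by (rule integrable_norm[OF int])
      show "norm (?g n w) \<le> indicator (ball 0 r) w * (cmod (a n) * r ^ n)" for w
        using le[of w n] by (auto simp: indicator_def)
    qed
    also have "\<dots> = cmod (a n) * r ^ n * (pi * r\<^sup>2)"
      using emeasure_ball_complex[of r 0] r by (simp add: measure_def)
    finally show "norm (LINT w|lborel. norm (?g n w)) \<le> cmod (a n) * r ^ n * (pi * r\<^sup>2)"
      by simp
  qed
  have summ1: "summable (\<lambda>n. norm (?g n w))" for w
    by (rule summable_comparison_test'[OF summ]) (use le in simp)
  have "(\<lambda>n. LINT w|lborel. ?g n w) sums (LINT w|lborel. (\<Sum>n. ?g n w))"
    by (rule sums_integral) (use int summ1 summ2 in auto)
  also have "(\<lambda>w. \<Sum>n. ?g n w) = (\<lambda>w. indicator (ball 0 r) w *\<^sub>R f w)"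
  proof
    fix w :: complex
    show "(\<Sum>n. ?g n w) = indicator (ball 0 r) w *\<^sub>R f w"
      using sums[of w] r by (auto simp: indicator_def intro!: sums_unique[symmetric])
  qed
  finally have 1: "(\<lambda>n. LINT w|lborel. ?g n w) sums (LINT w|lborel. indicator (ball 0 r) w *\<^sub>R f w)" .
  have eqn: "(LINT w|lborel. ?g n w) = a n * (LINT w|lborel. indicator (ball 0 r) w *\<^sub>R w ^ n)" for n
    by (subst integral_mult_right_zero[symmetric]) (simp add: mult.commute[of "a n"] scaleR_conv_of_real mult.assoc)
  have "(LINT w|lborel. ?g n w) = (if n = 0 then f 0 * (LINT w|lborel. indicator (ball 0 r) (w::complex) *\<^sub>R 1) else 0)" for n
    unfolding eqn using integral_ball_power_eq_0[of n r] by (cases "n = 0") (simp_all add: a_def)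
  moreover have "(LINT w|lborel. indicator (ball 0 r) (w::complex) *\<^sub>R (1::complex)) = of_real (pi * r\<^sup>2)"
    using emeasure_ball_complex[of r 0] r by (simp add: scaleR_conv_of_real measure_def)
  ultimately have "(LINT w|lborel. ?g n w) = (if n = 0 then f 0 * of_real (pi * r\<^sup>2) else 0)" for n
    by presburger
  then have "(\<lambda>n. LINT w|lborel. ?g n w) = (\<lambda>n. if n = 0 then f 0 * of_real (pi * r\<^sup>2) else 0)"
    by (rule ext)
  then have "(\<lambda>n. LINT w|lborel. ?g n w) sums (f 0 * of_real (pi * r\<^sup>2))"
    using sums_single[of 0 "\<lambda>_. f 0 * of_real (pi * r\<^sup>2)"] by presburger
  from sums_unique2[OF 1 this] show ?thesis
    by (simp only: mult.commute)
qed

lemma mean_value_ball: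
  assumes f: "f holomorphic_on ball a R" and r: "0 < r" "r < R"
  shows "(LINT w|lborel. indicator (ball a r) w *\<^sub>R f w) = of_real (pi * r\<^sup>2) * f a"
proof -
  have cont: "continuous_on (ball a r) f"
    using f r by (meson holomorphic_on_imp_continuous_on continuous_on_subset subset_ball less_imp_le)
  have "(LINT w|lborel. indicator (ball a r) w *\<^sub>R f w)
      = (LINT w|distr lborel borel ((+) a). indicator (ball a r) w *\<^sub>R f w)"
    by (simp add: lborel_distr_plus)
  also have "\<dots> = (LINT w|lborel. indicator (ball a r) (a + w) *\<^sub>R f (a + w))"
    using borel_measurable_continuous_on_indicator[OF _ cont]
    by (intro integral_distr) auto
  also have "\<dots> = (LINT w|lborel. indicator (ball 0 r) w *\<^sub>R f (a + w))"
    by (intro Bochner_Integration.integral_cong) (auto simp: indicator_def dist_norm)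
  also have "\<dots> = of_real (pi * r\<^sup>2) * f (a + 0)"
  proof (rule mean_value_ball_0[OF _ r])
    show "(\<lambda>w. f (a + w)) holomorphic_on ball 0 R"
      by (intro holomorphic_on_compose_gen[OF _ f, unfolded o_def] holomorphic_intros) (auto simp: dist_norm)
  qed
  finally show ?thesis by simp
qed

section \<open>Bounded point evaluations and completeness\<close>

context bergman
begin

text \<open>The value at \<open>z\<close> is the mean over a ball of radius
  \<open>(1 - R) / 2\<close>, on which the weight is bounded below by a constant depending on
  \<open>R\<close> only. The bound is thus uniform over \<open>cball 0 R\<close>, which makes norm
  convergence locally uniform.\<close>

lemma point_evaluation_bounded:
  assumes R: "0 \<le> R" "R < 1"
  obtains C where "C > 0" "\<And>f z. f \<in> A \<Longrightarrow> z \<in> cball 0 R \<Longrightarrow> cmod (f z) \<le> C * N f"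
proof
  define r where "r = (1 - R) / 2"
  define w0 where "w0 = (1 + \<alpha>) * (1 - (R + r)\<^sup>2) powr \<alpha> / pi"
  have r: "0 < r" "R + r < 1" "r < 1 - R"
    using R by (auto simp: r_def field_simps)
  have "(R + r)\<^sup>2 < 1"
    using r R by (simp add: power_less_one_iff abs_square_less_1)
  then have w0: "w0 > 0"
    using \<alpha> by (simp add: w0_def)
  let ?C = "1 + 1 / (w0 * (pi * r\<^sup>2))"
  show "?C > 0"
    using w0 r by (simp add: add_pos_pos)
  fix f :: "complex \<Rightarrow> complex" and z :: complex
  assume f: "f \<in> A" and z: "z \<in> cball 0 R"
  have sub: "ball z r \<subseteq> ball z (1 - R)" "ball z (1 - R) \<subseteq> disk"
    using r z norm_triangle_ineq2 by (auto simp: dist_norm) (smt (verit) norm_minus_commute norm_triangle_ineq2)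
  have hol: "f holomorphic_on ball z (1 - R)"
    using f sub(2) by (auto simp: bergman_space_def elim: holomorphic_on_subset)
  have cont: "continuous_on (ball z r) f"
    using hol sub(1) holomorphic_on_imp_continuous_on continuous_on_subset by blast
  have m1: "(\<lambda>w. indicator (ball z r) w *\<^sub>R f w) \<in> borel_measurable borel"
    using borel_measurable_continuous_on_indicator[OF _ cont] by auto
  have m2: "(\<lambda>w. cmod (indicator (ball z r) w *\<^sub>R f w)) \<in> borel_measurable borel"
    using m1 by measurable
  have fL: "f \<in> L"
    using f by (rule A_L)
  have weight: "w0 \<le> dA_weight \<alpha> w" if "w \<in> ball z r" for w
  proof -
    have "cmod w \<le> R + r"
      using that z norm_triangle_ineq2[of w z] by (auto simp: dist_norm norm_minus_commute)
    then have "(cmod w)\<^sup>2 \<le> (R + r)\<^sup>2"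
      by (intro power_mono) auto
    then show ?thesis
      using \<alpha> \<open>(R + r)\<^sup>2 < 1\<close> unfolding w0_def dA_weight_def
      by (intro divide_right_mono mult_left_mono powr_mono2) auto
  qed
  have *: "cmod (f z) \<le> ?C * m" if m: "m > N f" for m
  proof -
    have m0: "m > 0"
      using m bergman_norm_nonneg[of p \<alpha> f] by linarith
    \<comment> \<open>Stands in for Hoelder's inequality: either \<open>x \<le> m\<close>, or
      \<open>x = x powr (1 - p) * x powr p\<close> with first factor at most
      \<open>m powr (1 - p)\<close>. Integrated with \<open>m\<close> just above the norm, it bounds
      the mean of the modulus by a multiple of \<open>m\<close>.\<close>
    have xp: "x \<le> m + m powr (1 - p) * x powr p" if "x \<ge> 0" for x :: real
    proof (cases "x \<le> m")
      case False
      have "m powr (1 - p) * x powr p \<ge> x powr (1 - p) * x powr p"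
        using False m0 p by (intro mult_right_mono powr_mono2') auto
      also have "x powr (1 - p) * x powr p = x"
        using False m0 by (simp flip: powr_add)
      finally show ?thesis using m0 by simp
    qed (use that in \<open>auto intro: add_increasing2\<close>)
    let ?I = "\<integral>\<^sup>+w. ennreal (dA_weight \<alpha> w) * ennreal (cmod (indicator (ball z r) w *\<^sub>R f w) powr p) * indicator disk w \<partial>lborel"
    have [measurable]: "disk \<in> sets borel" "ball z r \<in> sets borel"
      by auto
    have "?I \<le> (\<integral>\<^sup>+w. ennreal (cmod (f w) powr p) \<partial>\<mu>)"
      using LpD(1)[OF fL] p by (subst nn_integral_dA) (auto intro!: nn_integral_mono simp: indicator_def)
    also have "\<dots> = ennreal (N f powr p)"
      using LpD[OF fL] by (subst nn_integral_eq_integral) (auto simp: N_powr)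
    also have "\<dots> \<le> ennreal (m powr p)"
      using m p by (intro ennreal_leI powr_mono2) auto
    finally have I: "?I \<le> ennreal (m powr p)" .
    have "ennreal (pi * r\<^sup>2 * cmod (f z)) = ennreal (norm (LINT w|lborel. indicator (ball z r) w *\<^sub>R f w))"
      using mean_value_ball[OF hol r(1) r(3)] by (simp add: norm_mult norm_power)
    also have "\<dots> \<le> (\<integral>\<^sup>+w. ennreal (norm (indicator (ball z r) w *\<^sub>R f w)) \<partial>lborel)"
      by (cases "integrable lborel (\<lambda>w. indicator (ball z r) w *\<^sub>R f w)")
         (auto intro: integral_norm_bound_ennreal simp: not_integrable_integral_eq simp del: norm_scaleR)
    also have "\<dots> \<le> (\<integral>\<^sup>+w. ennreal m * indicator (ball z r) w
        + ennreal (m powr (1 - p) / w0) * (ennreal (dA_weight \<alpha> w) * ennreal (cmod (indicator (ball z r) w *\<^sub>R f w) powr p) * indicator disk w) \<partial>lborel)"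
    proof (rule nn_integral_mono)
      fix w
      show "ennreal (norm (indicator (ball z r) w *\<^sub>R f w)) \<le> ennreal m * indicator (ball z r) w
        + ennreal (m powr (1 - p) / w0) * (ennreal (dA_weight \<alpha> w) * ennreal (cmod (indicator (ball z r) w *\<^sub>R f w) powr p) * indicator disk w)"
      proof (cases "w \<in> ball z r")
        case True
        have "m powr (1 - p) * cmod (f w) powr p \<le> m powr (1 - p) / w0 * (dA_weight \<alpha> w * cmod (f w) powr p)"
          using mult_right_mono[OF weight[OF True], of "m powr (1 - p) * cmod (f w) powr p"] w0
          by (simp add: field_simps)
        then have "cmod (f w) \<le> m + m powr (1 - p) / w0 * (dA_weight \<alpha> w * cmod (f w) powr p)"
          using xp[of "cmod (f w)"] by simp
        then have "ennreal (cmod (f w)) \<le> ennreal (m + m powr (1 - p) / w0 * (dA_weight \<alpha> w * cmod (f w) powr p))"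
          by (rule ennreal_leI)
        also have "\<dots> = ennreal m + ennreal (m powr (1 - p) / w0) * (ennreal (dA_weight \<alpha> w) * ennreal (cmod (f w) powr p))"
          using less_imp_le[OF m0] less_imp_le[OF w0] dA_weight_nonneg[OF \<alpha>, of w]
          by (simp only: ennreal_plus ennreal_mult mult_nonneg_nonneg divide_nonneg_nonneg powr_ge_zero)
        finally have "ennreal (cmod (f w)) \<le> ennreal m + ennreal (m powr (1 - p) / w0) * (ennreal (dA_weight \<alpha> w) * ennreal (cmod (f w) powr p))" .
        moreover have "w \<in> disk"
          using True sub by blast
        ultimately show ?thesis
          using True by simp
      qed simp
    qed
    also have "\<dots> = ennreal m * emeasure lborel (ball z r)
        + ennreal (m powr (1 - p) / w0) * (\<integral>\<^sup>+w. ennreal (dA_weight \<alpha> w) * ennreal (cmod (indicator (ball z r) w *\<^sub>R f w) powr p) * indicator disk w \<partial>lborel)"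
    proof -
      have [measurable]: "(\<lambda>w. ennreal (dA_weight \<alpha> w) * ennreal (cmod (indicator (ball z r) w *\<^sub>R f w) powr p) * indicator disk w) \<in> borel_measurable lborel"
        using m2 by measurable
      show ?thesis
        by (subst nn_integral_add, measurable, subst nn_integral_cmult, measurable, subst nn_integral_cmult_indicator, simp, rule refl)
    qed
    also have "\<dots> \<le> ennreal m * ennreal (pi * r\<^sup>2) + ennreal (m powr (1 - p) / w0) * ennreal (m powr p)"
      by (intro add_mono mult_left_mono I) (use r in \<open>simp_all add: emeasure_ball_complex\<close>)
    also have "\<dots> = ennreal (m * (pi * r\<^sup>2) + m powr (1 - p) / w0 * m powr p)"
      using m0 w0 by (simp add: ennreal_mult[symmetric] ennreal_plus[symmetric] del: ennreal_plus)
    also have "m powr (1 - p) / w0 * m powr p = m / w0"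
      using m0 by (simp flip: powr_add)
    finally have "ennreal (pi * r\<^sup>2 * cmod (f z)) \<le> ennreal (m * (pi * r\<^sup>2) + m / w0)" .
    moreover have "0 \<le> m * (pi * r\<^sup>2) + m / w0"
      using m0 w0 by (intro add_nonneg_nonneg mult_nonneg_nonneg divide_nonneg_nonneg) auto
    ultimately have "pi * r\<^sup>2 * cmod (f z) \<le> m * (pi * r\<^sup>2) + m / w0"
      using ennreal_le_iff by blast
    moreover have "m * (pi * r\<^sup>2) + m / w0 = (pi * r\<^sup>2) * (?C * m)"
    proof -
      have "m / w0 = (pi * r\<^sup>2) * (1 / (w0 * (pi * r\<^sup>2)) * m)"
        using r by simp
      then show ?thesis
        by (simp only: distrib_right distrib_left mult_1_left mult.commute[of m "pi * r\<^sup>2"])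
    qed
    ultimately have "(pi * r\<^sup>2) * cmod (f z) \<le> (pi * r\<^sup>2) * (?C * m)"
      by linarith
    then show ?thesis
      by (rule mult_left_le_imp_le) (use r in simp)
  qed
  show "cmod (f z) \<le> ?C * N f"
  proof (rule field_le_epsilon)
    fix e :: real assume "e > 0"
    then show "cmod (f z) \<le> ?C * N f + e"
      using *[of "N f + e / ?C"] \<open>?C > 0\<close> by (simp add: distrib_left)
  qed
qed

text \<open>Point evaluations make a norm-Cauchy sequence uniformly Cauchy on smaller closed disks,
  which yields a holomorphic limit. Fatou's lemma, applied to \<open>f n - f (k + M)\<close> as
  \<open>k\<close> grows, turns pointwise convergence back into convergence in norm.\<close>

lemma bergman_complete:
  assumes f: "\<And>n. f n \<in> A" and Cauchy: "\<And>e. e > 0 \<Longrightarrow> \<exists>M. \<forall>m\<ge>M. \<forall>n\<ge>M. N (\<lambda>z. f m z - f n z) < e"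
  obtains g where "g \<in> A" "(\<lambda>n. N (\<lambda>z. f n z - g z)) \<longlonglongrightarrow> 0"
proof -
  have uc: "uniformly_convergent_on (cball 0 R) f" if R: "0 \<le> R" "R < 1" for R
  proof (rule Cauchy_uniformly_convergent, rule uniformly_Cauchy_onI)
    obtain C where C: "C > 0" "\<And>f z. f \<in> A \<Longrightarrow> z \<in> cball 0 R \<Longrightarrow> cmod (f z) \<le> C * N f"
      using point_evaluation_bounded[OF R] by blast
    fix e :: real assume "e > 0"
    then obtain M where M: "\<forall>m\<ge>M. \<forall>n\<ge>M. N (\<lambda>z. f m z - f n z) < e / C"
      using Cauchy[of "e / C"] C(1) by auto
    have "dist (f m z) (f n z) < e" if "z \<in> cball 0 R" "m \<ge> M" "n \<ge> M" for z m n
    proof -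
      have "cmod (f m z - f n z) \<le> C * N (\<lambda>z. f m z - f n z)"
        using C(2)[OF A_diff[OF f f] that(1)] .
      also have "\<dots> < C * (e / C)"
        using M that C(1) by (intro mult_strict_left_mono) auto
      finally show ?thesis
        using C(1) by (simp add: dist_norm)
    qed
    then show "\<exists>M. \<forall>z\<in>cball 0 R. \<forall>m\<ge>M. \<forall>n\<ge>M. dist (f m z) (f n z) < e"
      by blast
  qed
  define g where "g z = lim (\<lambda>n. f n z)" for z
  have ul: "uniform_limit (cball 0 R) f g sequentially" if "0 \<le> R" "R < 1" for R
    using uc[OF that] unfolding g_def by (simp add: uniformly_convergent_uniform_limit_iff)
  have pt: "(\<lambda>n. f n z) \<longlonglongrightarrow> g z" if "z \<in> disk" for z
    using that by (intro tendsto_uniform_limitI[OF ul[of "cmod z"]]) auto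
  have "g holomorphic_on disk"
  proof (rule holomorphic_uniform_sequence[of _ f])
    fix z :: complex assume z: "z \<in> disk"
    define d where "d = (1 - cmod z) / 2"
    have sub: "cball z d \<subseteq> cball 0 (cmod z + d)"
      using norm_triangle_ineq2 by (auto simp: dist_norm) (smt (verit) norm_minus_commute norm_triangle_ineq2)
    have d: "d > 0" "cmod z + d < 1"
      using z by (auto simp: d_def field_simps)
    show "\<exists>d>0. cball z d \<subseteq> disk \<and> uniform_limit (cball z d) f g sequentially"
      using d sub uniform_limit_on_subset[OF ul[of "cmod z + d"] sub] by (intro exI[of _ d]) auto
  qed (use f in \<open>auto simp: bergman_space_def\<close>)
  then have gm: "g \<in> borel_measurable \<mu>"
    by (auto intro: holomorphic_on_imp_continuous_on)
  have key: "\<exists>M. \<forall>n\<ge>M. (\<lambda>z. f n z - g z) \<in> L \<and> N (\<lambda>z. f n z - g z) \<le> e" if e: "e > 0" for e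
  proof -
    obtain M where M: "\<forall>m\<ge>M. \<forall>n\<ge>M. N (\<lambda>z. f m z - f n z) < e"
      using Cauchy[OF e] by auto
    have "(\<lambda>z. f n z - g z) \<in> L \<and> N (\<lambda>z. f n z - g z) \<le> e" if "n \<ge> M" for n
    proof -
      have lim: "(\<lambda>k. f n z - f (k + M) z) \<longlonglongrightarrow> f n z - g z" if "z \<in> disk" for z
        using pt[OF that] by (intro tendsto_intros LIMSEQ_ignore_initial_segment)
      have fL: "(\<lambda>z. f n z - f (k + M) z) \<in> L" for k
        using f by (intro L_diff A_L)
      have le: "N (\<lambda>z. f n z - f (k + M) z) \<le> e" for k
        using M \<open>n \<ge> M\<close> by (intro less_imp_le) auto
      have m: "(\<lambda>z. f n z - g z) \<in> borel_measurable \<mu>"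
        using gm LpD(1)[OF A_L[OF f]] by measurable
      show ?thesis
        using N_fatou[OF fL le _ m lim] \<open>e > 0\<close> by auto
    qed
    then show ?thesis by blast
  qed
  obtain M where "(\<lambda>z. f M z - g z) \<in> L"
    using key[of 1] by auto
  \<comment> \<open>Membership of the limit is read off from a single difference, as
    \<open>g = f M - (f M - g)\<close>.\<close>
  then have "(\<lambda>z. f M z - (f M z - g z)) \<in> L"
    by (rule L_diff[OF A_L[OF f]])
  then have "g \<in> A"
    using \<open>g holomorphic_on disk\<close> by (simp add: A_iff_L)
  moreover have "(\<lambda>n. N (\<lambda>z. f n z - g z)) \<longlonglongrightarrow> 0"
  proof (rule LIMSEQ_I)
    fix e :: real assume "e > 0"
    then obtain M where M: "\<forall>n\<ge>M. N (\<lambda>z. f n z - g z) \<le> e / 2"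
      using key[of "e/2"] by auto
    have "N (\<lambda>z. f n z - g z) < e" if "n \<ge> M" for n
      using M that \<open>e > 0\<close> by (auto intro: order_le_less_trans[of _ "e / 2"])
    then show "\<exists>M. \<forall>n\<ge>M. norm (N (\<lambda>z. f n z - g z) - 0) < e"
      by auto
  qed
  ultimately show thesis
    using that by blast
qed

end

section \<open>Norms of the kernels\<close>

text \<open>The kernel at \<open>-1\<close> is written as \<open>cauchy_kernel c (- z)\<close>, so
  that reflection in the origin transfers the estimates from one kernel to the other.\<close>

definition cauchy_kernel :: "real \<Rightarrow> complex \<Rightarrow> complex" where
  "cauchy_kernel c z = (1 - z) powr (- of_real c)"

lemma g_hat_eq:
  "g_hat c \<theta> z = of_real \<theta> * cauchy_kernel c z + of_real (1 - \<theta>) * cauchy_kernel c (- z)"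
  by (simp add: g_hat_def cauchy_kernel_def)

lemma cmod_powr_of_real: "w \<noteq> 0 \<Longrightarrow> cmod (w powr (- of_real c)) = cmod w powr (- c)"
  by (simp add: powr_def)

lemma cmod_cauchy_kernel:
  assumes "z \<noteq> 1"
  shows "cmod (cauchy_kernel c z) = cmod (1 - z) powr (- c)"
  using assms by (simp add: cauchy_kernel_def cmod_powr_of_real)

lemma Re_one_minus_disk: "z \<in> disk \<Longrightarrow> Re (1 - z) > 0"
  using complex_Re_le_cmod[of z] by simp

lemma one_notin_disk: "z \<in> disk \<Longrightarrow> z \<noteq> 1" "z \<in> disk \<Longrightarrow> z \<noteq> -1"
  by auto

lemma cauchy_kernel_holomorphic: "cauchy_kernel c holomorphic_on disk"
proof -
  have "1 - z \<notin> \<real>\<^sub>\<le>\<^sub>0" if "z \<in> disk" for z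
    using Re_one_minus_disk[OF that] by (auto simp: complex_nonpos_Reals_iff)
  then show ?thesis
    unfolding cauchy_kernel_def by (intro holomorphic_intros) auto
qed

lemma cauchy_kernel_reflect_holomorphic: "(\<lambda>z. cauchy_kernel c (- z)) holomorphic_on disk"
proof -
  have "uminus ` disk \<subseteq> disk"
    by auto
  from holomorphic_on_compose_gen[OF holomorphic_on_minus[OF holomorphic_on_ident] cauchy_kernel_holomorphic this]
  show ?thesis
    by (simp add: o_def)
qed

text \<open>Dyadic rings around \<open>1\<close>: where the distance is at least
  \<open>(1/2) ^ k\<close> the integrand is at most \<open>2 powr (\<sigma> * k)\<close>, and the
  ball of radius \<open>2 * (1/2) ^ k\<close> has area \<open>4 * pi * (1/4) ^ k\<close>. The sum is
  a geometric series of ratio \<open>2 powr \<sigma> / 4\<close>, which is below one because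
  \<open>\<sigma> < 2\<close>.\<close>

lemma nn_integral_powr_neg_near_1_finite:
  assumes \<sigma>: "0 < \<sigma>" "\<sigma> < 2"
  shows "(\<integral>\<^sup>+z. ennreal (cmod (1 - z) powr (- \<sigma>)) * indicator disk z \<partial>lborel) < \<infinity>"
proof -
  let ?B = "\<lambda>k::nat. ball (1::complex) (2 * (1/2) ^ k)"
  let ?g = "\<lambda>k z. ennreal (2 powr (\<sigma> * real k)) * indicator (?B k) z"
  have pt: "ennreal (cmod (1 - z) powr (- \<sigma>)) * indicator disk z \<le> (\<Sum>k. ?g k z)" for z
  proof (cases "z \<in> disk")
    case True
    then have z1: "0 < cmod (1 - z)"
      by auto
    have z2: "cmod (1 - z) < 2"
      using True norm_triangle_ineq4[of 1 z] by simp
    \<comment> \<open>The least such \<open>k\<close> puts the distance between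
      \<open>(1/2) ^ k\<close> and twice that value; for \<open>k = 0\<close> the upper bound is the
      diameter of the disk.\<close>
    define k where "k = (LEAST k. (1/2) ^ k \<le> cmod (1 - z))"
    have "\<exists>k. (1/2::real) ^ k \<le> cmod (1 - z)"
      using real_arch_pow_inv[OF z1, of "1/2"] by (auto intro: less_imp_le)
    then have k: "(1/2) ^ k \<le> cmod (1 - z)"
      unfolding k_def by (rule LeastI_ex)
    have "cmod (1 - z) < 2 * (1/2) ^ k"
    proof (cases k)
      case (Suc m)
      then have "\<not> (1/2) ^ m \<le> cmod (1 - z)"
        using not_less_Least[of m "\<lambda>k. (1/2) ^ k \<le> cmod (1 - z)"] unfolding k_def by simp
      then show ?thesis using Suc by simp
    qed (use z2 in simp)
    then have zB: "z \<in> ?B k"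
      by (simp add: dist_norm)
    have "cmod (1 - z) powr (- \<sigma>) \<le> ((1/2) ^ k) powr (- \<sigma>)"
      using k \<sigma> by (intro powr_mono2') auto
    also have "(1/2::real) ^ k = 2 powr (- real k)"
      by (simp add: powr_minus powr_realpow power_one_over inverse_eq_divide)
    also have "(2 powr (- real k)) powr (- \<sigma>) = 2 powr (\<sigma> * real k)"
      by (simp add: powr_powr mult.commute)
    finally have "ennreal (cmod (1 - z) powr (- \<sigma>)) * indicator disk z \<le> ?g k z"
      using zB True by (simp add: ennreal_leI)
    also have "\<dots> = (\<Sum>i\<in>{k}. ?g i z)"
      by (subst sum.insert; simp only: finite.emptyI empty_iff not_False_eq_True sum.empty add_0_right)
    also have "\<dots> \<le> (\<Sum>k. ?g k z)"
      by (rule sum_le_suminf) auto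
    finally show ?thesis .
  qed simp
  have [measurable]: "?B k \<in> sets borel" for k
    by auto
  have "(\<integral>\<^sup>+z. ennreal (cmod (1 - z) powr (- \<sigma>)) * indicator disk z \<partial>lborel) \<le> (\<integral>\<^sup>+z. (\<Sum>k. ?g k z) \<partial>lborel)"
    by (intro nn_integral_mono pt)
  also have "\<dots> = (\<Sum>k. \<integral>\<^sup>+z. ?g k z \<partial>lborel)"
    by (rule nn_integral_suminf) measurable
  also have "\<dots> = (\<Sum>k. ennreal (4 * pi * (2 powr \<sigma> / 4) ^ k))"
  proof (intro suminf_cong)
    fix k
    have "(\<integral>\<^sup>+z. ?g k z \<partial>lborel) = ennreal (2 powr (\<sigma> * real k)) * emeasure lborel (?B k)"
      by (subst nn_integral_cmult_indicator) auto
    also have "\<dots> = ennreal (2 powr (\<sigma> * real k) * (pi * (2 * (1/2) ^ k)\<^sup>2))"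
      by (subst emeasure_ball_complex) (auto simp: ennreal_mult)
    also have "2 powr (\<sigma> * real k) * (pi * (2 * (1/2) ^ k)\<^sup>2) = 4 * pi * (2 powr \<sigma> / 4) ^ k"
    proof -
      have "2 powr (\<sigma> * real k) = (2 powr \<sigma>) ^ k"
        by (simp add: powr_realpow[symmetric] powr_powr)
      moreover have "((1/2::real) ^ k)\<^sup>2 = (1/4) ^ k"
        by (simp add: power2_eq_square power_mult_distrib[symmetric])
      ultimately show ?thesis
        by (simp add: power_mult_distrib power_divide)
    qed
    finally show "(\<integral>\<^sup>+z. ?g k z \<partial>lborel) = ennreal (4 * pi * (2 powr \<sigma> / 4) ^ k)" .
  qed
  also have "\<dots> < \<infinity>"
  proof -
    have "2 powr \<sigma> < 2 powr 2"
      using \<sigma> by (intro powr_less_mono) auto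
    then have "2 powr \<sigma> / 4 < 1" by simp
    then have "summable (\<lambda>k. 4 * pi * (2 powr \<sigma> / 4) ^ k)"
      by (intro summable_mult summable_geometric) simp
    then show ?thesis
      by (subst suminf_ennreal2) auto
  qed
  finally show ?thesis .
qed

section \<open>Invariance under reflection in the origin\<close>

lemma indicator_disk_measurable:
  fixes f :: "complex \<Rightarrow> ennreal"
  assumes "f \<in> borel_measurable (dA \<alpha>)"
  shows "(\<lambda>z. f z * indicator disk z) \<in> borel_measurable borel"
proof -
  have "f \<in> borel_measurable (restrict_space borel disk)"
    using assms measurable_cong_sets[OF sets_dA refl] by blast
  then show ?thesis
    by (subst (asm) borel_measurable_restrict_space_iff_ennreal) auto
qed

lemma measurable_uminus_dA: "uminus \<in> measurable (dA \<alpha>) (dA \<alpha>)"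
proof -
  have "uminus \<in> measurable (restrict_space borel disk) (restrict_space borel disk :: complex measure)"
    by (intro measurable_restrict_space3) auto
  then show ?thesis
    by (simp cong: measurable_cong_sets add: measurable_cong_sets[OF sets_dA sets_dA])
qed

lemma nn_integral_dA_reflect:
  fixes f :: "complex \<Rightarrow> ennreal"
  assumes f: "f \<in> borel_measurable (dA \<alpha>)"
  shows "(\<integral>\<^sup>+z. f (- z) \<partial>dA \<alpha>) = (\<integral>\<^sup>+z. f z \<partial>dA \<alpha>)"
proof -
  have m: "(\<lambda>z. ennreal (dA_weight \<alpha> z) * (f z * indicator disk z)) \<in> borel_measurable borel"
    using indicator_disk_measurable[OF f] by measurable
  have "(\<integral>\<^sup>+z. f z \<partial>dA \<alpha>) = (\<integral>\<^sup>+z. ennreal (dA_weight \<alpha> z) * (f z * indicator disk z) \<partial>distr lborel borel uminus)"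
    by (simp add: nn_integral_dA[OF f] lborel_distr_uminus_complex mult.assoc)
  also have "\<dots> = (\<integral>\<^sup>+z. ennreal (dA_weight \<alpha> (- z)) * (f (- z) * indicator disk (- z)) \<partial>lborel)"
    by (rule nn_integral_distr) (use m in auto)
  also have "\<dots> = (\<integral>\<^sup>+z. f (- z) \<partial>dA \<alpha>)"
    using measurable_compose[OF measurable_uminus_dA f]
    by (subst nn_integral_dA) (auto intro!: nn_integral_cong simp: dA_weight_def indicator_def)
  finally show ?thesis by simp
qed

lemma bergman_norm_reflect:
  assumes f: "f \<in> borel_measurable (dA \<alpha>)"
  shows "bergman_norm p \<alpha> (\<lambda>z. f (- z)) = bergman_norm p \<alpha> f"
proof -
  have m: "(\<lambda>z. f (- z)) \<in> borel_measurable (dA \<alpha>)"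
    by (rule measurable_compose[OF measurable_uminus_dA f])
  have "(\<lambda>z. ennreal (cmod (f z) powr p)) \<in> borel_measurable (dA \<alpha>)"
    using f by measurable
  then show ?thesis
    unfolding bergman_norm_def using m f nn_integral_dA_reflect[of "\<lambda>z. ennreal (cmod (f z) powr p)" \<alpha>]
    by (subst (1 2) integral_eq_nn_integral) auto
qed

section \<open>The critical exponent and the growth of the kernel norm\<close>

context bergman
begin

definition crit :: real where "crit = (2 + \<alpha>) / p"

lemma crit_pos: "crit > 0" "\<alpha> / p < crit" "\<alpha> / p \<ge> 0" "crit * p = 2 + \<alpha>"
  using p \<alpha> by (auto simp: crit_def field_simps)

lemma cauchy_kernel_measurable:
  "cauchy_kernel c \<in> borel_measurable \<mu>" "(\<lambda>z. cauchy_kernel c (- z)) \<in> borel_measurable \<mu>"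
  using cauchy_kernel_holomorphic cauchy_kernel_reflect_holomorphic
  by (auto intro!: measurable_dA_of_continuous holomorphic_on_imp_continuous_on)

text \<open>On the disk the weight is at most a multiple of
  \<open>cmod (1 - z) powr \<alpha>\<close>, which improves the exponent \<open>- (c * p)\<close> to
  \<open>- (c * p - \<alpha>)\<close>. The two bounds on \<open>c\<close> put
  \<open>c * p - \<alpha>\<close> between 0 and 2, the range of the unweighted estimate.\<close>

lemma cauchy_kernel_A:
  assumes c: "\<alpha> / p < c" "c < crit"
  shows "cauchy_kernel c \<in> A"
proof -
  define \<sigma> where "\<sigma> = c * p - \<alpha>"
  have \<sigma>: "0 < \<sigma>" "\<sigma> < 2"
    using c p crit_pos(4) mult_strict_right_mono[OF c(1), of p] mult_strict_right_mono[OF c(2), of p]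
    by (auto simp: \<sigma>_def)
  have "(\<integral>\<^sup>+z. ennreal (cmod (cauchy_kernel c z) powr p) \<partial>\<mu>)
      = (\<integral>\<^sup>+z. ennreal (dA_weight \<alpha> z) * ennreal (cmod (cauchy_kernel c z) powr p) * indicator disk z \<partial>lborel)"
    using cauchy_kernel_measurable by (intro nn_integral_dA) auto
  also have "\<dots> \<le> (\<integral>\<^sup>+z. ennreal ((1 + \<alpha>) * 2 powr \<alpha> / pi) * (ennreal (cmod (1 - z) powr (- \<sigma>)) * indicator disk z) \<partial>lborel)"
  proof (rule nn_integral_mono)
    fix z :: complex
    show "ennreal (dA_weight \<alpha> z) * ennreal (cmod (cauchy_kernel c z) powr p) * indicator disk z
      \<le> ennreal ((1 + \<alpha>) * 2 powr \<alpha> / pi) * (ennreal (cmod (1 - z) powr (- \<sigma>)) * indicator disk z)"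
    proof (cases "z \<in> disk")
      case True
      then have z: "cmod z < 1" "z \<noteq> 1"
        by auto
      have "1 - (cmod z)\<^sup>2 = (1 - cmod z) * (1 + cmod z)"
        by (simp add: power2_eq_square algebra_simps)
      also have "\<dots> \<le> cmod (1 - z) * 2"
        using z norm_triangle_ineq2[of 1 z] by (intro mult_mono) auto
      finally have le: "1 - (cmod z)\<^sup>2 \<le> 2 * cmod (1 - z)" by simp
      have "(1 - (cmod z)\<^sup>2) powr \<alpha> * cmod (1 - z) powr (- (c * p)) \<le> (2 * cmod (1 - z)) powr \<alpha> * cmod (1 - z) powr (- (c * p))"
        using z \<alpha> le by (intro mult_right_mono powr_mono2) (auto simp: power_le_one)
      also have "\<dots> = 2 powr \<alpha> * cmod (1 - z) powr (- \<sigma>)"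
        using z by (simp add: powr_mult \<sigma>_def mult.assoc flip: powr_add)
      finally have "(1 + \<alpha>) / pi * ((1 - (cmod z)\<^sup>2) powr \<alpha> * cmod (1 - z) powr (- (c * p))) \<le> (1 + \<alpha>) / pi * (2 powr \<alpha> * cmod (1 - z) powr (- \<sigma>))"
        using \<alpha> by (intro mult_left_mono) auto
      then have "ennreal (dA_weight \<alpha> z * cmod (cauchy_kernel c z) powr p) \<le> ennreal ((1 + \<alpha>) * 2 powr \<alpha> / pi * cmod (1 - z) powr (- \<sigma>))"
        using z by (intro ennreal_leI) (simp add: cmod_cauchy_kernel powr_powr dA_weight_def mult.assoc)
      then show ?thesis
        using True \<alpha> dA_weight_nonneg[OF \<alpha>, of z] by (simp add: ennreal_mult[symmetric])
    qed simp
  qed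
  also have "\<dots> = ennreal ((1 + \<alpha>) * 2 powr \<alpha> / pi) * (\<integral>\<^sup>+z. ennreal (cmod (1 - z) powr (- \<sigma>)) * indicator disk z \<partial>lborel)"
  proof -
    have [measurable]: "disk \<in> sets borel" by auto
    show ?thesis
      by (rule nn_integral_cmult) measurable
  qed
  also have "\<dots> < \<infinity>"
    using nn_integral_powr_neg_near_1_finite[OF \<sigma>] by (simp add: ennreal_mult_less_top)
  finally have "(\<integral>\<^sup>+z. ennreal (cmod (cauchy_kernel c z) powr p) \<partial>\<mu>) < \<infinity>" .
  then have "integrable \<mu> (\<lambda>z. cmod (cauchy_kernel c z) powr p)"
    using cauchy_kernel_measurable(1) by (intro integrableI_nonneg) auto
  then show ?thesis
    using cauchy_kernel_holomorphic by (simp add: bergman_space_def)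
qed

lemma cauchy_kernel_reflect_A:
  assumes "\<alpha> / p < c" "c < crit"
  shows "(\<lambda>z. cauchy_kernel c (- z)) \<in> A"
proof -
  have i: "integrable \<mu> (\<lambda>z. cmod (cauchy_kernel c z) powr p)"
    using cauchy_kernel_A[OF assms] by (simp add: bergman_space_def)
  have m: "(\<lambda>z. ennreal (cmod (cauchy_kernel c z) powr p)) \<in> borel_measurable \<mu>"
    using cauchy_kernel_measurable(1) by measurable
  have "(\<lambda>z. cmod (cauchy_kernel c (- z)) powr p) \<in> borel_measurable \<mu>"
    using cauchy_kernel_measurable(2) by measurable
  then have "integrable \<mu> (\<lambda>z. cmod (cauchy_kernel c (- z)) powr p)"
    using i nn_integral_dA_reflect[OF m] by (intro integrableI_nonneg) (auto simp: integrable_iff_bounded)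
  then show ?thesis
    using cauchy_kernel_reflect_holomorphic by (simp add: bergman_space_def)
qed

text \<open>The map \<open>z \<mapsto> (1 + z) / 2\<close> sends the disk into itself and contracts towards \<open>1\<close>. The change of
  variables bounds the integral \<open>I\<close> of \<open>cmod (1 - z) powr (- c * p)\<close> below by
  \<open>2 powr (c * p - 2 - \<alpha>) * I + \<rho>\<close>, where \<open>\<rho>\<close> comes from a part of the disk away from the image.\<close>

lemma norm_cauchy_kernel_lower:
  obtains \<rho> where "\<rho> > 0" "\<And>c. \<alpha> / p < c \<Longrightarrow> c < crit \<Longrightarrow>
    \<rho> / (1 - 2 powr (c * p - 2 - \<alpha>)) \<le> N (cauchy_kernel c) powr p"
proof
  \<comment> \<open>A lower bound for weight times kernel, times the area, on the ball of radius 1/4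
    around -1/2. There \<open>cmod z \<le> 3/4\<close>, so one minus its square is at least 7/16;
    and \<open>cmod (1 - z) \<le> 2\<close> with an exponent above \<open>- (2 + \<alpha>)\<close>
    gives the power of two. Nothing in it depends on \<open>c\<close>.\<close>
  define \<rho> where "\<rho> = (1 + \<alpha>) * (7/16) powr \<alpha> / pi * 2 powr (- (2 + \<alpha>)) * (pi * (1/4)\<^sup>2)"
  show "\<rho> > 0"
    using \<alpha> by (simp add: \<rho>_def)
  fix c assume c: "\<alpha> / p < c" "c < crit"
  define s where "s = c * p"
  have s: "\<alpha> < s" "s < 2 + \<alpha>"
    using c p crit_pos(4) mult_strict_right_mono[OF c(1), of p] mult_strict_right_mono[OF c(2), of p]
    by (auto simp: s_def)
  define I where "I = N (cauchy_kernel c) powr p"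
  define f where "f = (\<lambda>z. ennreal (dA_weight \<alpha> z * cmod (1 - z) powr (- s)))"
  have fm [measurable]: "f \<in> borel_measurable borel"
    unfolding f_def by measurable
  have [measurable]: "ball a r \<in> sets borel" for a :: complex and r
    by auto
  have fI: "(\<integral>\<^sup>+z. f z * indicator disk z \<partial>lborel) = ennreal I"
  proof -
    have "ennreal I = (\<integral>\<^sup>+z. ennreal (cmod (cauchy_kernel c z) powr p) \<partial>\<mu>)"
      using LpD[OF A_L[OF cauchy_kernel_A[OF c]]] unfolding I_def
      by (subst nn_integral_eq_integral) (auto simp: N_powr)
    also have "\<dots> = (\<integral>\<^sup>+z. ennreal (dA_weight \<alpha> z) * ennreal (cmod (cauchy_kernel c z) powr p) * indicator disk z \<partial>lborel)"
      using cauchy_kernel_measurable by (intro nn_integral_dA) auto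
    also have "\<dots> = (\<integral>\<^sup>+z. f z * indicator disk z \<partial>lborel)"
    proof (rule nn_integral_cong)
      fix z :: complex
      show "ennreal (dA_weight \<alpha> z) * ennreal (cmod (cauchy_kernel c z) powr p) * indicator disk z = f z * indicator disk z"
        using dA_weight_nonneg[OF \<alpha>, of z] one_notin_disk(1)[of z]
        by (cases "z \<in> disk") (simp_all add: f_def cmod_cauchy_kernel powr_powr s_def ennreal_mult')
    qed
    finally show ?thesis by simp
  qed
  \<comment> \<open>\<open>B1\<close> is the image of the disk under the contraction.
    \<open>B2\<close> is disjoint from it because the centres are at distance 1 while the radii add
    up to 3/4.\<close>
  define B1 where "B1 = ball (1/2::complex) (1/2)"
  define B2 where "B2 = ball (-1/2::complex) (1/4)"
  have [measurable]: "B1 \<in> sets borel" "B2 \<in> sets borel"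
    by (auto simp: B1_def B2_def)
  have "dist (1/2::complex) (-1/2) = 1"
    by (simp add: dist_norm)
  then have disj: "B1 \<inter> B2 = {}"
    unfolding B1_def B2_def by (intro disjoint_ballI) simp
  have sub: "B1 \<subseteq> disk" "B2 \<subseteq> disk"
    unfolding B1_def B2_def by (simp_all add: ball_subset_ball_iff dist_norm)
  have 2: "ennreal \<rho> \<le> (\<integral>\<^sup>+z. f z * indicator B2 z \<partial>lborel)"
  proof -
    let ?k = "(1 + \<alpha>) * (7/16) powr \<alpha> / pi * 2 powr (- (2 + \<alpha>))"
    have "?k \<le> dA_weight \<alpha> z * cmod (1 - z) powr (- s)" if z: "z \<in> B2" for z
    proof -
      have "cmod z \<le> 3/4"
        using z norm_triangle_ineq2[of z "-1/2"] by (simp add: B2_def dist_norm norm_minus_commute)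
      then have "(cmod z)\<^sup>2 \<le> (3/4)\<^sup>2"
        by (intro power_mono) auto
      then have "7/16 \<le> 1 - (cmod z)\<^sup>2"
        by (simp add: power2_eq_square)
      then have 1: "(1 + \<alpha>) * (7/16) powr \<alpha> / pi \<le> dA_weight \<alpha> z"
        using \<alpha> unfolding dA_weight_def by (intro divide_right_mono mult_left_mono powr_mono2) auto
      have "cmod (1 - z) \<le> 2" "z \<noteq> 1"
        using \<open>cmod z \<le> 3/4\<close> norm_triangle_ineq4[of 1 z] by auto
      then have "2 powr (- s) \<le> cmod (1 - z) powr (- s)"
        using s \<alpha> by (intro powr_mono2') auto
      moreover have "(2::real) powr (- (2 + \<alpha>)) \<le> 2 powr (- s)"
        using s by (intro powr_mono) auto
      ultimately have "2 powr (- (2 + \<alpha>)) \<le> cmod (1 - z) powr (- s)" by linarith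
      with 1 show ?thesis
        using \<alpha> by (intro mult_mono) (auto intro: dA_weight_nonneg)
    qed
    then have "(\<integral>\<^sup>+z. ennreal ?k * indicator B2 z \<partial>lborel) \<le> (\<integral>\<^sup>+z. f z * indicator B2 z \<partial>lborel)"
      by (intro nn_integral_mono) (auto simp: indicator_def f_def intro!: ennreal_leI)
    moreover have "(\<integral>\<^sup>+z. ennreal ?k * indicator B2 z \<partial>lborel) = ennreal \<rho>"
    proof -
      have "(\<integral>\<^sup>+z. ennreal ?k * indicator B2 z \<partial>lborel) = ennreal ?k * emeasure lborel B2"
        by (rule nn_integral_cmult_indicator) simp
      also have "emeasure lborel B2 = ennreal (pi * (1/4)\<^sup>2)"
        unfolding B2_def by (rule emeasure_ball_complex) simp
      also have "ennreal ?k * ennreal (pi * (1/4)\<^sup>2) = ennreal \<rho>"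
        unfolding \<rho>_def using \<alpha> by (intro ennreal_mult[symmetric]) auto
      finally show ?thesis .
    qed
    ultimately show ?thesis by simp
  qed
  have 1: "ennreal (2 powr (s - 2 - \<alpha>) * I) \<le> (\<integral>\<^sup>+z. f z * indicator B1 z \<partial>lborel)"
  proof -
    let ?T = "\<lambda>z::complex. 1/2 + (1/2::real) *\<^sub>R z"
    have T [measurable]: "?T \<in> borel_measurable borel"
      by measurable
    have fT: "(\<lambda>z. f (?T z) * indicator disk z) \<in> borel_measurable borel"
      using measurable_compose[OF T fm] by measurable
    have "(\<integral>\<^sup>+z. f z * indicator B1 z \<partial>lborel) = (\<integral>\<^sup>+z. f z * indicator B1 z \<partial>density (distr lborel borel ?T) (\<lambda>_. ennreal (1/4)))"
      using lborel_affine[of "1/2" "1/2::complex"] by (simp add: power2_eq_square)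
    also have "\<dots> = ennreal (1/4) * (\<integral>\<^sup>+z. f (?T z) * indicator B1 (?T z) \<partial>lborel)"
      by (simp add: nn_integral_density nn_integral_cmult nn_integral_distr)
    also have "\<dots> = ennreal (1/4) * (\<integral>\<^sup>+z. f (?T z) * indicator disk z \<partial>lborel)"
    proof -
      have "?T z \<in> B1 \<longleftrightarrow> z \<in> disk" for z
        by (simp add: B1_def dist_norm)
      then show ?thesis
        by (simp add: indicator_def)
    qed
    also have "\<dots> \<ge> ennreal (1/4) * (\<integral>\<^sup>+z. ennreal (2 powr (s - \<alpha>)) * (f z * indicator disk z) \<partial>lborel)"
    proof (intro mult_left_mono nn_integral_mono)
      fix z :: complex
      show "ennreal (2 powr (s - \<alpha>)) * (f z * indicator disk z) \<le> f (?T z) * indicator disk z"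
      proof (cases "z \<in> disk")
        case True
        then have z: "cmod z < 1" "z \<noteq> 1"
          by auto
        have T1: "1 - ?T z = (1/2::real) *\<^sub>R (1 - z)"
          by (simp add: algebra_simps scaleR_conv_of_real)
        \<comment> \<open>A quarter of this square is exactly the gap between
          \<open>(1 + (cmod z)^2) / 2\<close> and the squared modulus of the contracted point. The
          weight thus loses at most the factor \<open>2 powr (- \<alpha>)\<close>, while halving
          \<open>1 - z\<close> gains \<open>2 powr s\<close> for the kernel.\<close>
        have "0 \<le> (cmod (1 - z))\<^sup>2" by simp
        then have "(cmod (?T z))\<^sup>2 \<le> (1 + (cmod z)\<^sup>2) / 2"
          unfolding cmod_power2 by (simp add: power2_eq_square field_simps)
        then have "(1 - (cmod z)\<^sup>2) / 2 \<le> 1 - (cmod (?T z))\<^sup>2"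
          by (simp add: field_simps)
        then have "((1 - (cmod z)\<^sup>2) / 2) powr \<alpha> \<le> (1 - (cmod (?T z))\<^sup>2) powr \<alpha>"
          using \<alpha> z by (intro powr_mono2) (auto simp: power_le_one)
        then have "(1 - (cmod z)\<^sup>2) powr \<alpha> * 2 powr (- \<alpha>) \<le> (1 - (cmod (?T z))\<^sup>2) powr \<alpha>"
          using powr_divide[of "1 - (cmod z)\<^sup>2" 2 \<alpha>] z by (simp add: power_le_one powr_minus_divide)
        then have w: "dA_weight \<alpha> z * 2 powr (- \<alpha>) \<le> dA_weight \<alpha> (?T z)"
          using mult_left_mono[of "(1 - (cmod z)\<^sup>2) powr \<alpha> * 2 powr (- \<alpha>)" "(1 - (cmod (?T z))\<^sup>2) powr \<alpha>" "(1 + \<alpha>) / pi"] \<alpha>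
          by (simp add: dA_weight_def mult.assoc)
        have k: "cmod (1 - ?T z) powr (- s) = 2 powr s * cmod (1 - z) powr (- s)"
          using powr_divide[of "cmod (1 - z)" 2 "- s"] unfolding T1 by (simp add: powr_minus_divide)
        have "2 powr (s - \<alpha>) * (dA_weight \<alpha> z * cmod (1 - z) powr (- s)) = (dA_weight \<alpha> z * 2 powr (- \<alpha>)) * (2 powr s * cmod (1 - z) powr (- s))"
          by (simp add: powr_diff powr_minus_divide)
        also have "\<dots> \<le> dA_weight \<alpha> (?T z) * cmod (1 - ?T z) powr (- s)"
          unfolding k by (intro mult_right_mono w) auto
        finally have "ennreal (2 powr (s - \<alpha>) * (dA_weight \<alpha> z * cmod (1 - z) powr (- s))) \<le> f (?T z)"
          unfolding f_def by (rule ennreal_leI)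
        then show ?thesis
          using True by (simp add: f_def ennreal_mult')
      qed simp
    qed auto
    also have "(\<integral>\<^sup>+z. ennreal (2 powr (s - \<alpha>)) * (f z * indicator disk z) \<partial>lborel) = ennreal (2 powr (s - \<alpha>)) * ennreal I"
      unfolding fI[symmetric] by (rule nn_integral_cmult) measurable
    also have "ennreal (1/4) * (ennreal (2 powr (s - \<alpha>)) * ennreal I) = ennreal (1/4 * (2 powr (s - \<alpha>) * I))"
      by (simp add: I_def ennreal_mult[symmetric])
    also have "1/4 * (2 powr (s - \<alpha>) * I) = 2 powr (s - 2 - \<alpha>) * I"
      by (simp add: powr_diff)
    finally show ?thesis .
  qed
  have "ennreal (2 powr (s - 2 - \<alpha>) * I) + ennreal \<rho> \<le> (\<integral>\<^sup>+z. f z * indicator B1 z \<partial>lborel) + (\<integral>\<^sup>+z. f z * indicator B2 z \<partial>lborel)"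
    by (intro add_mono 1 2)
  also have "\<dots> = (\<integral>\<^sup>+z. f z * indicator B1 z + f z * indicator B2 z \<partial>lborel)"
    by (rule nn_integral_add[symmetric]) measurable
  also have "\<dots> \<le> (\<integral>\<^sup>+z. f z * indicator disk z \<partial>lborel)"
    using disj sub by (intro nn_integral_mono) (auto simp: indicator_def)
  finally have "ennreal (2 powr (s - 2 - \<alpha>) * I + \<rho>) \<le> ennreal I"
    using \<open>\<rho> > 0\<close> by (simp add: fI I_def)
  then have le: "2 powr (s - 2 - \<alpha>) * I + \<rho> \<le> I"
    by (subst (asm) ennreal_le_iff) (auto simp: I_def)
  have "(2::real) powr (s - 2 - \<alpha>) < 2 powr 0"
    using s by (intro powr_less_mono) auto
  then have "\<rho> / (1 - 2 powr (s - 2 - \<alpha>)) \<le> I"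
    using le by (subst pos_divide_le_eq) (auto simp: algebra_simps)
  then show "\<rho> / (1 - 2 powr (c * p - 2 - \<alpha>)) \<le> N (cauchy_kernel c) powr p"
    by (simp add: s_def I_def)
qed

lemma eventually_crit: "eventually (\<lambda>c. \<alpha> / p < c \<and> c < crit) (at_left crit)"
  using crit_pos(2) by (auto simp: eventually_at_left)

text \<open>As \<open>c * p\<close> increases to \<open>2 + \<alpha>\<close>, the denominator of the
  self-similarity bound tends to zero from above while its numerator \<rho> stays fixed.\<close>

lemma norm_cauchy_kernel_at_top: "filterlim (\<lambda>c. N (cauchy_kernel c)) at_top (at_left crit)"
proof -
  obtain \<rho> where \<rho>: "\<rho> > 0" "\<And>c. \<alpha> / p < c \<Longrightarrow> c < crit \<Longrightarrow>
    \<rho> / (1 - 2 powr (c * p - 2 - \<alpha>)) \<le> N (cauchy_kernel c) powr p"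
    using norm_cauchy_kernel_lower by blast
  have lim: "((\<lambda>c. 1 - 2 powr (c * p - 2 - \<alpha>)) \<longlongrightarrow> 1 - 2 powr (crit * p - 2 - \<alpha>)) (at_left crit)"
    by (intro tendsto_intros) auto
  have pos: "eventually (\<lambda>c. 1 - 2 powr (c * p - 2 - \<alpha>) > 0) (at_left crit)"
    using eventually_crit
  proof eventually_elim
    case (elim c)
    then have "c * p < crit * p"
      using p by (intro mult_strict_right_mono) auto
    then have "(2::real) powr (c * p - 2 - \<alpha>) < 2 powr 0"
      using crit_pos(4) by (intro powr_less_mono) auto
    then show ?case by simp
  qed
  have "filterlim (\<lambda>c. \<rho> / (1 - 2 powr (c * p - 2 - \<alpha>))) at_top (at_left crit)"
    using lim pos \<rho>(1) by (intro LIM_at_top_divide[OF tendsto_const]) (auto simp: crit_pos(4))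
  then have "filterlim (\<lambda>c. N (cauchy_kernel c) powr p) at_top (at_left crit)"
    by (rule filterlim_at_top_mono) (use eventually_crit \<rho>(2) in \<open>auto elim: eventually_mono\<close>)
  then have ev: "eventually (\<lambda>c. Z \<le> N (cauchy_kernel c) powr p) (at_left crit)" for Z
    by (simp add: filterlim_at_top)
  show ?thesis
    unfolding filterlim_at_top
  proof
    fix Z :: real
    show "eventually (\<lambda>c. Z \<le> N (cauchy_kernel c)) (at_left crit)"
      using ev[of "\<bar>Z\<bar> powr p"]
    proof eventually_elim
      case (elim c)
      then show ?case
        using powr_less_mono2[of p "N (cauchy_kernel c)" "\<bar>Z\<bar>"] p by fastforce
    qed
  qed
qed

end

section \<open>Concentration at the boundary points\<close>

context bergman
begin

definition lp2 :: "complex \<Rightarrow> complex \<Rightarrow> real" where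
  "lp2 a b = (cmod a powr p + cmod b powr p) powr (1 / p)"

lemma lp2_nonneg [simp]: "lp2 a b \<ge> 0"
  by (simp add: lp2_def)

lemma lp2_powr: "lp2 a b powr p = cmod a powr p + cmod b powr p"
  using p by (simp add: lp2_def powr_powr)

lemma norm_kernel_eventually_ge: "eventually (\<lambda>c. N (cauchy_kernel c) \<ge> Z) (at_left crit)"
  using norm_cauchy_kernel_at_top by (simp add: filterlim_at_top)

text \<open>Since the norms of the kernels tend to infinity, only the behaviour at \<open>1\<close> matters.\<close>

lemma norm_ratio_tendsto_0:
  assumes "\<And>\<eta>. \<eta> > 0 \<Longrightarrow> \<exists>B\<in>L. eventually (\<lambda>c. F c \<in> borel_measurable \<mu> \<and>
      (\<forall>z\<in>disk. cmod (F c z) \<le> \<eta> * cmod (cauchy_kernel c z) + cmod (B z))) (at_left crit)"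
  shows "((\<lambda>c. N (F c) / N (cauchy_kernel c)) \<longlongrightarrow> 0) (at_left crit)"
proof (rule tendstoI)
  fix e :: real assume e: "e > 0"
  then obtain B where B: "B \<in> L" and ev: "eventually (\<lambda>c. F c \<in> borel_measurable \<mu> \<and>
      (\<forall>z\<in>disk. cmod (F c z) \<le> e/3 * cmod (cauchy_kernel c z) + cmod (B z))) (at_left crit)"
    using assms[of "e/3"] by auto
  \<comment> \<open>The threshold on the kernel norm forces \<open>N B\<close> below
    \<open>e/3\<close> times that norm, so the total stays below two thirds of \<open>e\<close>
    times it. The summand 1 keeps the norm positive even if \<open>N B\<close> vanishes.\<close>
  show "eventually (\<lambda>c. dist (N (F c) / N (cauchy_kernel c)) 0 < e) (at_left crit)"
    using ev eventually_crit norm_kernel_eventually_ge[of "3 * N B / e + 1"]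
  proof eventually_elim
    case (elim c)
    have K: "cauchy_kernel c \<in> L"
      using elim by (intro A_L cauchy_kernel_A) auto
    let ?k = "\<lambda>z. complex_of_real (cmod (cauchy_kernel c z))" and ?b = "\<lambda>z. complex_of_real (cmod (B z))"
    have m [measurable]: "cauchy_kernel c \<in> borel_measurable \<mu>" "B \<in> borel_measurable \<mu>"
      using LpD(1)[OF K] LpD(1)[OF B] by auto
    have kL: "?k \<in> L" "N ?k = N (cauchy_kernel c)" and bL: "?b \<in> L" "N ?b = N B"
      using N_mono(1)[of ?k, OF _ K] N_mono(1)[of ?b, OF _ B] by (auto intro: bergman_norm_cong)
    have "N (F c) \<le> N (\<lambda>z. of_real (e/3) * ?k z + ?b z)"
    proof (rule N_mono(2))
      show "(\<lambda>z. of_real (e/3) * ?k z + ?b z) \<in> L"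
        by (intro L_add L_cmult kL bL)
      show "cmod (F c z) \<le> cmod (of_real (e/3) * ?k z + ?b z)" if "z \<in> disk" for z
      proof -
        have "of_real (e/3) * ?k z + ?b z = of_real (e/3 * cmod (cauchy_kernel c z) + cmod (B z))"
          by simp
        then have "cmod (of_real (e/3) * ?k z + ?b z) = \<bar>e/3 * cmod (cauchy_kernel c z) + cmod (B z)\<bar>"
          by (simp only: norm_of_real)
        then show ?thesis
          using elim(1) that e by fastforce
      qed
    qed (use elim in auto)
    also have "\<dots> \<le> e/3 * N (cauchy_kernel c) + N B"
      using N_triangle[OF L_cmult[OF kL(1), of "of_real (e/3)"] bL(1)] e
      unfolding N_cmult kL(2) bL(2) by (simp add: norm_divide)
    finally have le: "N (F c) \<le> e/3 * N (cauchy_kernel c) + N B" .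
    have K0: "N (cauchy_kernel c) > 0"
      using elim(3) e bergman_norm_nonneg[of p \<alpha> B] by (smt (verit) divide_nonneg_pos)
    have "N B < e/3 * N (cauchy_kernel c)"
      using elim(3) e by (simp add: field_simps)
    with le have "N (F c) < e * N (cauchy_kernel c)"
    proof -
      have "e/3 * N (cauchy_kernel c) = e * N (cauchy_kernel c) / 3"
        by simp
      then show ?thesis
        using mult_pos_pos[OF e K0] le \<open>N B < _\<close> by linarith
    qed
    then show ?case
      using K0 by (simp add: field_simps)
  qed
qed

lemma norm_cauchy_kernel_reflect: "N (\<lambda>z. cauchy_kernel c (- z)) = N (cauchy_kernel c)"
  by (rule bergman_norm_reflect[OF cauchy_kernel_measurable(1)])

lemma kernel_combination_A:
  assumes "\<alpha> / p < c" "c < crit"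
  shows "(\<lambda>z. a * cauchy_kernel c z + b * cauchy_kernel c (- z)) \<in> A"
  by (intro A_add_scale cauchy_kernel_A cauchy_kernel_reflect_A assms)

text \<open>The bound is uniform in \<open>c\<close> up to the critical value;
  \<open>\<epsilon> \<le> 1\<close> makes the power grow as its exponent decreases to
  \<open>- crit\<close>.\<close>

lemma cauchy_kernel_far_le:
  assumes "0 < \<epsilon>" "\<epsilon> \<le> 1" "\<epsilon> \<le> cmod (1 - z)" "0 \<le> c" "c \<le> crit"
  shows "cmod (cauchy_kernel c z) \<le> \<epsilon> powr (- crit)"
proof -
  have "cmod (1 - z) powr (- c) \<le> \<epsilon> powr (- c)"
    using assms by (intro powr_mono2') auto
  also have "\<dots> \<le> \<epsilon> powr (- crit)"
    using assms by (intro powr_mono') auto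
  finally show ?thesis
    using assms by (subst cmod_cauchy_kernel) auto
qed

text \<open>The two kernels do not interact in the limit, because on each side of the imaginary axis
  one of them has modulus at most one. Keeping only the dominant term on each half, which gives
  \<open>H\<close>, costs a bounded function; for \<open>H\<close> the p-th powers of the two norms
  add up to within a bounded error. Division by the diverging kernel norm removes both
  errors.\<close>

lemma norm_kernel_combination:
  "((\<lambda>c. N (\<lambda>z. a * cauchy_kernel c z + b * cauchy_kernel c (- z)) / N (cauchy_kernel c)) \<longlongrightarrow> lp2 a b)
     (at_left crit)"
proof -
  define H where "H c z = (if Re z > 0 then a * cauchy_kernel c z else b * cauchy_kernel c (- z))" for c z
  let ?V = "\<lambda>c z. a * cauchy_kernel c z + b * cauchy_kernel c (- z)"
  have Hm: "H c \<in> borel_measurable \<mu>" for c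
  proof -
    have [measurable]: "Re \<in> borel_measurable \<mu>"
      by (intro measurable_dA_of_borel) auto
    show ?thesis
      unfolding H_def using cauchy_kernel_measurable[of c] by measurable
  qed
  have far: "cmod (cauchy_kernel c z) \<le> 1" if "Re z \<le> 0" "0 \<le> c" "c \<le> crit" for c z
  proof -
    have "1 \<le> cmod (1 - z)"
      using complex_Re_le_cmod[of "1 - z"] that by simp
    then show ?thesis
      using cauchy_kernel_far_le[of 1 z c] that by simp
  qed
  have c_bounds: "0 \<le> c" "c \<le> crit" if "\<alpha> / p < c" "c < crit" for c
    using that crit_pos(3) by auto
  have 1: "((\<lambda>c. N (\<lambda>z. ?V c z - H c z) / N (cauchy_kernel c)) \<longlongrightarrow> 0) (at_left crit)"
  proof (rule norm_ratio_tendsto_0)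
    fix \<eta> :: real assume \<eta>: "\<eta> > 0"
    let ?B = "\<lambda>z::complex. complex_of_real (cmod a + cmod b)"
    have "eventually (\<lambda>c. (\<lambda>z. ?V c z - H c z) \<in> borel_measurable \<mu> \<and>
      (\<forall>z\<in>disk. cmod (?V c z - H c z) \<le> \<eta> * cmod (cauchy_kernel c z) + cmod (?B z))) (at_left crit)"
      using eventually_crit
    proof eventually_elim
      case (elim c)
      have "(\<lambda>z. ?V c z - H c z) \<in> borel_measurable \<mu>"
        using Hm[of c] cauchy_kernel_measurable[of c] by measurable
      moreover have "cmod (?V c z - H c z) \<le> \<eta> * cmod (cauchy_kernel c z) + cmod (?B z)" for z
      proof -
        have "cmod (?V c z - H c z) \<le> cmod a + cmod b"
        proof (cases "Re z > 0")
          case True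
          then have "cmod (cauchy_kernel c (- z)) \<le> 1"
            using c_bounds elim by (intro far) auto
          then have "cmod b * cmod (cauchy_kernel c (- z)) \<le> cmod b * 1"
            by (intro mult_left_mono) auto
          then show ?thesis
            using True by (simp add: H_def norm_mult add_increasing)
        next
          case False
          then have "cmod (cauchy_kernel c z) \<le> 1"
            using c_bounds elim by (intro far) auto
          then have "cmod a * cmod (cauchy_kernel c z) \<le> cmod a * 1"
            by (intro mult_left_mono) auto
          then show ?thesis
            using False by (simp add: H_def norm_mult add_increasing2)
        qed
        also have "\<dots> = cmod (?B z)"
          by (simp only: norm_of_real) simp
        finally show ?thesis
          using \<eta> by (simp add: add_increasing)
      qed
      ultimately show ?case by simp
    qed
    then show "\<exists>B\<in>L. eventually (\<lambda>c. (\<lambda>z. ?V c z - H c z) \<in> borel_measurable \<mu> \<and>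
      (\<forall>z\<in>disk. cmod (?V c z - H c z) \<le> \<eta> * cmod (cauchy_kernel c z) + cmod (B z))) (at_left crit)"
      by (intro bexI[of _ ?B] L_const)
  qed
  define l where "l = cmod a powr p + cmod b powr p"
  define m where "m = measure \<mu> (space \<mu>)"
  \<comment> \<open>The error \<open>l * m\<close> accounts for the halves that \<open>H\<close>
    discards: there each kernel has p-th power at most one, and \<open>m\<close> is the total mass
    of the disk.\<close>
  have HL: "H c \<in> L" and Hbound: "\<bar>N (H c) powr p - l * N (cauchy_kernel c) powr p\<bar> \<le> l * m"
    if c: "\<alpha> / p < c" "c < crit" for c
  proof -
    have K: "cauchy_kernel c \<in> L" and K': "(\<lambda>z. cauchy_kernel c (- z)) \<in> L"
      using c by (auto intro!: A_L cauchy_kernel_A cauchy_kernel_reflect_A)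
    let ?k = "\<lambda>z. cmod a powr p * cmod (cauchy_kernel c z) powr p + cmod b powr p * cmod (cauchy_kernel c (- z)) powr p"
    have k_int: "integrable \<mu> ?k"
      using LpD(2)[OF K] LpD(2)[OF K'] by (intro Bochner_Integration.integrable_add integrable_mult_right)
    have H_le: "cmod (H c z) powr p \<le> ?k z" for z
      by (simp add: H_def norm_mult powr_mult add_increasing add_increasing2)
    have H_int: "integrable \<mu> (\<lambda>z. cmod (H c z) powr p)"
    proof (rule Bochner_Integration.integrable_bound[OF k_int])
      show "(\<lambda>z. cmod (H c z) powr p) \<in> borel_measurable \<mu>"
        using Hm[of c] by measurable
      show "AE z in \<mu>. norm (cmod (H c z) powr p) \<le> norm (?k z)"
        using H_le by (intro AE_I2) (simp add: order_trans[OF _ abs_ge_self])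
    qed
    then show "H c \<in> L"
      using Hm by (simp add: Lp_def)
    have one: "cmod (cauchy_kernel c z) powr p \<le> 1" if "Re z \<le> 0" for z
      using powr_mono2[of p "cmod (cauchy_kernel c z)" 1] far[OF that c_bounds[OF c]] p by simp
    have diff: "\<bar>?k z - cmod (H c z) powr p\<bar> \<le> l" for z
    proof (cases "Re z > 0")
      case True
      then show ?thesis
        using mult_left_mono[OF one[of "- z"], of "cmod b powr p"]
        by (simp add: H_def norm_mult powr_mult l_def add_increasing)
    next
      case False
      then show ?thesis
        using mult_left_mono[OF one[of z], of "cmod a powr p"]
        by (simp add: H_def norm_mult powr_mult l_def add_increasing2)
    qed
    have "(LINT z|\<mu>. ?k z) = l * N (cauchy_kernel c) powr p"
      using LpD(2)[OF K] LpD(2)[OF K'] N_powr[of "cauchy_kernel c"] N_powr[of "\<lambda>z. cauchy_kernel c (- z)"]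
      by (simp add: norm_cauchy_kernel_reflect l_def distrib_right)
    then have "N (H c) powr p - l * N (cauchy_kernel c) powr p = (LINT z|\<mu>. cmod (H c z) powr p - ?k z)"
      using H_int k_int by (subst Bochner_Integration.integral_diff) (auto simp: N_powr)
    also have "\<bar>\<dots>\<bar> \<le> (LINT z|\<mu>. l)"
    proof (rule integral_abs_bound_integral)
      show "\<bar>cmod (H c z) powr p - ?k z\<bar> \<le> l" for z
        using diff[of z] by (simp add: abs_minus_commute)
    qed (use H_int k_int in auto)
    also have "\<dots> = l * m"
      by (simp add: m_def)
    finally show "\<bar>N (H c) powr p - l * N (cauchy_kernel c) powr p\<bar> \<le> l * m" .
  qed
  have inv: "((\<lambda>c. inverse (N (cauchy_kernel c))) \<longlongrightarrow> 0) (at_left crit)"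
    by (rule tendsto_inverse_0_at_top[OF norm_cauchy_kernel_at_top])
  have "((\<lambda>c. N (H c) powr p / N (cauchy_kernel c) powr p - l) \<longlongrightarrow> 0) (at_left crit)"
  proof (rule Lim_null_comparison)
    show "eventually (\<lambda>c. norm (N (H c) powr p / N (cauchy_kernel c) powr p - l) \<le> l * m * (inverse (N (cauchy_kernel c))) powr p) (at_left crit)"
      using eventually_crit norm_kernel_eventually_ge[of 1]
    proof eventually_elim
      case (elim c)
      let ?n = "N (cauchy_kernel c) powr p"
      have n: "?n > 0" using elim by simp
      have "norm (N (H c) powr p / ?n - l) = \<bar>N (H c) powr p - l * ?n\<bar> / ?n"
      proof -
        have "N (H c) powr p / ?n - l = (N (H c) powr p - l * ?n) / ?n"
          using n by (simp add: diff_divide_distrib)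
        then show ?thesis
          using n by (simp only: real_norm_def abs_divide abs_of_pos)
      qed
      also have "\<dots> \<le> l * m / ?n"
        using n Hbound elim by (intro divide_right_mono) auto
      also have "\<dots> = l * m * (inverse (N (cauchy_kernel c))) powr p"
        using elim by (simp add: divide_inverse powr_def ln_inverse exp_minus)
      finally show ?case .
    qed
    have "((\<lambda>c. (inverse (N (cauchy_kernel c))) powr p) \<longlongrightarrow> 0 powr p) (at_left crit)"
      using p by (intro tendsto_powr' inv tendsto_const) auto
    then show "((\<lambda>c. l * m * (inverse (N (cauchy_kernel c))) powr p) \<longlongrightarrow> 0) (at_left crit)"
      using tendsto_mult_right_zero[of "\<lambda>c. (inverse (N (cauchy_kernel c))) powr p" _ "l * m"] by simp
  qed
  then have "((\<lambda>c. N (H c) powr p / N (cauchy_kernel c) powr p) \<longlongrightarrow> l) (at_left crit)"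
    by (rule LIM_zero_cancel)
  then have "((\<lambda>c. (N (H c) powr p / N (cauchy_kernel c) powr p) powr (1/p)) \<longlongrightarrow> l powr (1/p)) (at_left crit)"
    using p by (intro tendsto_powr' tendsto_const) (auto simp: l_def)
  also have "(\<lambda>c. (N (H c) powr p / N (cauchy_kernel c) powr p) powr (1/p)) = (\<lambda>c. N (H c) / N (cauchy_kernel c))"
    using p by (simp add: powr_divide[symmetric] powr_powr)
  finally have 2: "((\<lambda>c. N (H c) / N (cauchy_kernel c)) \<longlongrightarrow> lp2 a b) (at_left crit)"
    by (simp add: l_def lp2_def)
  have "((\<lambda>c. N (?V c) / N (cauchy_kernel c) - N (H c) / N (cauchy_kernel c)) \<longlongrightarrow> 0) (at_left crit)"
  proof (rule Lim_null_comparison[OF _ 1])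
    show "eventually (\<lambda>c. norm (N (?V c) / N (cauchy_kernel c) - N (H c) / N (cauchy_kernel c)) \<le> N (\<lambda>z. ?V c z - H c z) / N (cauchy_kernel c)) (at_left crit)"
      using eventually_crit
    proof eventually_elim
      case (elim c)
      have "\<bar>N (?V c) - N (H c)\<bar> \<le> N (\<lambda>z. ?V c z - H c z)"
        using elim by (intro N_abs_diff A_L kernel_combination_A HL) auto
      then show ?case
        by (simp flip: diff_divide_distrib add: divide_right_mono)
    qed
  qed
  from tendsto_add[OF this 2] show ?thesis
    by simp
qed

section \<open>Kernels composed with a self-map of the disk\<close>

lemma cauchy_kernel_comp_near:
  assumes "z \<in> disk" "w \<in> disk" "q = (1 - w) / (1 - z)" "Re q > 0"
  shows "cauchy_kernel c w = cauchy_kernel c z * exp (- of_real c * Ln q)"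
proof -
  have z: "1 - z \<noteq> 0" and w: "1 - w \<noteq> 0"
    using assms(1,2) by auto
  \<comment> \<open>Both \<open>1 - z\<close> and \<open>q\<close> lie in the right half-plane, so
    their arguments add up to less than \<open>pi\<close> in modulus and the principal logarithm of
    the product has no jump.\<close>
  have "Ln ((1 - z) * q) = Ln (1 - z) + Ln q"
  proof (rule Ln_times_simple)
    have "\<bar>Im (Ln (1 - z))\<bar> < pi / 2" "\<bar>Im (Ln q)\<bar> < pi / 2"
      using Re_Ln_pos_lt[OF z] Re_Ln_pos_lt[of q] Re_one_minus_disk[OF assms(1)] assms(4) by force+
    then show "- pi < Im (Ln (1 - z)) + Im (Ln q)" "Im (Ln (1 - z)) + Im (Ln q) \<le> pi"
      by linarith+
  qed (use z assms(4) in auto)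
  then have "Ln (1 - w) = Ln (1 - z) + Ln q"
    using assms(3) z by simp
  then show ?thesis
    using z w by (simp add: cauchy_kernel_def powr_def algebra_simps flip: exp_add)
qed

text \<open>Near \<open>1\<close> the composed kernel is the kernel times a power of the quotient
  \<open>(1 - \<phi> z) / (1 - z)\<close> with exponent \<open>- c\<close>. The quotient tends to
  \<open>d\<close>, which together with the limit of \<open>u\<close> gives the coefficient. Away
  from \<open>1\<close>, the hypothesis \<open>far\<close> keeps both kernels bounded uniformly in
  \<open>c\<close>; what remains is a multiple of \<open>cmod (u z)\<close> plus a constant, a fixed
  function in \<open>L\<close>.\<close>

lemma weighted_comp_kernel_asymp:
  assumes u: "u \<in> L" "(u \<longlongrightarrow> u1) (at 1 within disk)"
    and \<phi>: "continuous_on disk \<phi>" "\<phi> ` disk \<subseteq> disk"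
    and d: "((\<lambda>z. (1 - \<phi> z) / (1 - z)) \<longlongrightarrow> of_real d) (at 1 within disk)" "d > 0"
    and far: "\<And>\<epsilon>. \<epsilon> > 0 \<Longrightarrow> \<exists>\<delta>>0. \<forall>z\<in>disk - ball 1 \<epsilon>. \<delta> \<le> cmod (1 - \<phi> z)"
  shows "((\<lambda>c. N (\<lambda>z. u z * cauchy_kernel c (\<phi> z) - u1 * of_real (d powr (- crit)) * cauchy_kernel c z)
            / N (cauchy_kernel c)) \<longlongrightarrow> 0) (at_left crit)"
proof (rule norm_ratio_tendsto_0)
  fix \<eta> :: real assume \<eta>: "\<eta> > 0"
  let ?q = "\<lambda>z. (1 - \<phi> z) / (1 - z)"
  define v where "v = u1 * complex_of_real (d powr (- crit))"
  have kcm: "(\<lambda>z. cauchy_kernel c (\<phi> z)) \<in> borel_measurable \<mu>" for c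
    using continuous_on_compose2[OF holomorphic_on_imp_continuous_on[OF cauchy_kernel_holomorphic] \<phi>] by auto
  \<comment> \<open>A joint limit in \<open>z\<close> and \<open>c\<close> yields one neighbourhood
    of \<open>1\<close> on which the estimate holds for all \<open>c\<close> close to
    \<open>crit\<close>. The constants for the rest of the disk can then be chosen independently of
    \<open>c\<close>.\<close>
  have "((\<lambda>x. u (fst x) * exp (- of_real (snd x) * Ln (?q (fst x))) - v)
      \<longlongrightarrow> u1 * exp (- of_real crit * Ln (of_real d)) - v) ((at 1 within disk) \<times>\<^sub>F at_left crit)"
  proof (intro tendsto_intros)
    show "((\<lambda>x. u (fst x)) \<longlongrightarrow> u1) ((at 1 within disk) \<times>\<^sub>F at_left crit)"
      by (rule filterlim_compose[OF u(2) filterlim_fst])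
    show "((\<lambda>x. ?q (fst x)) \<longlongrightarrow> of_real d) ((at 1 within disk) \<times>\<^sub>F at_left crit)"
      by (rule filterlim_compose[OF d(1) filterlim_fst])
    show "((\<lambda>x. snd x) \<longlongrightarrow> crit) ((at (1::complex) within disk) \<times>\<^sub>F at_left crit)"
      by (rule filterlim_compose[OF tendsto_ident_at filterlim_snd])
    show "complex_of_real d \<notin> \<real>\<^sub>\<le>\<^sub>0"
      using d(2) by (simp add: complex_nonpos_Reals_iff)
  qed
  also have "u1 * exp (- of_real crit * Ln (of_real d)) - v = 0"
    using d(2) by (simp add: v_def powr_def Ln_of_real exp_of_real[symmetric])
  finally have "eventually (\<lambda>x. dist (u (fst x) * exp (- of_real (snd x) * Ln (?q (fst x))) - v) 0 < \<eta>) ((at 1 within disk) \<times>\<^sub>F at_left crit)"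
    using \<eta> by (rule tendstoD)
  then obtain P Q where P: "eventually P (at 1 within disk)" and Q: "eventually Q (at_left crit)"
    and PQ: "\<And>z c. P z \<Longrightarrow> Q c \<Longrightarrow> cmod (u z * exp (- of_real c * Ln (?q z)) - v) < \<eta>"
    unfolding eventually_prod_filter by auto
  have "eventually (\<lambda>z. Re (?q z) > 0) (at 1 within disk)"
    using order_tendstoD(1)[OF tendsto_Re[OF d(1)], of 0] d(2) by simp
  with P have "eventually (\<lambda>z. P z \<and> Re (?q z) > 0) (at 1 within disk)"
    by (rule eventually_conj)
  then obtain \<epsilon>0 where \<epsilon>0: "\<epsilon>0 > 0" "\<And>z. z \<in> disk \<Longrightarrow> z \<noteq> 1 \<Longrightarrow> dist z 1 < \<epsilon>0 \<Longrightarrow> P z \<and> Re (?q z) > 0"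
    unfolding eventually_at by blast
  define \<epsilon> where "\<epsilon> = min \<epsilon>0 1"
  have \<epsilon>: "\<epsilon> > 0" "\<epsilon> \<le> 1" "\<epsilon> \<le> \<epsilon>0"
    using \<epsilon>0 by (auto simp: \<epsilon>_def)
  obtain \<delta>0 where \<delta>0: "\<delta>0 > 0" "\<And>z. z \<in> disk - ball 1 \<epsilon> \<Longrightarrow> \<delta>0 \<le> cmod (1 - \<phi> z)"
    using far[OF \<epsilon>(1)] by blast
  define \<delta> where "\<delta> = min \<delta>0 1"
  have \<delta>: "\<delta> > 0" "\<delta> \<le> 1" "\<And>z. z \<in> disk - ball 1 \<epsilon> \<Longrightarrow> \<delta> \<le> cmod (1 - \<phi> z)"
    using \<delta>0 by (force simp: \<delta>_def)+
  let ?B = "\<lambda>z. complex_of_real (cmod (u z) * \<delta> powr (- crit) + cmod v * \<epsilon> powr (- crit))"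
  have um [measurable]: "u \<in> borel_measurable \<mu>"
    by (rule LpD(1)[OF u(1)])
  have uL: "(\<lambda>z. complex_of_real (cmod (u z))) \<in> L"
    by (rule N_mono(1)[OF _ u(1)]) auto
  have "?B \<in> L"
    using L_add[OF L_cmult[OF uL, of "of_real (\<delta> powr (- crit))"] L_const[of "of_real (cmod v * \<epsilon> powr (- crit))"]]
    by (simp add: mult.commute)
  moreover have "eventually (\<lambda>c. (\<lambda>z. u z * cauchy_kernel c (\<phi> z) - v * cauchy_kernel c z) \<in> borel_measurable \<mu> \<and>
      (\<forall>z\<in>disk. cmod (u z * cauchy_kernel c (\<phi> z) - v * cauchy_kernel c z) \<le> \<eta> * cmod (cauchy_kernel c z) + cmod (?B z))) (at_left crit)"
    using Q eventually_crit
  proof eventually_elim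
    case (elim c)
    then have c: "0 \<le> c" "c \<le> crit"
      using crit_pos(3) by auto
    have "(\<lambda>z. u z * cauchy_kernel c (\<phi> z) - v * cauchy_kernel c z) \<in> borel_measurable \<mu>"
      using kcm[of c] cauchy_kernel_measurable(1)[of c] by measurable
    moreover have "cmod (u z * cauchy_kernel c (\<phi> z) - v * cauchy_kernel c z) \<le> \<eta> * cmod (cauchy_kernel c z) + cmod (?B z)"
      if z: "z \<in> disk" for z
    proof (cases "z \<in> ball 1 \<epsilon>")
      case True
      then have Pz: "P z" "Re (?q z) > 0"
        using \<epsilon>0(2)[of z] \<epsilon> z one_notin_disk(1)[OF z] by (auto simp: dist_commute)
      have "\<phi> z \<in> disk"
        using \<phi>(2) z by blast
      then have "u z * cauchy_kernel c (\<phi> z) - v * cauchy_kernel c z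
          = (u z * exp (- of_real c * Ln (?q z)) - v) * cauchy_kernel c z"
        using cauchy_kernel_comp_near[OF z _ refl Pz(2), of c] by (simp add: algebra_simps)
      then have "cmod (u z * cauchy_kernel c (\<phi> z) - v * cauchy_kernel c z)
          = cmod (u z * exp (- of_real c * Ln (?q z)) - v) * cmod (cauchy_kernel c z)"
        by (simp only: norm_mult)
      also have "\<dots> \<le> \<eta> * cmod (cauchy_kernel c z)"
        using PQ[OF Pz(1) elim(1)] by (intro mult_right_mono) auto
      finally show ?thesis
        by (simp add: add_increasing2)
    next
      case False
      then have f: "\<epsilon> \<le> cmod (1 - z)" "\<delta> \<le> cmod (1 - \<phi> z)"
        using z \<delta>(3)[of z] by (auto simp: dist_norm)
      have "cmod (u z * cauchy_kernel c (\<phi> z) - v * cauchy_kernel c z)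
          \<le> cmod (u z) * cmod (cauchy_kernel c (\<phi> z)) + cmod v * cmod (cauchy_kernel c z)"
        using norm_triangle_ineq4[of "u z * cauchy_kernel c (\<phi> z)" "v * cauchy_kernel c z"] by (simp only: norm_mult)
      also have "\<dots> \<le> cmod (u z) * \<delta> powr (- crit) + cmod v * \<epsilon> powr (- crit)"
        using cauchy_kernel_far_le[OF \<delta>(1,2) f(2) c] cauchy_kernel_far_le[OF \<epsilon>(1,2) f(1) c]
        by (intro add_mono mult_left_mono) auto
      also have "\<dots> = cmod (?B z)"
        unfolding norm_of_real by simp
      finally show ?thesis
        using \<eta> by (simp add: add_increasing)
    qed
    ultimately show ?case by blast
  qed
  ultimately show "\<exists>B\<in>L. eventually (\<lambda>c. (\<lambda>z. u z * cauchy_kernel c (\<phi> z) - u1 * of_real (d powr (- crit)) * cauchy_kernel c z) \<in> borel_measurable \<mu> \<and>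
      (\<forall>z\<in>disk. cmod (u z * cauchy_kernel c (\<phi> z) - u1 * of_real (d powr (- crit)) * cauchy_kernel c z) \<le> \<eta> * cmod (cauchy_kernel c z) + cmod (B z))) (at_left crit)"
    unfolding v_def[symmetric] by (intro bexI[of _ ?B])
qed

text \<open>Conjugating \<open>u\<close> and \<phi> with the reflection moves the boundary point
  \<open>-1\<close> to \<open>1\<close> and preserves norms.\<close>

lemma weighted_comp_kernel_asymp_reflect:
  assumes u: "u \<in> L" "(u \<longlongrightarrow> u1) (at (-1) within disk)"
    and \<phi>: "continuous_on disk \<phi>" "\<phi> ` disk \<subseteq> disk"
    and d: "((\<lambda>z. (1 + \<phi> z) / (1 + z)) \<longlongrightarrow> of_real d) (at (-1) within disk)" "d > 0"
    and far: "\<And>\<epsilon>. \<epsilon> > 0 \<Longrightarrow> \<exists>\<delta>>0. \<forall>z\<in>disk - ball (-1) \<epsilon>. \<delta> \<le> cmod (1 + \<phi> z)"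
  shows "((\<lambda>c. N (\<lambda>z. u z * cauchy_kernel c (- \<phi> z) - u1 * of_real (d powr (- crit)) * cauchy_kernel c (- z))
            / N (cauchy_kernel c)) \<longlongrightarrow> 0) (at_left crit)"
proof -
  have refl_lim: "((\<lambda>z. f (- z)) \<longlongrightarrow> l) (at 1 within disk)"
    if "(f \<longlongrightarrow> l) (at (-1) within disk)" for f :: "complex \<Rightarrow> complex" and l
  proof (rule filterlim_compose[OF that])
    show "filterlim uminus (at (-1) within disk) (at (1::complex) within disk)"
      unfolding filterlim_at
      by (auto intro!: tendsto_eq_intros simp: eventually_at_filter minus_equation_iff[of _ 1] eq_commute)
  qed
  let ?u = "\<lambda>z. u (- z)" and ?\<phi> = "\<lambda>z. - \<phi> (- z)"
  have um [measurable]: "u \<in> borel_measurable \<mu>"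
    by (rule LpD(1)[OF u(1)])
  have uL: "?u \<in> L"
  proof -
    have m: "?u \<in> borel_measurable \<mu>"
      by (rule measurable_compose[OF measurable_uminus_dA um])
    have m': "(\<lambda>z. ennreal (cmod (u z) powr p)) \<in> borel_measurable \<mu>"
      by measurable
    have "integrable \<mu> (\<lambda>z. cmod (u (- z)) powr p)"
      using m LpD(2)[OF u(1)] nn_integral_dA_reflect[OF m'] by (intro integrableI_nonneg) (auto simp: integrable_iff_bounded)
    with m show ?thesis by (simp add: Lp_def)
  qed
  have cont: "continuous_on disk ?\<phi>"
    by (intro continuous_on_minus continuous_on_compose2[OF \<phi>(1)] continuous_intros) auto
  have "((\<lambda>c. N (\<lambda>z. ?u z * cauchy_kernel c (?\<phi> z) - u1 * of_real (d powr (- crit)) * cauchy_kernel c z)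
            / N (cauchy_kernel c)) \<longlongrightarrow> 0) (at_left crit)"
  proof (rule weighted_comp_kernel_asymp[OF uL refl_lim[OF u(2)] cont _ _ d(2)])
    show "?\<phi> ` disk \<subseteq> disk"
      using \<phi>(2) by (auto simp: image_subset_iff)
    show "((\<lambda>z. (1 - - \<phi> (- z)) / (1 - z)) \<longlongrightarrow> of_real d) (at 1 within disk)"
      using refl_lim[OF d(1)] by simp
    fix \<epsilon> :: real assume "\<epsilon> > 0"
    then obtain \<delta> where \<delta>: "\<delta> > 0" "\<forall>z\<in>disk - ball (-1) \<epsilon>. \<delta> \<le> cmod (1 + \<phi> z)"
      using far by blast
    have "- z \<in> disk - ball (-1) \<epsilon>" if "z \<in> disk - ball 1 \<epsilon>" for z :: complex
      using that by (auto simp: dist_norm norm_minus_commute)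
    then show "\<exists>\<delta>>0. \<forall>z\<in>disk - ball 1 \<epsilon>. \<delta> \<le> cmod (1 - - \<phi> (- z))"
      using \<delta> by (intro exI[of _ \<delta>]) (auto simp del: Diff_iff)
  qed
  moreover have "N (\<lambda>z. ?u z * cauchy_kernel c (?\<phi> z) - u1 * of_real (d powr (- crit)) * cauchy_kernel c z)
      = N (\<lambda>z. u z * cauchy_kernel c (- \<phi> z) - u1 * of_real (d powr (- crit)) * cauchy_kernel c (- z))" for c
  proof -
    have "(\<lambda>z. cauchy_kernel c (- \<phi> z)) \<in> borel_measurable \<mu>"
      using \<phi>(2) continuous_on_compose2[OF holomorphic_on_imp_continuous_on[OF cauchy_kernel_reflect_holomorphic[of c]] \<phi>(1)]
      by auto
    then have "(\<lambda>z. u z * cauchy_kernel c (- \<phi> z) - u1 * of_real (d powr (- crit)) * cauchy_kernel c (- z)) \<in> borel_measurable \<mu>"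
      using cauchy_kernel_measurable(2)[of c] by measurable
    from bergman_norm_reflect[OF this, of p] show ?thesis
      by simp
  qed
  ultimately show ?thesis by simp
qed

end

section \<open>Bochner integrals in the Bergman space\<close>

lemma space_unit_interval [simp]: "space unit_interval = {0<..<1}"
  by (simp add: space_restrict_space)

lemma finite_measure_unit_interval: "finite_measure unit_interval"
proof
  have "emeasure unit_interval {0<..<1::real} = emeasure lebesgue {0<..<1::real}"
    by (rule emeasure_restrict_space) auto
  then show "emeasure unit_interval (space unit_interval) \<noteq> \<infinity>"
    by simp
qed

text \<open>The values of \<open>s\<close> may lie in an arbitrary type. One formula thus covers
  simple functions whose values are elements of the Bergman space, with \<open>f\<close> being an
  evaluation at a point, the norm, or the distance to a fixed element.\<close>

lemma has_integral_simple_function: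
  fixes s :: "real \<Rightarrow> 'b" and f :: "'b \<Rightarrow> 'c::{banach, second_countable_topology}"
  assumes "simple_function unit_interval s"
  shows "integrable unit_interval (\<lambda>t. f (s t))"
    and "(LINT t|unit_interval. f (s t)) = (\<Sum>g\<in>s ` {0<..<1}. measure unit_interval {t\<in>{0<..<1}. s t = g} *\<^sub>R f g)"
proof -
  interpret finite_measure unit_interval
    by (rule finite_measure_unit_interval)
  let ?E = "\<lambda>g. {t\<in>{0<..<1}. s t = g}"
  have fin: "finite (s ` {0<..<1})"
    using simple_functionD(1)[OF assms] by simp
  have E: "?E g \<in> sets unit_interval" for g
  proof -
    have "s -` {g} \<inter> space unit_interval \<in> sets unit_interval"
      by (rule simple_functionD(2)[OF assms])
    moreover have "s -` {g} \<inter> space unit_interval = ?E g" by auto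
    ultimately show ?thesis by simp
  qed
  have eq: "f (s t) = (\<Sum>g\<in>s ` {0<..<1}. indicator (?E g) t *\<^sub>R f g)" if "t \<in> {0<..<1}" for t
  proof -
    have "(\<Sum>g\<in>s ` {0<..<1}. indicator (?E g) t *\<^sub>R f g) = (\<Sum>g\<in>s ` {0<..<1}. if g = s t then f g else 0)"
      using that by (intro sum.cong) (auto simp: indicator_def)
    also have "\<dots> = f (s t)"
      using fin that by (simp add: sum.delta)
    finally show ?thesis by simp
  qed
  have int: "integrable unit_interval (\<lambda>t. indicator (?E g) t *\<^sub>R f g)" for g
    using E by (intro integrable_scaleR_left integrable_real_indicator) (auto simp: emeasure_finite less_top[symmetric])
  have "integrable unit_interval (\<lambda>t. \<Sum>g\<in>s ` {0<..<1}. indicator (?E g) t *\<^sub>R f g)"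
    by (intro Bochner_Integration.integrable_sum int)
  then show "integrable unit_interval (\<lambda>t. f (s t))"
    using eq by (subst Bochner_Integration.integrable_cong[OF refl]) auto
  have "(LINT t|unit_interval. f (s t)) = (LINT t|unit_interval. (\<Sum>g\<in>s ` {0<..<1}. indicator (?E g) t *\<^sub>R f g))"
    using eq by (intro Bochner_Integration.integral_cong) auto
  also have "\<dots> = (\<Sum>g\<in>s ` {0<..<1}. (LINT t|unit_interval. indicator (?E g) t *\<^sub>R f g))"
    by (intro Bochner_Integration.integral_sum int)
  also have "\<dots> = (\<Sum>g\<in>s ` {0<..<1}. measure unit_interval (?E g) *\<^sub>R f g)"
  proof (intro sum.cong refl)
    fix g
    have "?E g \<inter> space unit_interval = ?E g" by auto
    then show "(LINT t|unit_interval. indicator (?E g) t *\<^sub>R f g) = measure unit_interval (?E g) *\<^sub>R f g"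
      using E[of g] by (subst integral_scaleR_left) (auto simp: emeasure_finite less_top[symmetric])
  qed
  finally show "(LINT t|unit_interval. f (s t)) = (\<Sum>g\<in>s ` {0<..<1}. measure unit_interval (?E g) *\<^sub>R f g)" .
qed

text \<open>Reading the sum as a scalar integral for each \<open>z\<close> makes linearity of
  \<open>simple_integral\<close> available without refining two partitions to a common one.\<close>

lemma simple_integral_eq:
  assumes "simple_function unit_interval s"
  shows "simple_integral s z = (LINT t|unit_interval. s t z)"
  using has_integral_simple_function(2)[OF assms, of "\<lambda>g. g z"]
  by (simp add: simple_integral_def scaleR_conv_of_real)

section \<open>Integrals with values in the Bergman space\<close>

context bergman
begin

definition simple_A :: "(real \<Rightarrow> complex \<Rightarrow> complex) \<Rightarrow> bool" where
  "simple_A s \<longleftrightarrow> simple_function unit_interval s \<and> s ` {0<..<1} \<subseteq> A"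

text \<open>The part of \<open>has_bergman_integral\<close> that does not mention the value of the
  integral; completeness of the space supplies the value.\<close>

definition approximable :: "(real \<Rightarrow> complex \<Rightarrow> complex) \<Rightarrow> bool" where
  "approximable F \<longleftrightarrow> (\<forall>t\<in>{0<..<1}. F t \<in> A) \<and>
     (\<forall>e>0. \<exists>s. simple_A s \<and> integrable unit_interval (\<lambda>t. N (\<lambda>z. F t z - s t z)) \<and>
        (LINT t|unit_interval. N (\<lambda>z. F t z - s t z)) < e)"

lemma A_sum:
  assumes "\<And>i. i \<in> I \<Longrightarrow> f i \<in> A"
  shows "(\<lambda>z. \<Sum>i\<in>I. c i * f i z) \<in> A"
  using assms
proof (induction I rule: infinite_finite_induct)
  case (insert i I)
  then have "(\<lambda>z. c i * f i z + 1 * (\<Sum>i\<in>I. c i * f i z)) \<in> A"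
    by (intro A_add_scale) auto
  with insert show ?case by simp
qed auto

lemma simple_A_in: "simple_A s \<Longrightarrow> t \<in> {0<..<1} \<Longrightarrow> s t \<in> A"
  by (auto simp: simple_A_def)

lemma simple_integral_A: "simple_A s \<Longrightarrow> simple_integral s \<in> A"
  unfolding simple_integral_def simple_A_def by (intro A_sum) auto

lemma norm_simple_integral_le:
  assumes "simple_A s"
  shows "N (simple_integral s) \<le> (LINT t|unit_interval. N (s t))"
proof -
  have s: "simple_function unit_interval s" "s ` {0<..<1} \<subseteq> A"
    using assms by (auto simp: simple_A_def)
  have "N (simple_integral s) \<le> (\<Sum>g\<in>s ` {0<..<1}. N (\<lambda>z. complex_of_real (measure unit_interval {t \<in> {0<..<1}. s t = g}) * g z))"
    unfolding simple_integral_def using s(2) by (intro N_sum L_cmult A_L) auto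
  also have "\<dots> = (LINT t|unit_interval. N (s t))"
    by (simp add: N_cmult has_integral_simple_function(2)[OF s(1)])
  finally show ?thesis .
qed

lemma simple_A_diff:
  assumes "simple_A s" "simple_A s'"
  shows "simple_A (\<lambda>t z. s t z - s' t z)"
  using assms simple_function_compose2[of unit_interval s s' "\<lambda>f g z. f z - g z"]
  unfolding simple_A_def by (auto intro!: A_diff)

lemma norm_simple_integral_diff_le:
  assumes s: "simple_A s" "simple_A s'"
  shows "N (\<lambda>z. simple_integral s z - simple_integral s' z) \<le> (LINT t|unit_interval. N (\<lambda>z. s t z - s' t z))"
proof -
  have sf: "simple_function unit_interval s" "simple_function unit_interval s'" "simple_function unit_interval (\<lambda>t z. s t z - s' t z)"
    using s simple_A_diff[OF s] by (auto simp: simple_A_def)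
  have "simple_integral (\<lambda>t z. s t z - s' t z) = (\<lambda>z. simple_integral s z - simple_integral s' z)"
    unfolding simple_integral_eq[OF sf(1)] simple_integral_eq[OF sf(2)] simple_integral_eq[OF sf(3)]
    using has_integral_simple_function(1)[OF sf(1), of "\<lambda>g. g z" for z]
      has_integral_simple_function(1)[OF sf(2), of "\<lambda>g. g z" for z]
    by (intro ext Bochner_Integration.integral_diff)
  with norm_simple_integral_le[OF simple_A_diff[OF s]] show ?thesis
    by simp
qed

lemma simple_A_diff_integrable:
  assumes "simple_A s" "simple_A s'"
  shows "integrable unit_interval (\<lambda>t. N (\<lambda>z. s t z - s' t z))"
  using has_integral_simple_function(1)[of "\<lambda>t z. s t z - s' t z" N] simple_A_diff[OF assms]
  by (simp add: simple_A_def)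

text \<open>Two different integrands are allowed because the images of the test functions are
  compared with an explicit family. With equal integrands it shows that the value is unique up to
  norm zero, so the choice made by \<open>bergman_integral\<close> does not influence norms.\<close>

lemma norm_bergman_integral_diff_le:
  assumes F: "has_bergman_integral p \<alpha> F G" "has_bergman_integral p \<alpha> F' G'"
    and int: "integrable unit_interval (\<lambda>t. N (\<lambda>z. F t z - F' t z))"
  shows "N (\<lambda>z. G z - G' z) \<le> (LINT t|unit_interval. N (\<lambda>z. F t z - F' t z))"
proof -
  obtain s where G: "G \<in> A" and F_A: "\<And>t. t \<in> {0<..<1} \<Longrightarrow> F t \<in> A" and s: "\<And>n. simple_A (s n)"
    and sint: "\<And>n. integrable unit_interval (\<lambda>t. N (\<lambda>z. F t z - s n t z))"
    and slim: "(\<lambda>n. LINT t|unit_interval. N (\<lambda>z. F t z - s n t z)) \<longlonglongrightarrow> 0"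
    and sG: "(\<lambda>n. N (\<lambda>z. simple_integral (s n) z - G z)) \<longlonglongrightarrow> 0"
    using F(1) unfolding has_bergman_integral_def simple_A_def by blast
  obtain s' where G': "G' \<in> A" and F'_A: "\<And>t. t \<in> {0<..<1} \<Longrightarrow> F' t \<in> A" and s': "\<And>n. simple_A (s' n)"
    and s'int: "\<And>n. integrable unit_interval (\<lambda>t. N (\<lambda>z. F' t z - s' n t z))"
    and s'lim: "(\<lambda>n. LINT t|unit_interval. N (\<lambda>z. F' t z - s' n t z)) \<longlonglongrightarrow> 0"
    and s'G: "(\<lambda>n. N (\<lambda>z. simple_integral (s' n) z - G' z)) \<longlonglongrightarrow> 0"
    using F(2) unfolding has_bergman_integral_def simple_A_def by blast
  let ?D = "LINT t|unit_interval. N (\<lambda>z. F t z - F' t z)"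
  let ?b = "\<lambda>n. N (\<lambda>z. simple_integral (s n) z - G z)
      + ((LINT t|unit_interval. N (\<lambda>z. F t z - s n t z)) + ?D + (LINT t|unit_interval. N (\<lambda>z. F' t z - s' n t z)))
      + N (\<lambda>z. simple_integral (s' n) z - G' z)"
  have "N (\<lambda>z. G z - G' z) \<le> ?b n" for n
  proof -
    let ?S = "simple_integral (s n)" and ?S' = "simple_integral (s' n)"
    have SL: "?S \<in> L" "?S' \<in> L" "G \<in> L" "G' \<in> L"
      using simple_integral_A s s' G G' A_L by auto
    have 1: "N (\<lambda>z. ?S z - ?S' z) \<le> (LINT t|unit_interval. N (\<lambda>z. s n t z - s' n t z))"
      by (rule norm_simple_integral_diff_le[OF s s'])
    also have "\<dots> \<le> (LINT t|unit_interval. N (\<lambda>z. F t z - s n t z) + N (\<lambda>z. F t z - F' t z) + N (\<lambda>z. F' t z - s' n t z))"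
    proof (rule integral_mono)
      fix t assume "t \<in> space unit_interval"
      then have t: "s n t \<in> L" "s' n t \<in> L" "F t \<in> L" "F' t \<in> L"
        using simple_A_in[OF s] simple_A_in[OF s'] F_A F'_A A_L by auto
      show "N (\<lambda>z. s n t z - s' n t z) \<le> N (\<lambda>z. F t z - s n t z) + N (\<lambda>z. F t z - F' t z) + N (\<lambda>z. F' t z - s' n t z)"
        using N_triangle_diff[OF t(1,3,2)] N_triangle_diff[OF t(3,4,2)] N_minus_commute[of "s n t" "F t"] by linarith
    qed (intro simple_A_diff_integrable s s' Bochner_Integration.integrable_add sint s'int int)+
    also have "\<dots> = (LINT t|unit_interval. N (\<lambda>z. F t z - s n t z)) + ?D + (LINT t|unit_interval. N (\<lambda>z. F' t z - s' n t z))"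
      using sint s'int int by simp
    finally have 1: "N (\<lambda>z. ?S z - ?S' z) \<le> (LINT t|unit_interval. N (\<lambda>z. F t z - s n t z)) + ?D + (LINT t|unit_interval. N (\<lambda>z. F' t z - s' n t z))" .
    show ?thesis
      using 1 N_triangle_diff[OF SL(3,1,4)] N_triangle_diff[OF SL(1,2,4)] N_minus_commute[of G ?S] by linarith
  qed
  moreover have "?b \<longlonglongrightarrow> 0 + (0 + ?D + 0) + 0"
    by (intro tendsto_intros sG s'G slim s'lim)
  ultimately have "N (\<lambda>z. G z - G' z) \<le> 0 + (0 + ?D + 0) + 0"
    by (intro LIMSEQ_le_const) auto
  then show ?thesis by simp
qed

text \<open>The simple integrals form a Cauchy sequence, because their mutual distances are bounded
  by the mean distances of the approximants to \<open>F\<close>.\<close>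

lemma approximable_has_integral:
  assumes "approximable F"
  obtains G where "has_bergman_integral p \<alpha> F G"
proof -
  have F_A: "\<And>t. t \<in> {0<..<1} \<Longrightarrow> F t \<in> A"
    using assms by (auto simp: approximable_def)
  have "\<forall>n. \<exists>s. simple_A s \<and> integrable unit_interval (\<lambda>t. N (\<lambda>z. F t z - s t z)) \<and>
        (LINT t|unit_interval. N (\<lambda>z. F t z - s t z)) < inverse (real (Suc n))"
    using assms unfolding approximable_def by (auto simp del: of_nat_Suc)
  from choice[OF this] obtain s where s: "\<And>n. simple_A (s n)" and sint: "\<And>n. integrable unit_interval (\<lambda>t. N (\<lambda>z. F t z - s n t z))"
    and sle: "\<And>n. (LINT t|unit_interval. N (\<lambda>z. F t z - s n t z)) < inverse (real (Suc n))"
    by blast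
  have lim: "(\<lambda>n. LINT t|unit_interval. N (\<lambda>z. F t z - s n t z)) \<longlonglongrightarrow> 0"
    by (rule tendsto_sandwich[OF _ _ tendsto_const LIMSEQ_inverse_real_of_nat])
       (use sle in \<open>auto intro!: always_eventually less_imp_le simp del: of_nat_Suc\<close>)
  have Cauchy: "\<exists>M. \<forall>m\<ge>M. \<forall>n\<ge>M. N (\<lambda>z. simple_integral (s m) z - simple_integral (s n) z) < e" if "e > 0" for e
  proof -
    obtain M where M: "\<And>n. n \<ge> M \<Longrightarrow> (LINT t|unit_interval. N (\<lambda>z. F t z - s n t z)) < e / 2"
      using order_tendstoD(2)[OF lim, of "e/2"] \<open>e > 0\<close> by (auto simp: eventually_sequentially)
    have "N (\<lambda>z. simple_integral (s m) z - simple_integral (s n) z) < e" if "m \<ge> M" "n \<ge> M" for m n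
    proof -
      have "N (\<lambda>z. simple_integral (s m) z - simple_integral (s n) z) \<le> (LINT t|unit_interval. N (\<lambda>z. s m t z - s n t z))"
        by (rule norm_simple_integral_diff_le[OF s s])
      also have "\<dots> \<le> (LINT t|unit_interval. N (\<lambda>z. F t z - s m t z) + N (\<lambda>z. F t z - s n t z))"
      proof (rule integral_mono)
        fix t assume "t \<in> space unit_interval"
        then have t: "s m t \<in> L" "s n t \<in> L" "F t \<in> L"
          using simple_A_in[OF s] F_A A_L by auto
        show "N (\<lambda>z. s m t z - s n t z) \<le> N (\<lambda>z. F t z - s m t z) + N (\<lambda>z. F t z - s n t z)"
          using N_triangle_diff[OF t(1,3,2)] N_minus_commute[of "s m t" "F t"] by linarith
      qed (intro simple_A_diff_integrable s Bochner_Integration.integrable_add sint)+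
      also have "\<dots> = (LINT t|unit_interval. N (\<lambda>z. F t z - s m t z)) + (LINT t|unit_interval. N (\<lambda>z. F t z - s n t z))"
        using sint by simp
      also have "\<dots> < e"
        using M[OF that(1)] M[OF that(2)] by simp
      finally show ?thesis .
    qed
    then show ?thesis by blast
  qed
  obtain G where "G \<in> A" "(\<lambda>n. N (\<lambda>z. simple_integral (s n) z - G z)) \<longlonglongrightarrow> 0"
    using bergman_complete[of "\<lambda>n. simple_integral (s n)", OF simple_integral_A[OF s] Cauchy] by blast
  then have "has_bergman_integral p \<alpha> F G"
    using s sint lim F_A unfolding has_bergman_integral_def simple_A_def by blast
  then show thesis by (rule that)
qed

text \<open>A simple function is constant on finitely many measurable pieces, so measurability of
  the distances to fixed elements passes to it. Measurability of a function-valued family is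
  expressed through such distances throughout.\<close>

lemma norm_diff_simple_measurable:
  assumes "\<And>h. h \<in> A \<Longrightarrow> (\<lambda>t. N (\<lambda>z. F t z - h z)) \<in> borel_measurable unit_interval" "simple_A s"
  shows "(\<lambda>t. N (\<lambda>z. F t z - s t z)) \<in> borel_measurable unit_interval"
proof -
  have s: "simple_function unit_interval s" "s ` {0<..<1} \<subseteq> A"
    using assms(2) by (auto simp: simple_A_def)
  let ?E = "\<lambda>g. s -` {g} \<inter> space unit_interval"
  have fin: "finite (s ` {0<..<1})"
    using simple_functionD(1)[OF s(1)] by simp
  have E: "?E g \<in> sets unit_interval" for g
    by (rule simple_functionD(2)[OF s(1)])
  have "(\<lambda>t. \<Sum>g\<in>s ` {0<..<1}. indicator (?E g) t * N (\<lambda>z. F t z - g z)) \<in> borel_measurable unit_interval"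
    using s(2) E by (intro borel_measurable_sum borel_measurable_times borel_measurable_indicator assms(1)) auto
  moreover have "(\<Sum>g\<in>s ` {0<..<1}. indicator (?E g) t * N (\<lambda>z. F t z - g z)) = N (\<lambda>z. F t z - s t z)"
    if "t \<in> space unit_interval" for t
  proof -
    have "(\<Sum>g\<in>s ` {0<..<1}. indicator (?E g) t * N (\<lambda>z. F t z - g z)) = (\<Sum>g\<in>s ` {0<..<1}. if g = s t then N (\<lambda>z. F t z - g z) else 0)"
      using that by (intro sum.cong) (auto simp: indicator_def)
    also have "\<dots> = N (\<lambda>z. F t z - s t z)"
      using fin that by (simp add: sum.delta)
    finally show ?thesis .
  qed
  ultimately show ?thesis
    by (subst measurable_cong) auto
qed

section \<open>Integrability of norm-continuous families\<close>

definition continuous_A :: "(real \<Rightarrow> complex \<Rightarrow> complex) \<Rightarrow> bool" where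
  "continuous_A F \<longleftrightarrow> (\<forall>t\<in>{0<..<1}. F t \<in> A \<and> ((\<lambda>t'. N (\<lambda>z. F t' z - F t z)) \<longlongrightarrow> 0) (at t))"

lemma continuous_A_norm_diff_tendsto:
  assumes F: "continuous_A F" and h: "h \<in> A" and t: "t \<in> {0<..<1}"
  shows "((\<lambda>t'. N (\<lambda>z. F t' z - h z)) \<longlongrightarrow> N (\<lambda>z. F t z - h z)) (at t)"
proof -
  have "((\<lambda>t'. N (\<lambda>z. F t' z - h z) - N (\<lambda>z. F t z - h z)) \<longlongrightarrow> 0) (at t)"
  proof (rule Lim_null_comparison)
    show "((\<lambda>t'. N (\<lambda>z. F t' z - F t z)) \<longlongrightarrow> 0) (at t)"
      using F t by (simp add: continuous_A_def)
    have "eventually (\<lambda>t'. t' \<in> {0<..<1}) (at t)"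
      using t by (intro eventually_at_in_open') auto
    then show "eventually (\<lambda>t'. norm (N (\<lambda>z. F t' z - h z) - N (\<lambda>z. F t z - h z)) \<le> N (\<lambda>z. F t' z - F t z)) (at t)"
    proof eventually_elim
      case (elim t')
      then have *: "F t' \<in> L" "F t \<in> L" "h \<in> L"
        using F t h A_L by (auto simp: continuous_A_def)
      show ?case
        using N_abs_diff[OF L_diff[OF *(1,3)] L_diff[OF *(2,3)]] by simp
    qed
  qed
  then show ?thesis
    by (rule LIM_zero_cancel)
qed

lemma continuous_A_measurable:
  assumes "continuous_A F" "h \<in> A"
  shows "(\<lambda>t. N (\<lambda>z. F t z - h z)) \<in> borel_measurable unit_interval"
proof (rule continuous_imp_measurable_on_sets_lebesgue)
  show "continuous_on {0<..<1} (\<lambda>t. N (\<lambda>z. F t z - h z))"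
    unfolding continuous_on_def
    by (intro ballI tendsto_within_subset[OF continuous_A_norm_diff_tendsto[OF assms] subset_UNIV])
qed auto

text \<open>Sampling on a grid gives simple functions that converge pointwise by continuity. The
  obstacle is domination: the majorant \<open>m\<close> is merely integrable, and its value at
  \<open>t\<close> says nothing about the norm of \<open>F\<close> at the sampling point.\<close>

lemma continuous_A_approximable:
  assumes F: "continuous_A F" and m: "integrable unit_interval m" "\<And>t. t \<in> {0<..<1} \<Longrightarrow> N (F t) \<le> m t"
  shows "approximable F"
proof -
  interpret finite_measure unit_interval
    by (rule finite_measure_unit_interval)
  have F_A: "\<And>t. t \<in> {0<..<1} \<Longrightarrow> F t \<in> A"
    using F by (auto simp: continuous_A_def)
  \<comment> \<open>Midpoints of the cells, because left endpoints would sample the first cell at 0,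
    outside the open interval on which the family is known to lie in the space.\<close>
  define \<tau> where "\<tau> n t = (of_int \<lfloor>real (Suc n) * t\<rfloor> + 1/2) / real (Suc n)" for n t
  have \<tau>_in: "\<tau> n t \<in> {0<..<1}" if "t \<in> {0<..<1}" for n t
  proof -
    have *: "(k + 1/2) / real (Suc n) \<in> {0<..<1}" if "0 \<le> k" "k + 1 \<le> real (Suc n)" for k :: real
    proof -
      have "0 < k + 1/2" "k + 1/2 < real (Suc n)"
        using that by linarith+
      then show ?thesis
        by (simp del: of_nat_Suc add: divide_less_eq)
    qed
    have "\<lfloor>real (Suc n) * t\<rfloor> < int (Suc n)"
      using that mult_strict_left_mono[of t 1 "real (Suc n)"] by (simp add: floor_less_iff del: of_nat_Suc)
    then have "of_int \<lfloor>real (Suc n) * t\<rfloor> + 1 \<le> real (Suc n)"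
      by linarith
    moreover have "0 \<le> real_of_int \<lfloor>real (Suc n) * t\<rfloor>"
      using that by simp
    ultimately show ?thesis
      unfolding \<tau>_def by (intro *)
  qed
  have \<tau>_dist: "\<bar>\<tau> n t - t\<bar> \<le> inverse (real (Suc n))" for n t
  proof -
    have "\<tau> n t - t = (of_int \<lfloor>real (Suc n) * t\<rfloor> + 1/2 - real (Suc n) * t) / real (Suc n)"
      by (simp add: \<tau>_def field_simps del: of_nat_Suc)
    then have "\<bar>\<tau> n t - t\<bar> = \<bar>of_int \<lfloor>real (Suc n) * t\<rfloor> + 1/2 - real (Suc n) * t\<bar> / real (Suc n)"
      by (simp only: abs_divide abs_of_nat)
    moreover have "\<bar>of_int \<lfloor>real (Suc n) * t\<rfloor> + 1/2 - real (Suc n) * t\<bar> \<le> 1"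
      by linarith
    then have "\<bar>of_int \<lfloor>real (Suc n) * t\<rfloor> + 1/2 - real (Suc n) * t\<bar> / real (Suc n) \<le> 1 / real (Suc n)"
      by (intro divide_right_mono) auto
    ultimately show ?thesis
      by (simp only: inverse_eq_divide)
  qed
  have \<tau>_lim: "(\<lambda>n. \<tau> n t) \<longlonglongrightarrow> t" for t
  proof -
    have "(\<lambda>n. \<tau> n t - t) \<longlonglongrightarrow> 0"
      by (rule Lim_null_comparison[OF _ LIMSEQ_inverse_real_of_nat]) (use \<tau>_dist in \<open>auto simp del: of_nat_Suc\<close>)
    then show ?thesis by (rule LIM_zero_cancel)
  qed
  have \<tau>_simple: "simple_function unit_interval (\<tau> n)" for n
  proof (rule simple_function_borel_measurable)
    have "\<tau> n \<in> borel_measurable lborel"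
      unfolding \<tau>_def by measurable
    then have "\<tau> n \<in> borel_measurable lebesgue"
      by (rule measurable_completion)
    then show "\<tau> n \<in> borel_measurable unit_interval"
      by (rule measurable_restrict_space1)
    have "\<tau> n ` space unit_interval \<subseteq> (\<lambda>k. (of_int k + 1/2) / real (Suc n)) ` {0..<int (Suc n)}"
    proof
      fix x assume "x \<in> \<tau> n ` space unit_interval"
      then obtain t where t: "t \<in> {0<..<1}" "x = \<tau> n t" by auto
      have "\<lfloor>real (Suc n) * t\<rfloor> \<ge> 0"
        using t by simp
      moreover have "\<lfloor>real (Suc n) * t\<rfloor> < int (Suc n)"
        using t mult_strict_left_mono[of t 1 "real (Suc n)"] by (simp add: floor_less_iff del: of_nat_Suc)
      ultimately show "x \<in> (\<lambda>k. (of_int k + 1/2) / real (Suc n)) ` {0..<int (Suc n)}"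
        using t(2) by (auto simp: \<tau>_def simp del: of_nat_Suc)
    qed
    then show "finite (\<tau> n ` space unit_interval)"
      by (rule finite_subset) auto
  qed
  have F\<tau>_simple: "simple_A (\<lambda>t. F (\<tau> n t))" for n
    unfolding simple_A_def using simple_function_compose1[OF \<tau>_simple[of n], of F] \<tau>_in F_A by auto
  have NF_meas: "(\<lambda>t. N (F t)) \<in> borel_measurable unit_interval"
    using continuous_A_measurable[OF F A_zero] by simp
  text \<open>The truncation makes the approximants dominated, without disturbing pointwise convergence.\<close>
  define s where "s n t = (if N (F (\<tau> n t)) \<le> N (F t) + 1 then F (\<tau> n t) else (\<lambda>z. 0))" for n t
  have s_simple: "simple_A (s n)" for n
  proof -
    have "(\<lambda>t. N (F (\<tau> n t))) \<in> borel_measurable unit_interval"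
      using has_integral_simple_function(1)[of "\<lambda>t. F (\<tau> n t)" N] F\<tau>_simple[of n]
      by (simp add: simple_A_def)
    then have "{t \<in> space unit_interval. N (F (\<tau> n t)) \<le> N (F t) + 1} \<in> sets unit_interval"
      using NF_meas by measurable
    then have "simple_function unit_interval (s n)"
      using F\<tau>_simple[of n] unfolding s_def by (intro simple_function_If) (auto simp: simple_A_def)
    then show ?thesis
      using \<tau>_in F_A by (auto simp: simple_A_def s_def)
  qed
  have s_lim: "(\<lambda>n. N (\<lambda>z. F t z - s n t z)) \<longlonglongrightarrow> 0" if t: "t \<in> {0<..<1}" for t
  proof -
    have *: "(\<lambda>n. N (\<lambda>z. F (\<tau> n t) z - h z)) \<longlonglongrightarrow> N (\<lambda>z. F t z - h z)" if "h \<in> A" for h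
    proof -
      have "isCont (\<lambda>t. N (\<lambda>z. F t z - h z)) t"
        unfolding isCont_def by (rule continuous_A_norm_diff_tendsto[OF F that t])
      from isCont_tendsto_compose[OF this \<tau>_lim] show ?thesis .
    qed
    have "(\<lambda>n. N (F (\<tau> n t))) \<longlonglongrightarrow> N (F t)"
      using *[OF A_zero] by simp
    then have "eventually (\<lambda>n. N (F (\<tau> n t)) < N (F t) + 1) sequentially"
      by (rule order_tendstoD(2)) simp
    then have "eventually (\<lambda>n. N (\<lambda>z. F (\<tau> n t) z - F t z) = N (\<lambda>z. F t z - s n t z)) sequentially"
      by eventually_elim (simp add: s_def N_minus_commute[of "F t"])
    from Lim_transform_eventually[OF *[OF F_A[OF t]] this] show ?thesis
      by simp
  qed
  have meas: "(\<lambda>t. N (\<lambda>z. F t z - s n t z)) \<in> borel_measurable unit_interval" for n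
    by (rule norm_diff_simple_measurable[OF continuous_A_measurable[OF F] s_simple])
  have bound: "N (\<lambda>z. F t z - s n t z) \<le> 2 * m t + 1" if "t \<in> {0<..<1}" for n t
  proof -
    have "N (\<lambda>z. F t z - s n t z) \<le> N (F t) + N (s n t)"
      using that F_A simple_A_in[OF s_simple] by (intro N_diff_le A_L) auto
    also have "N (s n t) \<le> N (F t) + 1"
      by (simp add: s_def)
    finally show ?thesis
      using m(2)[OF that] by simp
  qed
  have int_b: "integrable unit_interval (\<lambda>t. 2 * m t + 1)"
    using m(1) by simp
  have lim: "(\<lambda>n. LINT t|unit_interval. N (\<lambda>z. F t z - s n t z)) \<longlonglongrightarrow> (LINT t|unit_interval. 0)"
    by (rule integral_dominated_convergence[OF _ meas int_b]) (use s_lim bound in auto)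
  have int: "integrable unit_interval (\<lambda>t. N (\<lambda>z. F t z - s n t z))" for n
  proof (rule Bochner_Integration.integrable_bound[OF int_b meas AE_I2])
    fix t assume "t \<in> space unit_interval"
    then show "norm (N (\<lambda>z. F t z - s n t z)) \<le> norm (2 * m t + 1)"
      using order_trans[OF bound abs_ge_self] by simp
  qed
  show ?thesis
    unfolding approximable_def
  proof (intro conjI ballI allI impI)
    fix e :: real assume "e > 0"
    then have "eventually (\<lambda>n. (LINT t|unit_interval. N (\<lambda>z. F t z - s n t z)) < e) sequentially"
      using order_tendstoD(2)[OF lim, of e] by simp
    then obtain n where "(LINT t|unit_interval. N (\<lambda>z. F t z - s n t z)) < e"
      by (auto simp: eventually_sequentially)
    then show "\<exists>s. simple_A s \<and> integrable unit_interval (\<lambda>t. N (\<lambda>z. F t z - s t z)) \<and>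
        (LINT t|unit_interval. N (\<lambda>z. F t z - s t z)) < e"
      using s_simple int by blast
  qed (use F_A in auto)
qed

lemma approximable_limit:
  assumes F: "\<And>t. t \<in> {0<..<1} \<Longrightarrow> F t \<in> A"
    and meas: "\<And>h. h \<in> A \<Longrightarrow> (\<lambda>t. N (\<lambda>z. F t z - h z)) \<in> borel_measurable unit_interval"
    and Fn: "\<And>n::nat. approximable (Fn n)"
    and int: "\<And>n. integrable unit_interval (\<lambda>t. N (\<lambda>z. F t z - Fn n t z))"
    and lim: "(\<lambda>n. LINT t|unit_interval. N (\<lambda>z. F t z - Fn n t z)) \<longlonglongrightarrow> 0"
  shows "approximable F"
  unfolding approximable_def
proof (intro conjI ballI allI impI)
  fix e :: real assume "e > 0"
  then have "eventually (\<lambda>n. (LINT t|unit_interval. N (\<lambda>z. F t z - Fn n t z)) < e/2) sequentially"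
    using order_tendstoD(2)[OF lim, of "e/2"] by simp
  then obtain n where n: "(LINT t|unit_interval. N (\<lambda>z. F t z - Fn n t z)) < e/2"
    by (auto simp: eventually_sequentially)
  obtain s where s: "simple_A s" and sint: "integrable unit_interval (\<lambda>t. N (\<lambda>z. Fn n t z - s t z))"
    and sle: "(LINT t|unit_interval. N (\<lambda>z. Fn n t z - s t z)) < e/2"
    using Fn[of n] \<open>e > 0\<close> unfolding approximable_def by (meson half_gt_zero)
  have tri: "N (\<lambda>z. F t z - s t z) \<le> N (\<lambda>z. F t z - Fn n t z) + N (\<lambda>z. Fn n t z - s t z)" if "t \<in> {0<..<1}" for t
    using that F Fn[of n] simple_A_in[OF s] by (intro N_triangle_diff A_L) (auto simp: approximable_def)
  have int_b: "integrable unit_interval (\<lambda>t. N (\<lambda>z. F t z - Fn n t z) + N (\<lambda>z. Fn n t z - s t z))"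
    using int sint by simp
  have int_s: "integrable unit_interval (\<lambda>t. N (\<lambda>z. F t z - s t z))"
    by (rule Bochner_Integration.integrable_bound[OF int_b norm_diff_simple_measurable[OF meas s]])
       (use tri in \<open>auto intro: order_trans[OF _ abs_ge_self]\<close>)
  have "(LINT t|unit_interval. N (\<lambda>z. F t z - s t z)) \<le> (LINT t|unit_interval. N (\<lambda>z. F t z - Fn n t z) + N (\<lambda>z. Fn n t z - s t z))"
    using tri by (intro integral_mono int_s int_b) auto
  also have "\<dots> < e"
    using n sle int sint by simp
  finally show "\<exists>s. simple_A s \<and> integrable unit_interval (\<lambda>t. N (\<lambda>z. F t z - s t z)) \<and>
        (LINT t|unit_interval. N (\<lambda>z. F t z - s t z)) < e"
    using s int_s by blast
qed (use F in auto)

text \<open>With two fixed vectors, approximating the scalar coefficients is enough. The second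
  claim keeps the approximation pointwise in \<open>t\<close>; it makes the distance between two
  families that both vary with \<open>t\<close> measurable.\<close>

lemma has_bergman_integral_combination:
  assumes a: "integrable unit_interval a" "integrable unit_interval b" and e: "e1 \<in> A" "e2 \<in> A"
  shows "has_bergman_integral p \<alpha> (\<lambda>t z. a t * e1 z + b t * e2 z)
    (\<lambda>z. (LINT t|unit_interval. a t) * e1 z + (LINT t|unit_interval. b t) * e2 z)"
    and "\<exists>s. (\<forall>n. simple_A (s n)) \<and> (\<forall>t\<in>{0<..<1}. (\<lambda>n. N (\<lambda>z. a t * e1 z + b t * e2 z - s n t z)) \<longlonglongrightarrow> 0)"
proof -
  have seq: "\<exists>s :: nat \<Rightarrow> real \<Rightarrow> complex. (\<forall>n. simple_function unit_interval (s n)) \<and>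
      (\<forall>t\<in>{0<..<1}. (\<lambda>n. cmod (f t - s n t)) \<longlonglongrightarrow> 0) \<and>
      (\<forall>n. integrable unit_interval (s n)) \<and>
      (\<lambda>n. LINT t|unit_interval. cmod (f t - s n t)) \<longlonglongrightarrow> 0 \<and>
      (\<lambda>n. LINT t|unit_interval. s n t) \<longlonglongrightarrow> (LINT t|unit_interval. f t)"
    if f: "integrable unit_interval f" for f :: "real \<Rightarrow> complex"
  proof -
    note [measurable] = borel_measurable_integrable[OF f]
    \<comment> \<open>The approximants are bounded by \<open>2 * cmod (f t)\<close>, so
      \<open>3 * cmod (f t)\<close> dominates both them and their errors.\<close>
    obtain s where s: "\<forall>n. simple_function unit_interval (s n)"
      "\<forall>t\<in>space unit_interval. (\<lambda>n. s n t) \<longlonglongrightarrow> f t"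
      "\<forall>n. \<forall>t\<in>space unit_interval. dist (s n t) 0 \<le> 2 * dist (f t) 0"
      using borel_measurable_implies_sequence_metric[OF borel_measurable_integrable[OF f], of 0] by blast
    have [measurable]: "s n \<in> borel_measurable unit_interval" for n
      using s(1) by (intro borel_measurable_simple_function) auto
    have int: "integrable unit_interval (s n)" for n
      using has_integral_simple_function(1)[of "s n" "\<lambda>x. x"] s(1) by simp
    have b: "integrable unit_interval (\<lambda>t. 3 * cmod (f t))"
      using f by simp
    have pt: "(\<lambda>n. cmod (f t - s n t)) \<longlonglongrightarrow> 0" if "t \<in> {0<..<1}" for t
      using s(2) that tendsto_norm[OF tendsto_diff[OF tendsto_const[of "f t"]], of "\<lambda>n. s n t" "f t" sequentially] by simp
    have le: "cmod (f t - s n t) \<le> 3 * cmod (f t)" if "t \<in> {0<..<1}" for n t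
    proof -
      have "cmod (s n t) \<le> 2 * cmod (f t)"
        using s(3) that by (simp add: dist_norm)
      then show ?thesis
        using norm_triangle_ineq4[of "f t" "s n t"] by linarith
    qed
    have "(\<lambda>n. LINT t|unit_interval. cmod (f t - s n t)) \<longlonglongrightarrow> (LINT t|unit_interval. 0)"
      by (rule integral_dominated_convergence[OF _ _ b]) (use pt le in auto)
    moreover have "(\<lambda>n. LINT t|unit_interval. s n t) \<longlonglongrightarrow> (LINT t|unit_interval. f t)"
    proof (rule integral_dominated_convergence[OF _ _ b])
      show "AE t in unit_interval. norm (s n t) \<le> 3 * cmod (f t)" for n
      proof (rule AE_I2)
        fix t assume "t \<in> space unit_interval"
        then have "cmod (s n t) \<le> 2 * cmod (f t)"
          using s(3) by (simp add: dist_norm)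
        then show "norm (s n t) \<le> 3 * cmod (f t)"
          using norm_ge_zero[of "f t"] by linarith
      qed
    qed (use s(2) in auto)
    ultimately show ?thesis
      using s(1) pt int by (intro exI[of _ s]) auto
  qed
  obtain sa where sa: "\<And>n. simple_function unit_interval (sa n)"
      "\<And>t. t\<in>{0<..<1} \<Longrightarrow> (\<lambda>n. cmod (a t - sa n t)) \<longlonglongrightarrow> 0"
      "\<And>n. integrable unit_interval (sa n)"
      "(\<lambda>n. LINT t|unit_interval. cmod (a t - sa n t)) \<longlonglongrightarrow> 0"
      "(\<lambda>n. LINT t|unit_interval. sa n t) \<longlonglongrightarrow> (LINT t|unit_interval. a t)"
    using seq[OF a(1)] by blast
  obtain sb where sb: "\<And>n. simple_function unit_interval (sb n)"
      "\<And>t. t\<in>{0<..<1} \<Longrightarrow> (\<lambda>n. cmod (b t - sb n t)) \<longlonglongrightarrow> 0"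
      "\<And>n. integrable unit_interval (sb n)"
      "(\<lambda>n. LINT t|unit_interval. cmod (b t - sb n t)) \<longlonglongrightarrow> 0"
      "(\<lambda>n. LINT t|unit_interval. sb n t) \<longlonglongrightarrow> (LINT t|unit_interval. b t)"
    using seq[OF a(2)] by blast
  define s where "s n t = (\<lambda>z. sa n t * e1 z + sb n t * e2 z)" for n t
  have sA: "simple_A (s n)" for n
    unfolding simple_A_def s_def
    using simple_function_compose2[OF sa(1)[of n] sb(1)[of n], of "\<lambda>x y z. x * e1 z + y * e2 z"] e
    by (auto intro!: A_add_scale)
  have le: "N (\<lambda>z. (x * e1 z + y * e2 z) - (x' * e1 z + y' * e2 z)) \<le> cmod (x - x') * N e1 + cmod (y - y') * N e2" for x y x' y'
  proof -
    have "N (\<lambda>z. (x - x') * e1 z + (y - y') * e2 z) \<le> cmod (x - x') * N e1 + cmod (y - y') * N e2"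
      using N_triangle[OF L_cmult[OF A_L[OF e(1)], of "x - x'"] L_cmult[OF A_L[OF e(2)], of "y - y'"]] by (simp add: N_cmult)
    then show ?thesis
      by (simp add: algebra_simps)
  qed
  have pt: "(\<lambda>n. N (\<lambda>z. a t * e1 z + b t * e2 z - s n t z)) \<longlonglongrightarrow> 0" if "t \<in> {0<..<1}" for t
  proof (rule Lim_null_comparison)
    show "(\<lambda>n. cmod (a t - sa n t) * N e1 + cmod (b t - sb n t) * N e2) \<longlonglongrightarrow> 0"
      using tendsto_add[OF tendsto_mult_left_zero[OF sa(2)[OF that], of "N e1"] tendsto_mult_left_zero[OF sb(2)[OF that], of "N e2"]] by simp
  qed (use le in \<open>simp add: s_def\<close>)
  then show "\<exists>s. (\<forall>n. simple_A (s n)) \<and> (\<forall>t\<in>{0<..<1}. (\<lambda>n. N (\<lambda>z. a t * e1 z + b t * e2 z - s n t z)) \<longlonglongrightarrow> 0)"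
    using sA by blast
  let ?F = "\<lambda>t z. a t * e1 z + b t * e2 z"
  have FA: "?F t \<in> A" for t
    using e by (rule A_add_scale)
  have int_b: "integrable unit_interval (\<lambda>t. cmod (a t - sa n t) * N e1 + cmod (b t - sb n t) * N e2)" for n
    using a sa(3)[of n] sb(3)[of n] by (intro Bochner_Integration.integrable_add integrable_mult_left integrable_norm Bochner_Integration.integrable_diff)
  have meas: "(\<lambda>t. N (\<lambda>z. ?F t z - h z)) \<in> borel_measurable unit_interval" if h: "h \<in> A" for h
  proof (rule borel_measurable_LIMSEQ_metric)
    show "(\<lambda>t. N (\<lambda>z. s n t z - h z)) \<in> borel_measurable unit_interval" for n
      using has_integral_simple_function(1)[of "s n" "\<lambda>g. N (\<lambda>z. g z - h z)"] sA[of n] by (simp add: simple_A_def)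
    fix t assume t: "t \<in> space unit_interval"
    have "(\<lambda>n. N (\<lambda>z. s n t z - h z) - N (\<lambda>z. ?F t z - h z)) \<longlonglongrightarrow> 0"
    proof (rule Lim_null_comparison)
      show "(\<lambda>n. N (\<lambda>z. ?F t z - s n t z)) \<longlonglongrightarrow> 0"
        using pt t by simp
      have *: "s n t \<in> L" "?F t \<in> L" "h \<in> L" for n
        using simple_A_in[OF sA] t FA h A_L by auto
      show "eventually (\<lambda>n. norm (N (\<lambda>z. s n t z - h z) - N (\<lambda>z. ?F t z - h z)) \<le> N (\<lambda>z. ?F t z - s n t z)) sequentially"
      proof (intro always_eventually allI)
        fix n
        have "\<bar>N (\<lambda>z. s n t z - h z) - N (\<lambda>z. ?F t z - h z)\<bar> \<le> N (\<lambda>z. (s n t z - h z) - (?F t z - h z))"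
          by (intro N_abs_diff L_diff *)
        also have "\<dots> = N (\<lambda>z. ?F t z - s n t z)"
          by (rule bergman_norm_cong) (subst norm_minus_cancel[symmetric], simp add: algebra_simps)
        finally show "norm (N (\<lambda>z. s n t z - h z) - N (\<lambda>z. ?F t z - h z)) \<le> N (\<lambda>z. ?F t z - s n t z)"
          by simp
      qed
    qed
    then show "(\<lambda>n. N (\<lambda>z. s n t z - h z)) \<longlonglongrightarrow> N (\<lambda>z. ?F t z - h z)"
      by (rule LIM_zero_cancel)
  qed
  have int: "integrable unit_interval (\<lambda>t. N (\<lambda>z. ?F t z - s n t z))" for n
  proof (rule Bochner_Integration.integrable_bound[OF int_b[of n]])
    show "(\<lambda>t. N (\<lambda>z. ?F t z - s n t z)) \<in> borel_measurable unit_interval"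
      by (rule norm_diff_simple_measurable[OF meas sA])
    show "AE t in unit_interval. norm (N (\<lambda>z. ?F t z - s n t z)) \<le> norm (cmod (a t - sa n t) * N e1 + cmod (b t - sb n t) * N e2)"
      using le by (intro AE_I2) (simp add: s_def)
  qed
  have lim: "(\<lambda>n. LINT t|unit_interval. N (\<lambda>z. ?F t z - s n t z)) \<longlonglongrightarrow> 0"
  proof (rule Lim_null_comparison)
    show "(\<lambda>n. (LINT t|unit_interval. cmod (a t - sa n t)) * N e1 + (LINT t|unit_interval. cmod (b t - sb n t)) * N e2) \<longlonglongrightarrow> 0"
      using tendsto_add[OF tendsto_mult_left_zero[OF sa(4), of "N e1"] tendsto_mult_left_zero[OF sb(4), of "N e2"]] by simp
    have "(LINT t|unit_interval. N (\<lambda>z. ?F t z - s n t z)) \<le> (LINT t|unit_interval. cmod (a t - sa n t)) * N e1 + (LINT t|unit_interval. cmod (b t - sb n t)) * N e2" for n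
    proof -
      have "(LINT t|unit_interval. N (\<lambda>z. ?F t z - s n t z)) \<le> (LINT t|unit_interval. cmod (a t - sa n t) * N e1 + cmod (b t - sb n t) * N e2)"
        by (intro integral_mono int int_b) (simp add: s_def le)
      also have "\<dots> = (LINT t|unit_interval. cmod (a t - sa n t)) * N e1 + (LINT t|unit_interval. cmod (b t - sb n t)) * N e2"
        using a sa(3)[of n] sb(3)[of n] by (subst Bochner_Integration.integral_add) auto
      finally show ?thesis .
    qed
    then show "eventually (\<lambda>n. norm (LINT t|unit_interval. N (\<lambda>z. ?F t z - s n t z))
        \<le> (LINT t|unit_interval. cmod (a t - sa n t)) * N e1 + (LINT t|unit_interval. cmod (b t - sb n t)) * N e2) sequentially"
      by (simp add: always_eventually)
  qed
  let ?a = "LINT t|unit_interval. a t" and ?b = "LINT t|unit_interval. b t"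
  have "simple_integral (s n) = (\<lambda>z. (LINT t|unit_interval. sa n t) * e1 z + (LINT t|unit_interval. sb n t) * e2 z)" for n
  proof
    fix z
    have "simple_integral (s n) z = (LINT t|unit_interval. sa n t * e1 z + sb n t * e2 z)"
      using sA[of n] by (subst simple_integral_eq) (auto simp: simple_A_def s_def)
    also have "\<dots> = (LINT t|unit_interval. sa n t) * e1 z + (LINT t|unit_interval. sb n t) * e2 z"
      using sa(3)[of n] sb(3)[of n] by (subst Bochner_Integration.integral_add) auto
    finally show "simple_integral (s n) z = (LINT t|unit_interval. sa n t) * e1 z + (LINT t|unit_interval. sb n t) * e2 z" .
  qed
  then have "(\<lambda>n. N (\<lambda>z. simple_integral (s n) z - (?a * e1 z + ?b * e2 z)))
      = (\<lambda>n. N (\<lambda>z. ((LINT t|unit_interval. sa n t) * e1 z + (LINT t|unit_interval. sb n t) * e2 z) - (?a * e1 z + ?b * e2 z)))"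
    by simp
  also have "\<dots> \<longlonglongrightarrow> 0"
  proof (rule Lim_null_comparison)
    have "(\<lambda>n. cmod ((LINT t|unit_interval. sa n t) - ?a)) \<longlonglongrightarrow> 0" "(\<lambda>n. cmod ((LINT t|unit_interval. sb n t) - ?b)) \<longlonglongrightarrow> 0"
      using sa(5) sb(5) by (auto intro: tendsto_norm_zero LIM_zero)
    then show "(\<lambda>n. cmod ((LINT t|unit_interval. sa n t) - ?a) * N e1 + cmod ((LINT t|unit_interval. sb n t) - ?b) * N e2) \<longlonglongrightarrow> 0"
      using tendsto_add[OF tendsto_mult_left_zero[of _ _ "N e1"] tendsto_mult_left_zero[of _ _ "N e2"]] by fastforce
  qed (use le in simp)
  finally show "has_bergman_integral p \<alpha> ?F (\<lambda>z. ?a * e1 z + ?b * e2 z)"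
    unfolding has_bergman_integral_def using sA int lim FA A_add_scale[OF e]
    by (intro conjI ballI exI[of _ s]) (auto simp: simple_A_def)
qed

end

section \<open>Equality in the triangle inequality\<close>

text \<open>The weighted arithmetic-geometric mean inequality for \<open>s powr p\<close> and 1 with
  weights \<open>1 / p\<close> and \<open>1 - 1 / p\<close>. With \<open>m\<close> the right-hand
  side, \<open>ln x \<le> x - 1\<close> is applied at \<open>s powr p / m\<close> and at
  \<open>1 / m\<close>; the weighted sum of the two linear bounds is zero, whence
  \<open>ln s \<le> ln m\<close>. If these logarithms agree, the estimate at \<open>1 / m\<close> is
  an equality, which forces \<open>m = 1\<close>.\<close>

lemma Bernoulli_powr_strict:
  fixes p s :: real
  assumes "p > 1" "s \<ge> 0"
  shows "s \<le> (1 - 1 / p) + s powr p / p" and "s = (1 - 1 / p) + s powr p / p \<Longrightarrow> s = 1"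
proof -
  define m where "m = (1 - 1 / p) + s powr p / p"
  have "s \<le> m \<and> (s = m \<longrightarrow> s = 1)"
  proof (cases "s = 0")
    case True
    then show ?thesis using assms by (auto simp: m_def)
  next
    case False
    then have s: "s > 0" using assms by simp
    have m: "m > 0"
      unfolding m_def using assms s by (intro add_pos_pos) auto
    let ?r = "1 / p"
    have ln_s: "ln s = ?r * ln (s powr p)"
      using s assms by (simp add: ln_powr)
    have ln_sp: "ln (s powr p) = ln (s powr p / m) + ln m" and ln_m: "ln (1 / m) = - ln m"
      using s m by (auto simp: ln_div)
    have "r * (x + l) - l = r * x + (1 - r) * (- l)" for r x l :: real
      by (simp add: algebra_simps)
    then have *: "ln s - ln m = ?r * ln (s powr p / m) + (1 - ?r) * ln (1 / m)"
      unfolding ln_s ln_sp[symmetric] ln_m by (metis ln_sp)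
    have sum: "?r * (s powr p / m - 1) + (1 - ?r) * (1 / m - 1) = 0"
    proof -
      have "?r * (s powr p / m - 1) + (1 - ?r) * (1 / m - 1) = ((1 - ?r) + s powr p / p) / m - 1"
        by (simp add: algebra_simps add_divide_distrib diff_divide_distrib)
      then show ?thesis using m by (simp flip: m_def)
    qed
    have 1: "?r * ln (s powr p / m) \<le> ?r * (s powr p / m - 1)"
      using assms s m by (intro mult_left_mono ln_le_minus_one) auto
    have 2: "(1 - ?r) * ln (1 / m) \<le> (1 - ?r) * (1 / m - 1)"
      using assms m by (intro mult_left_mono ln_le_minus_one) auto
    have "ln s \<le> ln m"
      using 1 2 * sum by linarith
    then have "s \<le> m" using s m by simp
    moreover have "s = 1" if "s = m"
    proof -
      have "ln s - ln m = 0"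
        using that by simp
      then have "(1 - ?r) * ln (1 / m) = (1 - ?r) * (1 / m - 1)"
        using 1 2 * sum by linarith
      moreover have "1 - ?r \<noteq> 0"
        using assms by simp
      ultimately have "ln (1 / m) = 1 / m - 1"
        using mult_left_cancel by blast
      then have "1 / m = 1"
        using m by (intro ln_eq_minus_one) auto
      with that show ?thesis by simp
    qed
    ultimately show ?thesis by blast
  qed
  then show "s \<le> (1 - 1 / p) + s powr p / p" "s = (1 - 1 / p) + s powr p / p \<Longrightarrow> s = 1"
    by (auto simp: m_def)
qed

text \<open>Young's inequality with its equality case. Both sides are homogeneous of degree
  \<open>p\<close>, so dividing by \<open>x powr p\<close> leaves the one-variable inequality for
  \<open>s = y / x\<close>.\<close>

lemma Young_powr_strict:
  fixes p x y :: real
  assumes "p > 1" "x \<ge> 0" "y \<ge> 0"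
  shows "x powr (p - 1) * y \<le> (1 - 1 / p) * x powr p + y powr p / p"
    and "x powr (p - 1) * y = (1 - 1 / p) * x powr p + y powr p / p \<Longrightarrow> x = y"
proof -
  have "x powr (p - 1) * y \<le> (1 - 1 / p) * x powr p + y powr p / p \<and>
    (x powr (p - 1) * y = (1 - 1 / p) * x powr p + y powr p / p \<longrightarrow> x = y)"
  proof (cases "x = 0")
    case True
    then show ?thesis using assms by auto
  next
    case False
    then have x: "x > 0" using assms by simp
    define s where "s = y / x"
    have y: "y = s * x" and s: "s \<ge> 0"
      using x assms by (auto simp: s_def)
    have 1: "x powr (p - 1) * y = x powr p * s"
      using x by (simp add: y powr_diff)
    have 2: "(1 - 1 / p) * x powr p + y powr p / p = x powr p * ((1 - 1 / p) + s powr p / p)"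
      using x s by (simp add: y powr_mult algebra_simps)
    show ?thesis
      unfolding 1 2 using Bernoulli_powr_strict[OF assms(1) s] x by (auto simp: y)
  qed
  then show "x powr (p - 1) * y \<le> (1 - 1 / p) * x powr p + y powr p / p"
    "x powr (p - 1) * y = (1 - 1 / p) * x powr p + y powr p / p \<Longrightarrow> x = y"
    by auto
qed

text \<open>Translates between almost-everywhere statements and the set of full measure in the
  theorem. The set can be taken measurable because an exceptional set lies inside a measurable null
  set.\<close>

lemma AE_unit_interval_iff:
  "(AE t in unit_interval. P t) \<longleftrightarrow>
    (\<exists>M \<subseteq> {0<..<1}. M \<in> sets lebesgue \<and> negligible ({0<..<1} - M) \<and> (\<forall>t\<in>M. P t))"
proof
  assume "AE t in unit_interval. P t"
  then have "AE t in lebesgue. t \<in> {0<..<1::real} \<longrightarrow> P t"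
    by (subst (asm) AE_restrict_space_iff) auto
  then obtain Z where Z: "{t. \<not> (t \<in> {0<..<1} \<longrightarrow> P t)} \<subseteq> Z" "emeasure lebesgue Z = 0" "Z \<in> sets lebesgue"
    by (auto elim!: AE_E)
  have "Z \<in> null_sets lebesgue"
    using Z by (simp add: null_sets_def)
  then have "negligible Z"
    by (simp only: negligible_iff_null_sets)
  then have "negligible ({0<..<1} - ({0<..<1} - Z))"
    by (rule negligible_subset) auto
  then show "\<exists>M \<subseteq> {0<..<1}. M \<in> sets lebesgue \<and> negligible ({0<..<1} - M) \<and> (\<forall>t\<in>M. P t)"
    using Z by (intro exI[of _ "{0<..<1} - Z"]) auto
next
  assume "\<exists>M \<subseteq> {0<..<1}. M \<in> sets lebesgue \<and> negligible ({0<..<1} - M) \<and> (\<forall>t\<in>M. P t)"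
  then obtain M where M: "negligible ({0<..<1} - M)" "\<forall>t\<in>M. P t"
    by blast
  have "AE t in lebesgue. t \<notin> {0<..<1} - M"
    using M(1) by (intro AE_not_in) (simp add: negligible_iff_null_sets)
  then have "AE t in lebesgue. t \<in> {0<..<1} \<longrightarrow> P t"
    by (rule AE_mp) (use M(2) in auto)
  then show "AE t in unit_interval. P t"
    by (subst AE_restrict_space_iff) auto
qed

section \<open>The p-norm on pairs and its norming functionals\<close>

context bergman
begin

lemma lp2_eq_0_iff: "lp2 a b = 0 \<longleftrightarrow> a = 0 \<and> b = 0"
  using p by (auto simp: lp2_def add_nonneg_eq_0_iff)

lemma lp2_scale: "r \<ge> 0 \<Longrightarrow> lp2 (of_real r * a) (of_real r * b) = r * lp2 a b"
  using p by (simp add: lp2_def norm_mult powr_mult powr_powr flip: distrib_left)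

lemma cmod_le_lp2: "cmod a \<le> lp2 a b" "cmod b \<le> lp2 a b"
proof -
  have "(cmod a powr p) powr (1/p) \<le> lp2 a b" "(cmod b powr p) powr (1/p) \<le> lp2 a b"
    unfolding lp2_def using p by (intro powr_mono2; simp)+
  then show "cmod a \<le> lp2 a b" "cmod b \<le> lp2 a b"
    using p by (simp_all add: powr_powr)
qed

text \<open>One coordinate of the duality map of the \<open>p\<close>-norm on pairs.\<close>

definition dual :: "complex \<Rightarrow> complex \<Rightarrow> complex" where
  "dual v x = of_real (cmod v powr (p - 2)) * cnj v * x"

text \<open>Young's inequality for the moduli. Equality first makes the moduli agree and then leaves
  no loss in passing to the real part, so that \<open>Re (cnj v * x)\<close> is the square of
  \<open>cmod v\<close> and the distance between \<open>x\<close> and \<open>v\<close>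
  vanishes.\<close>

lemma dual_le:
  "Re (dual v x) \<le> (1 - 1 / p) * cmod v powr p + cmod x powr p / p"
  "Re (dual v x) = (1 - 1 / p) * cmod v powr p + cmod x powr p / p \<Longrightarrow> x = v"
proof -
  have 1: "cmod (dual v x) = cmod v powr (p - 1) * cmod x"
  proof (cases "v = 0")
    case False
    then have "cmod v powr (p - 2) * cmod v = cmod v powr (p - 1)"
      using powr_add[of "cmod v" "p - 2" 1] by simp
    then show ?thesis by (simp add: dual_def norm_mult)
  qed (simp add: dual_def)
  have le1: "Re (dual v x) \<le> cmod v powr (p - 1) * cmod x"
    using complex_Re_le_cmod[of "dual v x"] 1 by simp
  have le2: "cmod v powr (p - 1) * cmod x \<le> (1 - 1 / p) * cmod v powr p + cmod x powr p / p"
    by (rule Young_powr_strict(1)) (use p in auto)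
  show "Re (dual v x) \<le> (1 - 1 / p) * cmod v powr p + cmod x powr p / p"
    using le1 le2 by linarith
  assume eq: "Re (dual v x) = (1 - 1 / p) * cmod v powr p + cmod x powr p / p"
  then have "cmod v powr (p - 1) * cmod x = (1 - 1 / p) * cmod v powr p + cmod x powr p / p"
    using le1 le2 by linarith
  then have vx: "cmod v = cmod x"
    by (rule Young_powr_strict(2)[OF p norm_ge_zero norm_ge_zero])
  show "x = v"
  proof (cases "v = 0")
    case True
    then show ?thesis using vx by simp
  next
    case False
    have "Re (dual v x) = cmod v powr (p - 1) * cmod x"
      using eq le1 le2 by linarith
    moreover have "cmod v powr (p - 1) = cmod v powr (p - 2) * cmod v"
      using False powr_add[of "cmod v" "p - 2" 1] by simp
    moreover have "x \<noteq> 0"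
      using False vx by (metis norm_eq_zero)
    ultimately have "Re (cnj v * x) = (cmod v)\<^sup>2"
      using vx by (simp add: dual_def power2_eq_square mult.assoc)
    moreover have "(cmod (x - v))\<^sup>2 = (cmod x)\<^sup>2 + (cmod v)\<^sup>2 - 2 * Re (cnj v * x)"
      unfolding cmod_power2 by (simp add: power2_eq_square algebra_simps)
    ultimately have "(cmod (x - v))\<^sup>2 = 0"
      using vx by simp
    then show ?thesis by simp
  qed
qed

text \<open>Hoelder's inequality for the functional that norms \<open>(v, w)\<close>. After scaling
  \<open>(x, y)\<close> to norm one, the bounds for the two coordinates sum to one, so equality in
  the sum is equality in each coordinate.\<close>

lemma dual_pair_le:
  assumes "lp2 v w = 1"
  shows "Re (dual v x + dual w y) \<le> lp2 x y"
    and "Re (dual v x + dual w y) = lp2 x y \<Longrightarrow> x = of_real (lp2 x y) * v \<and> y = of_real (lp2 x y) * w"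
proof -
  have vw: "cmod v powr p + cmod w powr p = 1"
    using lp2_powr[of v w] assms by simp
  define n where "n = lp2 x y"
  have "Re (dual v x + dual w y) \<le> n \<and> (Re (dual v x + dual w y) = n \<longrightarrow> x = of_real n * v \<and> y = of_real n * w)"
  proof (cases "n = 0")
    case True
    then have "x = 0" "y = 0"
      using lp2_eq_0_iff[of x y] by (auto simp: n_def)
    then show ?thesis by (simp add: dual_def True)
  next
    case False
    then have n: "n > 0"
      using lp2_nonneg[of x y] unfolding n_def by linarith
    define x' y' where "x' = of_real (1 / n) * x" and "y' = of_real (1 / n) * y"
    have xy: "x = of_real n * x'" "y = of_real n * y'"
      using n by (auto simp: x'_def y'_def)
    have "lp2 x' y' = 1"
      unfolding x'_def y'_def using n by (subst lp2_scale) (auto simp: n_def)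
    then have xy': "cmod x' powr p + cmod y' powr p = 1"
      using lp2_powr[of x' y'] by simp
    have scale: "Re (dual v x + dual w y) = n * Re (dual v x' + dual w y')"
      by (simp add: dual_def xy algebra_simps)
    have one: "((1 - 1 / p) * cmod v powr p + cmod x' powr p / p) + ((1 - 1 / p) * cmod w powr p + cmod y' powr p / p) = 1"
    proof -
      have "((1 - 1 / p) * cmod v powr p + cmod x' powr p / p) + ((1 - 1 / p) * cmod w powr p + cmod y' powr p / p)
          = (1 - 1 / p) * (cmod v powr p + cmod w powr p) + (cmod x' powr p + cmod y' powr p) / p"
        by (simp add: algebra_simps add_divide_distrib)
      then show ?thesis by (simp add: vw xy')
    qed
    have le: "Re (dual v x' + dual w y') \<le> 1"
      using dual_le(1)[of v x'] dual_le(1)[of w y'] one by simp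
    have "x' = v \<and> y' = w" if "Re (dual v x' + dual w y') = 1"
    proof -
      have "Re (dual v x') = (1 - 1 / p) * cmod v powr p + cmod x' powr p / p"
        "Re (dual w y') = (1 - 1 / p) * cmod w powr p + cmod y' powr p / p"
        using that dual_le(1)[of v x'] dual_le(1)[of w y'] one by simp_all
      then show ?thesis
        using dual_le(2) by blast
    qed
    then show ?thesis
      unfolding scale using le n by (auto simp: xy)
  qed
  then show "Re (dual v x + dual w y) \<le> lp2 x y"
    "Re (dual v x + dual w y) = lp2 x y \<Longrightarrow> x = of_real (lp2 x y) * v \<and> y = of_real (lp2 x y) * w"
    by (auto simp: n_def)
qed

lemma lp2_integrable:
  assumes a: "integrable M a" and b: "integrable M b"
  shows "integrable M (\<lambda>t. lp2 (a t) (b t))"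
proof (rule Bochner_Integration.integrable_bound)
  show "integrable M (\<lambda>t. 2 powr (1/p) * (cmod (a t) + cmod (b t)))"
    using a b by simp
  note [measurable] = borel_measurable_integrable[OF a] borel_measurable_integrable[OF b]
  show "(\<lambda>t. lp2 (a t) (b t)) \<in> borel_measurable M"
    unfolding lp2_def by measurable
  have "lp2 x y \<le> 2 powr (1/p) * (cmod x + cmod y)" for x y
  proof -
    have "lp2 x y \<le> (2 * (cmod x + cmod y) powr p) powr (1/p)"
      unfolding lp2_def mult_2 using p by (intro powr_mono2 add_mono) auto
    also have "\<dots> = 2 powr (1/p) * (cmod x + cmod y)"
      using p by (simp add: powr_mult powr_powr)
    finally show ?thesis .
  qed
  then show "AE t in M. norm (lp2 (a t) (b t)) \<le> norm (2 powr (1/p) * (cmod (a t) + cmod (b t)))"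
    by (intro AE_I2) (simp add: order_trans[OF _ abs_ge_self])
qed

text \<open>One direction is strict convexity, through the functional that norms the integral.\<close>

lemma lp2_integral_eq_iff:
  assumes a: "integrable unit_interval a" and b: "integrable unit_interval b"
  shows "lp2 (LINT t|unit_interval. a t) (LINT t|unit_interval. b t) = (LINT t|unit_interval. lp2 (a t) (b t)) \<longleftrightarrow>
    (\<exists>M \<subseteq> {0<..<1}. M \<in> sets lebesgue \<and> negligible ({0<..<1} - M) \<and>
      (\<forall>t0\<in>M. (\<forall>t\<in>M. \<exists>l::real. l \<ge> 0 \<and> b t = of_real l * b t0 \<and> a t = of_real l * a t0) \<or> (b t0 = 0 \<and> a t0 = 0)))"
    (is "lp2 ?A ?B = ?n \<longleftrightarrow> ?R")
proof
  note ab = lp2_integrable[OF a b]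
  have nn: "?n \<ge> 0"
    by (intro integral_nonneg_AE) auto
  assume eq: "lp2 ?A ?B = ?n"
  \<comment> \<open>A common direction for almost all pairs is found first; this leaves a single
    null set, valid for all choices of \<open>t0\<close> and \<open>t\<close> at once.\<close>
  have "\<exists>v w. AE t in unit_interval. a t = of_real (lp2 (a t) (b t)) * v \<and> b t = of_real (lp2 (a t) (b t)) * w"
  proof (cases "?n = 0")
    case True
    then have "AE t in unit_interval. lp2 (a t) (b t) = 0"
      using integral_nonneg_eq_0_iff_AE[OF ab] by auto
    then have "AE t in unit_interval. a t = of_real (lp2 (a t) (b t)) * 0 \<and> b t = of_real (lp2 (a t) (b t)) * 0"
      by (rule AE_mp) (auto simp: lp2_eq_0_iff)
    then show ?thesis by blast
  next
    case False
    then have n: "?n > 0"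
      using nn by linarith
    \<comment> \<open>The direction is that of the integral itself. By linearity the integral of its
      norming functional is \<open>?n\<close>, while pointwise the functional is at most the norm;
      the nonnegative difference has integral zero and so vanishes almost everywhere.\<close>
    define v w where "v = of_real (1 / ?n) * ?A" and "w = of_real (1 / ?n) * ?B"
    have AB: "?A = of_real ?n * v" "?B = of_real ?n * w"
      using n by (auto simp: v_def w_def)
    have vw: "lp2 v w = 1"
      unfolding v_def w_def using n eq by (subst lp2_scale) auto
    let ?\<psi> = "\<lambda>t. Re (dual v (a t) + dual w (b t))"
    have int: "integrable unit_interval (\<lambda>t. dual v (a t) + dual w (b t))"
      unfolding dual_def using a b by simp
    have \<psi>_int: "integrable unit_interval ?\<psi>"
      by (rule integrable_Re[OF int])
    have "(LINT t|unit_interval. ?\<psi> t) = Re (LINT t|unit_interval. dual v (a t) + dual w (b t))"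
      by (rule integral_Re[OF int])
    also have "(LINT t|unit_interval. dual v (a t) + dual w (b t)) = dual v ?A + dual w ?B"
      unfolding dual_def using a b by simp
    also have "Re (dual v ?A + dual w ?B) = ?n * Re (dual v v + dual w w)"
      unfolding AB by (simp add: dual_def algebra_simps)
    also have "Re (dual v v + dual w w) = 1"
    proof -
      have "Re (dual v v) = cmod v powr p" for v
      proof (cases "v = 0")
        case False
        have "Re (dual v v) = cmod v powr (p - 2) * (cmod v)\<^sup>2"
          unfolding dual_def cmod_power2 by (simp add: power2_eq_square algebra_simps)
        also have "\<dots> = cmod v powr p"
          using False powr_add[of "cmod v" "p - 2" 2] by (simp add: powr_numeral)
        finally show ?thesis .
      qed (use p in \<open>simp add: dual_def\<close>)
      then show ?thesis
        using lp2_powr[of v w] vw by simp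
    qed
    finally have "(LINT t|unit_interval. lp2 (a t) (b t) - ?\<psi> t) = 0"
      using ab \<psi>_int by simp
    moreover have "integrable unit_interval (\<lambda>t. lp2 (a t) (b t) - ?\<psi> t)"
      using ab \<psi>_int by (rule Bochner_Integration.integrable_diff)
    ultimately have "AE t in unit_interval. lp2 (a t) (b t) - ?\<psi> t = 0"
      using dual_pair_le(1)[OF vw] by (subst (asm) integral_nonneg_eq_0_iff_AE) auto
    then have "AE t in unit_interval. a t = of_real (lp2 (a t) (b t)) * v \<and> b t = of_real (lp2 (a t) (b t)) * w"
      by (rule AE_mp) (intro AE_I2 impI dual_pair_le(2)[OF vw], simp)
    then show ?thesis by blast
  qed
  then obtain v w M where M: "M \<subseteq> {0<..<1}" "M \<in> sets lebesgue" "negligible ({0<..<1} - M)"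
    and vw: "\<And>t. t \<in> M \<Longrightarrow> a t = of_real (lp2 (a t) (b t)) * v \<and> b t = of_real (lp2 (a t) (b t)) * w"
    unfolding AE_unit_interval_iff by blast
  have "(\<forall>t\<in>M. \<exists>l::real. l \<ge> 0 \<and> b t = of_real l * b t0 \<and> a t = of_real l * a t0) \<or> (b t0 = 0 \<and> a t0 = 0)"
    if t0: "t0 \<in> M" for t0
  proof (cases "lp2 (a t0) (b t0) = 0")
    case True
    then show ?thesis by (simp add: lp2_eq_0_iff)
  next
    case False
    define n0 where "n0 = lp2 (a t0) (b t0)"
    have n0: "n0 > 0"
      using False lp2_nonneg[of "a t0" "b t0"] unfolding n0_def by linarith
    have 0: "a t0 = of_real n0 * v" "b t0 = of_real n0 * w"
      using vw[OF t0] by (auto simp: n0_def)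
    have "\<exists>l::real. l \<ge> 0 \<and> b t = of_real l * b t0 \<and> a t = of_real l * a t0" if t: "t \<in> M" for t
    proof -
      define k where "k = lp2 (a t) (b t)"
      have k: "a t = of_real k * v" "b t = of_real k * w"
        using vw[OF t] by (auto simp: k_def)
      show ?thesis
        unfolding 0 k using n0 lp2_nonneg[of "a t" "b t"] by (intro exI[of _ "k / n0"]) (auto simp: k_def)
    qed
    then show ?thesis by blast
  qed
  then show ?R
    using M by blast
next
  assume ?R
  then obtain M where M: "M \<subseteq> {0<..<1}" "M \<in> sets lebesgue" "negligible ({0<..<1} - M)"
    and *: "\<And>t0. t0 \<in> M \<Longrightarrow> (\<forall>t\<in>M. \<exists>l::real. l \<ge> 0 \<and> b t = of_real l * b t0 \<and> a t = of_real l * a t0) \<or> (b t0 = 0 \<and> a t0 = 0)"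
    by blast
  \<comment> \<open>If all pairs over \<open>M\<close> vanish there is no direction to normalise;
    zero vectors then serve, and the last alternative records this case.\<close>
  have "\<exists>v w. (\<forall>t\<in>M. a t = of_real (lp2 (a t) (b t)) * v \<and> b t = of_real (lp2 (a t) (b t)) * w \<and> (lp2 v w = 1 \<or> lp2 (a t) (b t) = 0))"
  proof (cases "\<exists>t0\<in>M. lp2 (a t0) (b t0) \<noteq> 0")
    case True
    then obtain t0 where t0: "t0 \<in> M" "lp2 (a t0) (b t0) \<noteq> 0" by blast
    define n0 where "n0 = lp2 (a t0) (b t0)"
    have n0: "n0 > 0"
      using t0 lp2_nonneg[of "a t0" "b t0"] unfolding n0_def by linarith
    define v w where "v = of_real (1 / n0) * a t0" and "w = of_real (1 / n0) * b t0"
    have vw: "lp2 v w = 1"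
      unfolding v_def w_def using n0 by (subst lp2_scale) (auto simp: n0_def)
    have "a t = of_real (lp2 (a t) (b t)) * v \<and> b t = of_real (lp2 (a t) (b t)) * w" if t: "t \<in> M" for t
    proof -
      obtain l :: real where l: "l \<ge> 0" "b t = of_real l * b t0" "a t = of_real l * a t0"
        using *[OF t0(1)] t t0(2) by (auto simp: lp2_eq_0_iff)
      have "lp2 (a t) (b t) = l * n0"
        unfolding l n0_def by (rule lp2_scale[OF l(1)])
      then show ?thesis
        using n0 by (simp add: l v_def w_def)
    qed
    then show ?thesis
      using vw by (intro exI[of _ v] exI[of _ w]) auto
  next
    case False
    then have "lp2 (a t) (b t) = 0 \<and> a t = 0 \<and> b t = 0" if "t \<in> M" for t
      using that lp2_eq_0_iff[of "a t" "b t"] by blast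
    then show ?thesis
      using lp2_eq_0_iff[of 0 0] by (intro exI[of _ 0]) auto
  qed
  then obtain v w where vw: "\<forall>t\<in>M. a t = of_real (lp2 (a t) (b t)) * v \<and> b t = of_real (lp2 (a t) (b t)) * w \<and> (lp2 v w = 1 \<or> lp2 (a t) (b t) = 0)"
    by blast
  have AE: "AE t in unit_interval. a t = of_real (lp2 (a t) (b t)) * v \<and> b t = of_real (lp2 (a t) (b t)) * w \<and> (lp2 v w = 1 \<or> lp2 (a t) (b t) = 0)"
    unfolding AE_unit_interval_iff using M vw by blast
  note ab = lp2_integrable[OF a b]
  have meas: "a \<in> borel_measurable unit_interval" "b \<in> borel_measurable unit_interval" "(\<lambda>t. complex_of_real (lp2 (a t) (b t))) \<in> borel_measurable unit_interval"
    using a b ab by auto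
  have "?A = (LINT t|unit_interval. of_real (lp2 (a t) (b t)) * v)" "?B = (LINT t|unit_interval. of_real (lp2 (a t) (b t)) * w)"
  proof -
    have *: "AE t in unit_interval. a t = of_real (lp2 (a t) (b t)) * v" "AE t in unit_interval. b t = of_real (lp2 (a t) (b t)) * w"
      using AE by (eventually_elim, blast)+
    show "?A = (LINT t|unit_interval. of_real (lp2 (a t) (b t)) * v)"
      by (rule integral_cong_AE[OF meas(1) borel_measurable_times[OF meas(3) borel_measurable_const] *(1)])
    show "?B = (LINT t|unit_interval. of_real (lp2 (a t) (b t)) * w)"
      by (rule integral_cong_AE[OF meas(2) borel_measurable_times[OF meas(3) borel_measurable_const] *(2)])
  qed
  then have AB: "?A = of_real ?n * v" "?B = of_real ?n * w"
    using ab by auto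
  have nn: "?n \<ge> 0"
    by (intro integral_nonneg_AE) auto
  have "lp2 ?A ?B = ?n * lp2 v w"
    unfolding AB using lp2_scale[OF nn] by simp
  moreover have "lp2 v w = 1 \<or> ?n = 0"
  proof (cases "lp2 v w = 1")
    case False
    then have "AE t in unit_interval. lp2 (a t) (b t) = 0"
      by (intro eventually_mono[OF AE]) (use False in blast)
    then have "?n = (LINT t|unit_interval. 0)"
      using ab by (intro integral_cong_AE[OF borel_measurable_integrable]) simp_all
    then show ?thesis by simp
  qed simp
  ultimately show "lp2 ?A ?B = ?n" by auto
qed

end

section \<open>Boundary behaviour and dependence on the parameter\<close>

lemma at_within_disk_neq_bot:
  assumes "cmod \<xi> = 1"
  shows "at \<xi> within disk \<noteq> bot"
  using assms by (simp add: trivial_limit_within islimpt_ball)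

text \<open>Identifies the limit chosen by \<open>bval\<close> with the value of the continuous
  extension. Uniqueness of limits applies because a boundary point is an accumulation point of the
  disk.\<close>

lemma extends_near_pm1_tendsto:
  assumes f: "extends_near_pm1 f" and \<xi>: "\<xi> = 1 \<or> \<xi> = -1"
  shows "(f \<longlongrightarrow> bval f \<xi>) (at \<xi> within disk)"
proof -
  obtain \<epsilon> h where \<epsilon>: "\<epsilon> > 0" and h: "continuous_on (cball 0 1 \<inter> U \<epsilon>) h" "\<And>z. z \<in> disk \<inter> U \<epsilon> \<Longrightarrow> h z = f z"
    using f unfolding extends_near_pm1_def by blast
  have \<xi>U: "\<xi> \<in> cball 0 1 \<inter> U \<epsilon>"
    using \<xi> \<epsilon> by (auto simp: U_def)
  have nz: "at \<xi> within disk \<noteq> bot"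
    using \<xi> by (intro at_within_disk_neq_bot) auto
  have "(h \<longlongrightarrow> h \<xi>) (at \<xi> within (cball 0 1 \<inter> U \<epsilon>))"
    using h(1) \<xi>U by (simp add: continuous_on_def)
  then have "(h \<longlongrightarrow> h \<xi>) (at \<xi> within (disk \<inter> U \<epsilon>))"
    by (rule tendsto_within_subset) auto
  moreover have "at \<xi> within (disk \<inter> U \<epsilon>) = at \<xi> within disk"
    using \<xi>U by (intro at_within_nhd[of _ "U \<epsilon>"]) (auto simp: U_def)
  ultimately have "(h \<longlongrightarrow> h \<xi>) (at \<xi> within disk)"
    by simp
  moreover have "eventually (\<lambda>z. h z = f z) (at \<xi> within disk)"
  proof -
    have "eventually (\<lambda>z. z \<in> U \<epsilon>) (at \<xi> within disk)"
      using \<xi>U by (intro topological_tendstoD[OF tendsto_ident_at]) (auto simp: U_def)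
    then show ?thesis
      using h(2) by (auto simp: eventually_at_filter elim!: eventually_mono)
  qed
  ultimately have "(f \<longlongrightarrow> h \<xi>) (at \<xi> within disk)"
    by (rule Lim_transform_eventually)
  with tendsto_Lim[OF nz this] show ?thesis
    by (simp add: bval_def)
qed

text \<open>The mean value inequality turns the limit of the derivative into an angular derivative.\<close>

lemma difference_quotient_tendsto:
  assumes f: "f holomorphic_on disk" and \<xi>: "cmod \<xi> = 1"
    and D: "(deriv f \<longlongrightarrow> D) (at \<xi> within disk)" and lim: "(f \<longlongrightarrow> l) (at \<xi> within disk)"
  shows "((\<lambda>z. (l - f z) / (\<xi> - z)) \<longlongrightarrow> D) (at \<xi> within disk)"
proof (rule tendstoI)
  fix e :: real assume e: "e > 0"
  have "eventually (\<lambda>z. dist (deriv f z) D < e / 2) (at \<xi> within disk)"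
    using tendstoD[OF D, of "e/2"] e by simp
  then obtain \<delta> where \<delta>: "\<delta> > 0" "\<And>z. z \<in> disk \<Longrightarrow> z \<noteq> \<xi> \<Longrightarrow> dist z \<xi> < \<delta> \<Longrightarrow> dist (deriv f z) D < e / 2"
    unfolding eventually_at by blast
  have \<xi>n: "\<xi> \<notin> disk" using \<xi> by auto
  define C where "C = disk \<inter> ball \<xi> \<delta>"
  have C: "convex C"
    by (auto simp: C_def intro: convex_Int)
  \<comment> \<open>Subtracting the linear map of slope \<open>D\<close> leaves a function whose
    derivative is at most \<open>e / 2\<close> in modulus, and the cap \<open>C\<close> is
    convex.\<close>
  have bound: "cmod ((f w - D * w) - (f z - D * z)) \<le> e / 2 * cmod (w - z)" if "w \<in> C" "z \<in> C" for w z
  proof (rule field_differentiable_bound[OF C, where f' = "\<lambda>z. deriv f z - D"])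
    fix x assume x: "x \<in> C"
    then have "(f has_field_derivative deriv f x) (at x)"
      using f by (intro holomorphic_derivI[of _ disk]) (auto simp: C_def)
    then show "((\<lambda>z. f z - D * z) has_field_derivative deriv f x - D) (at x within C)"
      by (auto intro!: derivative_eq_intros intro: has_field_derivative_at_within)
    show "cmod (deriv f x - D) \<le> e / 2"
    proof -
      have "x \<in> disk" "x \<noteq> \<xi>" "dist x \<xi> < \<delta>"
        using x \<xi>n by (auto simp: C_def dist_commute)
      from \<delta>(2)[OF this] show ?thesis
        by (simp add: dist_norm)
    qed
  qed (use that in auto)
  have "dist ((l - f z) / (\<xi> - z)) D < e" if z: "z \<in> disk" "dist z \<xi> < \<delta>" for z
  proof -
    have zC: "z \<in> C"
      using z by (simp add: C_def dist_commute)
    have z\<xi>: "\<xi> - z \<noteq> 0"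
      using z \<xi>n by auto
    \<comment> \<open>The boundary point does not belong to \<open>C\<close>; the estimate reaches
      it by letting \<open>w\<close> tend to \<open>\<xi>\<close>.\<close>
    have "cmod ((l - D * \<xi>) - (f z - D * z)) \<le> e / 2 * cmod (\<xi> - z)"
    proof (rule tendsto_le[OF at_within_disk_neq_bot[OF \<xi>]])
      show "((\<lambda>w. e / 2 * cmod (w - z)) \<longlongrightarrow> e / 2 * cmod (\<xi> - z)) (at \<xi> within disk)"
        by (intro tendsto_intros)
      show "((\<lambda>w. cmod ((f w - D * w) - (f z - D * z))) \<longlongrightarrow> cmod ((l - D * \<xi>) - (f z - D * z))) (at \<xi> within disk)"
        by (intro tendsto_intros lim)
      show "eventually (\<lambda>w. cmod ((f w - D * w) - (f z - D * z)) \<le> e / 2 * cmod (w - z)) (at \<xi> within disk)"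
        unfolding eventually_at using \<delta>(1) bound[OF _ zC]
        by (intro exI[of _ \<delta>]) (auto simp: C_def dist_commute)
    qed
    moreover have "(l - f z) / (\<xi> - z) - D = ((l - D * \<xi>) - (f z - D * z)) / (\<xi> - z)"
      using z\<xi> by (simp add: field_simps)
    ultimately have "cmod ((l - f z) / (\<xi> - z) - D) \<le> e / 2"
      using z\<xi> by (simp add: norm_divide divide_le_eq)
    then show ?thesis
      using e by (simp add: dist_norm)
  qed
  then show "eventually (\<lambda>z. dist ((l - f z) / (\<xi> - z)) D < e) (at \<xi> within disk)"
    unfolding eventually_at using \<delta>(1) by blast
qed

text \<open>Approaching \<open>\<xi>\<close> in every direction \<open>w\<close> of the right half-plane gives \<open>Re (w * D) \<ge> 0\<close>.\<close>

lemma angular_derivative_nonneg: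
  assumes f: "f ` disk \<subseteq> disk" and \<xi>: "cmod \<xi> = 1"
    and D: "((\<lambda>z. (\<xi> - f z) / (\<xi> - z)) \<longlongrightarrow> D) (at \<xi> within disk)"
  shows "Im D = 0" "Re D \<ge> 0"
proof -
  have \<xi>0: "\<xi> \<noteq> 0" using \<xi> by auto
  have half: "Re (w * D) \<ge> 0" if w: "Re w > 0" for w
  proof -
    let ?z = "\<lambda>s::real. \<xi> * (1 - of_real s * w)"
    have w0: "w \<noteq> 0" using w by auto
    \<comment> \<open>The squared modulus of \<open>1 - s * w\<close> is
      \<open>1 - 2 * s * Re w + s^2 * (cmod w)^2\<close>, which for positive \<open>s\<close> is
      below one exactly in this range.\<close>
    have in_disk: "?z s \<in> disk" if s: "0 < s" "s < 2 * Re w / (cmod w)\<^sup>2" for s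
    proof -
      have "s * (cmod w)\<^sup>2 < 2 * Re w"
        using s w0 by (simp add: field_simps)
      then have "s * (s * (cmod w)\<^sup>2) < s * (2 * Re w)"
        using s by (intro mult_strict_left_mono) auto
      then have "(cmod (1 - of_real s * w))\<^sup>2 < 1"
        unfolding cmod_power2 by (simp add: power2_eq_square algebra_simps)
      then have "cmod (1 - of_real s * w) < 1"
        by (simp add: power_less_one_iff abs_square_less_1)
      then show ?thesis
        using \<xi> by (simp add: norm_mult)
    qed
    have pos: "2 * Re w / (cmod w)\<^sup>2 > 0"
      using w w0 by simp
    have ev: "eventually (\<lambda>s. 0 < s \<and> s < 2 * Re w / (cmod w)\<^sup>2) (at_right 0)"
      using pos by (auto simp: eventually_at_right)
    have "filterlim ?z (at \<xi> within disk) (at_right 0)"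
      unfolding filterlim_at
    proof
      show "eventually (\<lambda>s. ?z s \<in> disk \<and> ?z s \<noteq> \<xi>) (at_right 0)"
        using ev by eventually_elim (use in_disk \<xi> in fastforce)
      have "(?z \<longlongrightarrow> \<xi> * (1 - of_real 0 * w)) (at_right 0)"
        by (intro tendsto_intros)
      then show "(?z \<longlongrightarrow> \<xi>) (at_right 0)" by simp
    qed
    from filterlim_compose[OF D this]
    have "((\<lambda>s. Re (w * ((\<xi> - f (?z s)) / (\<xi> - ?z s)))) \<longlongrightarrow> Re (w * D)) (at_right 0)"
      by (intro tendsto_intros)
    moreover have "eventually (\<lambda>s. Re (w * ((\<xi> - f (?z s)) / (\<xi> - ?z s))) \<ge> 0) (at_right 0)"
      using ev
    proof eventually_elim
      case (elim s)
      have "f (?z s) \<in> disk"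
        using f in_disk elim by blast
      then have "cmod (cnj \<xi> * f (?z s)) < 1"
        using \<xi> by (simp add: norm_mult)
      then have re: "Re (1 - cnj \<xi> * f (?z s)) > 0"
        using complex_Re_le_cmod[of "cnj \<xi> * f (?z s)"] by (simp del: times_complex.sel)
      have "\<xi> * cnj \<xi> = 1"
        using \<xi> by (simp add: complex_norm_square[symmetric])
      then have "\<xi> - f (?z s) = \<xi> * (1 - cnj \<xi> * f (?z s))"
        by (simp add: right_diff_distrib mult.assoc[symmetric])
      moreover have "\<xi> - ?z s = \<xi> * (of_real s * w)"
        by (simp add: algebra_simps)
      ultimately have "w * ((\<xi> - f (?z s)) / (\<xi> - ?z s)) = (1 - cnj \<xi> * f (?z s)) / of_real s"
        using \<xi>0 w0 by simp
      then have "Re (w * ((\<xi> - f (?z s)) / (\<xi> - ?z s))) = Re (1 - cnj \<xi> * f (?z s)) / s"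
        by (simp only: Re_divide_of_real)
      then show ?case
        using re elim by (simp del: times_complex.sel minus_complex.sel)
    qed
    ultimately show ?thesis
      by (rule tendsto_lowerbound) simp
  qed
  show "Re D \<ge> 0"
    using half[of 1] by simp
  show "Im D = 0"
  proof (rule ccontr)
    \<comment> \<open>The direction used next has real part one and is chosen such that the real
      part of its product with \<open>D\<close> is \<open>Re D - (Re D + 1) = -1\<close>.\<close>
    assume "Im D \<noteq> 0"
    then show False
      using half[of "Complex 1 ((Re D + 1) / Im D)"] by simp
  qed
qed

section \<open>Operator bounds and continuity in the parameter\<close>

locale weighted_family = bergman +
  fixes u \<phi> :: "real \<Rightarrow> complex \<Rightarrow> complex"
  assumes family: "weighted_comp_family p \<alpha> u \<phi>"
    and directions: "has_directions_pm1 u \<phi>"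
    and cond_W: "condition_W p \<alpha> u \<phi>"
begin

abbreviation S :: "real \<Rightarrow> (complex \<Rightarrow> complex) \<Rightarrow> complex \<Rightarrow> complex" where
  "S t \<equiv> weighted_comp (u t) (\<phi> t)"

abbreviation opn :: "real \<Rightarrow> real" where
  "opn t \<equiv> operator_norm p \<alpha> (S t)"

lemma familyD:
  assumes "t \<in> {0<..<1}"
  shows "\<phi> t holomorphic_on disk" "\<phi> t ` disk \<subseteq> disk" "u t \<in> A" "S t \<in> bounded_operators p \<alpha>"
  using assms family by (auto simp: weighted_comp_family_def)

lemma S_A: "t \<in> {0<..<1} \<Longrightarrow> f \<in> A \<Longrightarrow> S t f \<in> A"
  using familyD(4)[of t] by (simp add: bounded_operators_def)

lemma opn_integrable: "integrable unit_interval opn"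
  using cond_W by (simp add: condition_W_def)

text \<open>A supremum of reals bounds the values only if their range is bounded above, which is
  what membership in \<open>bounded_operators\<close> supplies. The same constant \<open>K\<close>
  settles functions of norm zero, which cannot be normalised.\<close>

lemma norm_S_le:
  assumes t: "t \<in> {0<..<1}" and f: "f \<in> A"
  shows "N (S t f) \<le> opn t * N f"
proof -
  obtain K where K: "\<And>f. f \<in> A \<Longrightarrow> N (S t f) \<le> K * N f"
    using familyD(4)[OF t] unfolding bounded_operators_def by blast
  show ?thesis
  proof (cases "N f = 0")
    case True
    then show ?thesis using K[OF f] by simp
  next
    case False
    then have n: "N f > 0"
      using bergman_norm_nonneg[of p \<alpha> f] by linarith
    let ?g = "\<lambda>z. of_real (1 / N f) * f z"
    have g: "?g \<in> A" "N ?g = 1"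
      by (rule A_cmult[OF f]) (use n N_cmult[of "of_real (1 / N f)" f] in \<open>auto simp: norm_divide\<close>)
    have bdd: "bdd_above ((\<lambda>f. N (S t f)) ` {f \<in> A. N f \<le> 1})"
    proof (rule bdd_aboveI2)
      fix f assume "f \<in> {f \<in> A. N f \<le> 1}"
      then show "N (S t f) \<le> \<bar>K\<bar>"
        using K[of f] mult_right_mono[OF abs_ge_self, of "N f" K] mult_left_mono[of "N f" 1 "\<bar>K\<bar>"] by auto
    qed
    have "N (S t ?g) \<le> opn t"
      unfolding operator_norm_def using g by (intro cSUP_upper bdd) auto
    also have "S t ?g = (\<lambda>z. of_real (1 / N f) * S t f z)"
      by (simp add: weighted_comp_def)
    also have "N \<dots> = 1 / N f * N (S t f)"
      using n by (simp only: N_cmult norm_of_real) simp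
    finally show ?thesis
      using n by (simp add: field_simps)
  qed
qed

lemma S_diff: "(\<lambda>z. S t f z - S t g z) = S t (\<lambda>z. f z - g z)"
  by (simp add: weighted_comp_def right_diff_distrib)

lemma eventually_in_unit: "t0 \<in> {0<..<1} \<Longrightarrow> eventually (\<lambda>t. t \<in> {0<..<1}) (at (t0::real))"
  by (intro eventually_at_in_open') auto

text \<open>The supremum in condition (i) yields a pointwise estimate because two self-maps of the
  disk differ by at most 2, so the range is bounded above.\<close>

lemma \<phi>_uniform:
  assumes t0: "t0 \<in> {0<..<1}" and e: "e > 0"
  shows "eventually (\<lambda>t. \<forall>z\<in>disk. cmod (\<phi> t z - \<phi> t0 z) < e) (at t0)"
proof -
  have "((\<lambda>t. SUP z\<in>disk. cmod (\<phi> t z - \<phi> t0 z)) \<longlongrightarrow> 0) (at t0)"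
    using cond_W t0 by (simp add: condition_W_def)
  from order_tendstoD(2)[OF this e] eventually_in_unit[OF t0]
  show ?thesis
  proof eventually_elim
    case (elim t)
    have bdd: "bdd_above ((\<lambda>z. cmod (\<phi> t z - \<phi> t0 z)) ` disk)"
    proof (rule bdd_aboveI2)
      fix z :: complex assume "z \<in> disk"
      then have "\<phi> t z \<in> disk" "\<phi> t0 z \<in> disk"
        using familyD(2) elim(2) t0 by blast+
      then show "cmod (\<phi> t z - \<phi> t0 z) \<le> 2"
        using norm_triangle_ineq4[of "\<phi> t z" "\<phi> t0 z"] by simp
    qed
    show ?case
      using elim(1) cSUP_upper[OF _ bdd] by (meson order_le_less_trans)
  qed
qed

lemma measure_U_le:
  assumes "\<epsilon> > 0"
  shows "measure \<mu> (disk \<inter> U \<epsilon>) \<le> (1 + \<alpha>) * (2 * pi * \<epsilon>\<^sup>2)"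
proof -
  have Ub: "U \<epsilon> \<in> sets borel"
    by (simp add: U_def)
  have meas: "disk \<inter> U \<epsilon> \<in> sets \<mu>"
    using Ub by (simp add: sets_dA sets_restrict_space image_iff) blast
  have "emeasure \<mu> (disk \<inter> U \<epsilon>) = (\<integral>\<^sup>+z. indicator (disk \<inter> U \<epsilon>) z \<partial>\<mu>)"
    using meas by simp
  also have "\<dots> = (\<integral>\<^sup>+z. ennreal (dA_weight \<alpha> z) * indicator (disk \<inter> U \<epsilon>) z * indicator disk z \<partial>lborel)"
    using meas by (intro nn_integral_dA) auto
  also have "\<dots> \<le> (\<integral>\<^sup>+z. ennreal (1 + \<alpha>) * indicator (U \<epsilon>) z \<partial>lborel)"
    using dA_weight_le[OF \<alpha>] by (intro nn_integral_mono) (auto simp: indicator_def simp del: ennreal_plus intro!: ennreal_leI)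
  also have "\<dots> = ennreal (1 + \<alpha>) * emeasure lborel (U \<epsilon>)"
    using Ub by (intro nn_integral_cmult_indicator) simp
  also have "emeasure lborel (U \<epsilon>) \<le> ennreal (pi * \<epsilon>\<^sup>2) + ennreal (pi * \<epsilon>\<^sup>2)"
    unfolding U_def using assms emeasure_subadditive[of "ball (1::complex) \<epsilon>" lborel "ball (-1) \<epsilon>"]
    by (simp add: emeasure_ball_complex)
  also have "ennreal (pi * \<epsilon>\<^sup>2) + ennreal (pi * \<epsilon>\<^sup>2) = ennreal (2 * pi * \<epsilon>\<^sup>2)"
    by (subst ennreal_plus[symmetric]) (auto simp del: ennreal_plus)
  also have "ennreal (1 + \<alpha>) * ennreal (2 * pi * \<epsilon>\<^sup>2) = ennreal ((1 + \<alpha>) * (2 * pi * \<epsilon>\<^sup>2))"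
    using \<alpha> by (intro ennreal_mult[symmetric]) auto
  finally have "emeasure \<mu> (disk \<inter> U \<epsilon>) \<le> ennreal ((1 + \<alpha>) * (2 * pi * \<epsilon>\<^sup>2))"
    by (simp add: mult_left_mono)
  then show ?thesis
    using \<alpha> by (simp add: emeasure_eq_measure)
qed

lemma u_locally_bounded:
  assumes t0: "t0 \<in> {0<..<1}"
  obtains \<epsilon> K where "\<epsilon> > 0" "K \<ge> 0" "\<And>t z. t \<in> {0<..<1} \<Longrightarrow> dist t t0 < \<epsilon> \<Longrightarrow> z \<in> disk \<Longrightarrow> z \<in> U \<epsilon> \<Longrightarrow> cmod (u t z) \<le> K"
proof -
  obtain \<epsilon> where \<epsilon>: "\<epsilon> > 0" and lt: "(SUP t\<in>{0<..<1} \<inter> ball t0 \<epsilon>. SUP z\<in>U \<epsilon> \<inter> disk. ereal (cmod (u t z))) < \<infinity>" (is "?S < _")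
    using cond_W t0 unfolding condition_W_def by blast
  have le: "ereal (cmod (u t z)) \<le> ?S" if "t \<in> {0<..<1}" "dist t t0 < \<epsilon>" "z \<in> disk" "z \<in> U \<epsilon>" for t z
    using that by (intro SUP_upper2[of t] SUP_upper) (auto simp: dist_commute)
  define K where "K = max 0 (real_of_ereal ?S)"
  have "cmod (u t z) \<le> K" if "t \<in> {0<..<1}" "dist t t0 < \<epsilon>" "z \<in> disk" "z \<in> U \<epsilon>" for t z
    using le[OF that] lt unfolding K_def by (cases ?S) auto
  then show thesis
    using that[of \<epsilon> K] \<epsilon> by (auto simp: K_def)
qed

text \<open>Off \<open>U \<epsilon>\<close> this is condition (ii). On \<open>U \<epsilon>\<close>
  condition (iii) bounds the integrand by \<open>(2 * K) powr p\<close>, and the mass of this set is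
  of order \<epsilon> squared. Hence \<epsilon> is fixed first, and \<open>t\<close> is moved
  towards \<open>t0\<close> afterwards.\<close>

lemma u_continuous:
  assumes t0: "t0 \<in> {0<..<1}"
  shows "((\<lambda>t. N (\<lambda>z. u t z - u t0 z)) \<longlongrightarrow> 0) (at t0)"
proof -
  obtain \<epsilon>0 K where \<epsilon>0: "\<epsilon>0 > 0" "K \<ge> 0" and K: "\<And>t z. t \<in> {0<..<1} \<Longrightarrow> dist t t0 < \<epsilon>0 \<Longrightarrow> z \<in> disk \<Longrightarrow> z \<in> U \<epsilon>0 \<Longrightarrow> cmod (u t z) \<le> K"
    using u_locally_bounded[OF t0] by blast
  let ?f = "\<lambda>t z. cmod (u t z - u t0 z) powr p"
  have near: "eventually (\<lambda>t. t \<in> {0<..<1} \<and> dist t t0 < \<epsilon>0) (at t0)"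
    using eventually_in_unit[OF t0] eventually_at_ball[OF \<epsilon>0(1), of t0] by eventually_elim (auto simp: dist_commute)
  have split: "(LINT z|\<mu>. ?f t z) \<le> (LINT z:(disk - U \<epsilon>)|\<mu>. ?f t z) + (2 * K) powr p * ((1 + \<alpha>) * (2 * pi * \<epsilon>\<^sup>2))"
    if t: "t \<in> {0<..<1}" "dist t t0 < \<epsilon>0" and \<epsilon>: "0 < \<epsilon>" "\<epsilon> \<le> \<epsilon>0" for t \<epsilon>
  proof -
    have int: "integrable \<mu> (?f t)"
      using familyD(3) t(1) t0 by (intro LpD(2) L_diff A_L) auto
    have Ub: "U \<epsilon> \<in> sets borel"
      by (simp add: U_def)
    have meas: "disk \<inter> U \<epsilon> \<in> sets \<mu>" "disk - U \<epsilon> \<in> sets \<mu>"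
    proof -
      show 1: "disk \<inter> U \<epsilon> \<in> sets \<mu>"
        using Ub by (simp add: sets_dA sets_restrict_space image_iff) blast
      have "disk - U \<epsilon> = space \<mu> - (disk \<inter> U \<epsilon>)" by auto
      then show "disk - U \<epsilon> \<in> sets \<mu>"
        using 1 by (metis sets.compl_sets)
    qed
    have "(LINT z|\<mu>. ?f t z) \<le> (LINT z|\<mu>. indicator (disk - U \<epsilon>) z *\<^sub>R ?f t z + (2 * K) powr p * indicator (disk \<inter> U \<epsilon>) z)"
    proof (rule integral_mono[OF int])
      show "integrable \<mu> (\<lambda>z. indicator (disk - U \<epsilon>) z *\<^sub>R ?f t z + (2 * K) powr p * indicator (disk \<inter> U \<epsilon>) z)"
        using meas int by (intro Bochner_Integration.integrable_add integrable_mult_indicator integrable_mult_right integrable_real_indicator)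
          (auto simp: emeasure_finite less_top[symmetric])
      fix z assume z: "z \<in> space \<mu>"
      show "?f t z \<le> indicator (disk - U \<epsilon>) z *\<^sub>R ?f t z + (2 * K) powr p * indicator (disk \<inter> U \<epsilon>) z"
      proof (cases "z \<in> U \<epsilon>")
        case True
        then have "z \<in> U \<epsilon>0"
          using \<epsilon> by (auto simp: U_def)
        then have "cmod (u t z) \<le> K" "cmod (u t0 z) \<le> K"
          using K t t0 z \<epsilon>0 by auto
        then have "cmod (u t z - u t0 z) \<le> 2 * K"
          using norm_triangle_ineq4[of "u t z" "u t0 z"] by simp
        then show ?thesis
          using True z p by (simp add: powr_mono2)
      qed (use z in simp)
    qed
    also have "\<dots> = (LINT z:(disk - U \<epsilon>)|\<mu>. ?f t z) + (2 * K) powr p * measure \<mu> (disk \<inter> U \<epsilon>)"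
    proof (subst Bochner_Integration.integral_add)
      show "integrable \<mu> (\<lambda>z. indicator (disk - U \<epsilon>) z *\<^sub>R ?f t z)"
        using meas int by (intro integrable_mult_indicator)
      show "integrable \<mu> (\<lambda>z. (2 * K) powr p * indicator (disk \<inter> U \<epsilon>) z)"
        using meas by (intro integrable_mult_right integrable_real_indicator) (auto simp: emeasure_finite less_top[symmetric])
      have "disk \<inter> U \<epsilon> \<inter> space \<mu> = disk \<inter> U \<epsilon>" by auto
      then show "(LINT z|\<mu>. indicator (disk - U \<epsilon>) z *\<^sub>R ?f t z) + (LINT z|\<mu>. (2 * K) powr p * indicator (disk \<inter> U \<epsilon>) z)
          = (LINT z:(disk - U \<epsilon>)|\<mu>. ?f t z) + (2 * K) powr p * measure \<mu> (disk \<inter> U \<epsilon>)"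
        by (simp only: integral_mult_right_zero set_lebesgue_integral_def Bochner_Integration.integral_indicator)
    qed
    also have "\<dots> \<le> (LINT z:(disk - U \<epsilon>)|\<mu>. ?f t z) + (2 * K) powr p * ((1 + \<alpha>) * (2 * pi * \<epsilon>\<^sup>2))"
      using measure_U_le[OF \<epsilon>(1)] by (intro add_left_mono mult_left_mono) auto
    finally show ?thesis .
  qed
  have "((\<lambda>t. LINT z|\<mu>. ?f t z) \<longlongrightarrow> 0) (at t0)"
  proof (rule tendstoI)
    fix e :: real assume e: "e > 0"
    \<comment> \<open>The summand 1 keeps \<open>C\<close> positive even for \<open>K = 0\<close>,
      so that \<epsilon> can be chosen with \<epsilon> squared at most
      \<open>e / (2 * C)\<close>.\<close>
    define C where "C = (2 * K) powr p * ((1 + \<alpha>) * (2 * pi)) + 1"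
    have C: "C > 0"
      using \<alpha> by (auto simp: C_def intro!: add_nonneg_pos)
    define \<epsilon> where "\<epsilon> = min \<epsilon>0 (sqrt (e / (2 * C)))"
    have \<epsilon>: "0 < \<epsilon>" "\<epsilon> \<le> \<epsilon>0"
      using \<epsilon>0 e C by (auto simp: \<epsilon>_def)
    have "\<epsilon>\<^sup>2 \<le> (sqrt (e / (2 * C)))\<^sup>2"
      using \<epsilon> by (intro power_mono) (auto simp: \<epsilon>_def)
    then have "\<epsilon>\<^sup>2 \<le> e / (2 * C)"
      using e C by simp
    then have "C * \<epsilon>\<^sup>2 \<le> C * (e / (2 * C))"
      using C by (intro mult_left_mono) auto
    then have small: "C * \<epsilon>\<^sup>2 \<le> e / 2"
      using C by simp
    have "(2 * K) powr p * ((1 + \<alpha>) * (2 * pi * \<epsilon>\<^sup>2)) = C * \<epsilon>\<^sup>2 - \<epsilon>\<^sup>2"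
      by (simp add: C_def algebra_simps)
    then have small': "(2 * K) powr p * ((1 + \<alpha>) * (2 * pi * \<epsilon>\<^sup>2)) \<le> e / 2"
      using small zero_le_power2[of \<epsilon>] by linarith
    have "((\<lambda>t. LINT z:(disk - U \<epsilon>)|\<mu>. ?f t z) \<longlongrightarrow> 0) (at t0)"
      using cond_W t0 \<epsilon> unfolding condition_W_def by blast
    then have "eventually (\<lambda>t. (LINT z:(disk - U \<epsilon>)|\<mu>. ?f t z) < e / 2) (at t0)"
      using e by (intro order_tendstoD(2)) auto
    then show "eventually (\<lambda>t. dist (LINT z|\<mu>. ?f t z) 0 < e) (at t0)"
      using near
    proof eventually_elim
      case (elim t)
      have "(LINT z|\<mu>. ?f t z) < e"
        using split[of t \<epsilon>] elim \<epsilon> small' by linarith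
      moreover have "(LINT z|\<mu>. ?f t z) \<ge> 0"
        by (intro integral_nonneg_AE) auto
      ultimately show ?case by simp
    qed
  qed
  then have "((\<lambda>t. (LINT z|\<mu>. ?f t z) powr (1/p)) \<longlongrightarrow> 0 powr (1/p)) (at t0)"
    using p by (intro tendsto_powr' tendsto_const) (auto intro!: always_eventually integral_nonneg_AE)
  then show ?thesis
    by (simp add: bergman_norm_def)
qed

lemma measurable_if_continuous:
  fixes f :: "real \<Rightarrow> complex"
  assumes "\<And>t. t \<in> {0<..<1} \<Longrightarrow> (f \<longlongrightarrow> f t) (at t)"
  shows "f \<in> borel_measurable unit_interval"
proof (rule continuous_imp_measurable_on_sets_lebesgue)
  show "continuous_on {0<..<1} f"
    unfolding continuous_on_def by (intro ballI tendsto_within_subset[OF assms subset_UNIV])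
qed auto

text \<open>Continuity in norm implies continuity of the value at each fixed point, since point
  evaluations are bounded.\<close>

lemma u_measurable:
  assumes z: "z \<in> disk"
  shows "(\<lambda>t. u t z) \<in> borel_measurable unit_interval"
proof (rule measurable_if_continuous)
  fix t0 :: real assume t0: "t0 \<in> {0<..<1}"
  obtain C where C: "C > 0" "\<And>f z'. f \<in> A \<Longrightarrow> z' \<in> cball 0 (cmod z) \<Longrightarrow> cmod (f z') \<le> C * N f"
    using point_evaluation_bounded[of "cmod z"] z by auto
  have "((\<lambda>t. u t z - u t0 z) \<longlongrightarrow> 0) (at t0)"
  proof (rule Lim_null_comparison)
    show "((\<lambda>t. C * N (\<lambda>z. u t z - u t0 z)) \<longlongrightarrow> 0) (at t0)"
      by (rule tendsto_mult_right_zero[OF u_continuous[OF t0]])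
    show "eventually (\<lambda>t. cmod (u t z - u t0 z) \<le> C * N (\<lambda>z. u t z - u t0 z)) (at t0)"
      using eventually_in_unit[OF t0]
    proof eventually_elim
      case (elim t)
      have "(\<lambda>z. u t z - u t0 z) \<in> A"
        using familyD(3) elim t0 by (intro A_diff) auto
      from C(2)[OF this, of z] show ?case by simp
    qed
  qed
  then show "((\<lambda>t. u t z) \<longlongrightarrow> u t0 z) (at t0)"
    by (rule LIM_zero_cancel)
qed

lemma \<phi>_measurable:
  assumes z: "z \<in> disk"
  shows "(\<lambda>t. \<phi> t z) \<in> borel_measurable unit_interval"
proof (rule measurable_if_continuous)
  fix t0 :: real assume t0: "t0 \<in> {0<..<1}"
  show "((\<lambda>t. \<phi> t z) \<longlongrightarrow> \<phi> t0 z) (at t0)"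
  proof (rule tendstoI)
    fix e :: real assume "e > 0"
    from \<phi>_uniform[OF t0 this] show "eventually (\<lambda>t. dist (\<phi> t z) (\<phi> t0 z) < e) (at t0)"
      by eventually_elim (use z in \<open>simp add: dist_norm\<close>)
  qed
qed

lemma continuous_on_cball_A:
  assumes "continuous_on (cball 0 1) h" "h holomorphic_on disk"
  shows "h \<in> A" "\<exists>B>0. \<forall>z\<in>cball 0 1. cmod (h z) \<le> B"
proof -
  have "bounded (h ` cball 0 1)"
    by (intro compact_imp_bounded compact_continuous_image assms) auto
  then show ex: "\<exists>B>0. \<forall>z\<in>cball 0 1. cmod (h z) \<le> B"
    by (auto simp: bounded_pos)
  then obtain B where B: "B > 0" "\<forall>z\<in>cball 0 1. cmod (h z) \<le> B" by blast
  have hm: "h \<in> borel_measurable \<mu>"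
    using assms(2) by (auto intro: holomorphic_on_imp_continuous_on)
  have "h \<in> L"
    by (rule N_mono(1)[OF hm L_const[of "of_real B"]]) (use B in auto)
  then show "h \<in> A"
    using assms(2) by (simp add: A_iff_L)
qed

text \<open>The difference splits into \<open>h (\<phi> t z) * (u t z - u t0 z)\<close> and
  \<open>(h (\<phi> t z) - h (\<phi> t0 z)) * u t0 z\<close>. The first term is small because
  \<open>h\<close> is bounded, the second because \<open>h\<close> is uniformly continuous on the
  compact disk while \<open>\<phi> t\<close> converges uniformly.\<close>

lemma S_continuous:
  assumes h: "continuous_on (cball 0 1) h" "h holomorphic_on disk"
  shows "continuous_A (\<lambda>t. S t h)"
  unfolding continuous_A_def
proof (intro ballI conjI)
  fix t0 :: real assume t0: "t0 \<in> {0<..<1}"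
  have hA: "h \<in> A"
    by (rule continuous_on_cball_A(1)[OF h])
  show "S t0 h \<in> A"
    by (rule S_A[OF t0 hA])
  obtain B where B: "B > 0" "\<And>z. z \<in> cball 0 1 \<Longrightarrow> cmod (h z) \<le> B"
    using continuous_on_cball_A(2)[OF h] by blast
  have uc: "uniformly_continuous_on (cball 0 1) h"
    by (rule compact_uniformly_continuous[OF h(1)]) simp
  have hm: "(\<lambda>z. h (\<phi> t z)) \<in> borel_measurable \<mu>" if t: "t \<in> {0<..<1}" for t
    using familyD(1,2)[OF t] continuous_on_compose2[OF holomorphic_on_imp_continuous_on[OF h(2)] holomorphic_on_imp_continuous_on]
    by auto
  show "((\<lambda>t. N (\<lambda>z. S t h z - S t0 h z)) \<longlongrightarrow> 0) (at t0)"
  proof (rule tendstoI)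
    fix e :: real assume e: "e > 0"
    define n where "n = N (u t0) + 1"
    have n: "n > 0" "N (u t0) < n"
      using bergman_norm_nonneg[of p \<alpha> "u t0"] by (auto simp: n_def intro: add_nonneg_pos)
    define \<eta> where "\<eta> = e / (2 * n)"
    have \<eta>: "\<eta> > 0" using e n by (simp add: \<eta>_def)
    obtain \<delta> where \<delta>: "\<delta> > 0" "\<And>z w. z \<in> cball 0 1 \<Longrightarrow> w \<in> cball 0 1 \<Longrightarrow> dist z w < \<delta> \<Longrightarrow> dist (h z) (h w) < \<eta>"
      using uc \<eta> unfolding uniformly_continuous_on_def by (metis dist_commute)
    have "eventually (\<lambda>t. N (\<lambda>z. u t z - u t0 z) < e / (2 * B)) (at t0)"
      using e B by (intro order_tendstoD(2)[OF u_continuous[OF t0]]) auto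
    with \<phi>_uniform[OF t0 \<delta>(1)] eventually_in_unit[OF t0]
    show "eventually (\<lambda>t. dist (N (\<lambda>z. S t h z - S t0 h z)) 0 < e) (at t0)"
    proof eventually_elim
      case (elim t)
      have in_disk: "\<phi> t z \<in> cball 0 1" "\<phi> t0 z \<in> cball 0 1" if "z \<in> disk" for z
        using familyD(2)[OF elim(2)] familyD(2)[OF t0] that by (auto simp: image_subset_iff less_imp_le)
      have uL: "(\<lambda>z. u t z - u t0 z) \<in> L" "u t0 \<in> L"
        using familyD(3) elim(2) t0 by (auto intro: L_diff A_L)
      let ?d = "\<lambda>z. h (\<phi> t z) - h (\<phi> t0 z)"
      have dm: "?d \<in> borel_measurable \<mu>"
        using hm[OF elim(2)] hm[OF t0] by measurable
      have 1: "(\<lambda>z. h (\<phi> t z) * (u t z - u t0 z)) \<in> L" "N (\<lambda>z. h (\<phi> t z) * (u t z - u t0 z)) \<le> B * N (\<lambda>z. u t z - u t0 z)"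
        using L_bounded_mult[OF uL(1) hm[OF elim(2)] less_imp_le[OF B(1)] B(2)[OF in_disk(1)]] by blast+
      have d_le: "cmod (?d z) \<le> \<eta>" if "z \<in> disk" for z
        using \<delta>(2)[OF in_disk[OF that]] elim(1) that by (simp add: dist_norm less_imp_le)
      have 2: "(\<lambda>z. ?d z * u t0 z) \<in> L" "N (\<lambda>z. ?d z * u t0 z) \<le> \<eta> * N (u t0)"
        using L_bounded_mult[OF uL(2) dm less_imp_le[OF \<eta>] d_le] by blast+
      have "N (\<lambda>z. S t h z - S t0 h z) = N (\<lambda>z. h (\<phi> t z) * (u t z - u t0 z) + ?d z * u t0 z)"
        by (simp add: weighted_comp_def algebra_simps)
      also have "\<dots> \<le> B * N (\<lambda>z. u t z - u t0 z) + \<eta> * N (u t0)"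
        using N_triangle[OF 1(1) 2(1)] 1(2) 2(2) by linarith
      also have "B * N (\<lambda>z. u t z - u t0 z) < B * (e / (2 * B))"
        using elim(3) B by (intro mult_strict_left_mono) auto
      also have "\<eta> * N (u t0) \<le> \<eta> * n"
        using \<eta> n by (intro mult_left_mono) auto
      also have "B * (e / (2 * B)) + \<eta> * n = e"
        using B n by (simp add: \<eta>_def)
      finally show ?case by simp
    qed
  qed
qed

text \<open>The error for \<open>h n\<close> is at most \<open>opn t\<close> times a null sequence,
  and \<open>opn\<close> is integrable. Both measurability and approximation in the mean therefore
  pass from the functions \<open>h n\<close> to \<open>f\<close>.\<close>

lemma S_approximable:
  assumes f: "f \<in> A" and h: "\<And>n::nat. continuous_on (cball 0 1) (h n)" "\<And>n. h n holomorphic_on disk"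
    and lim: "(\<lambda>n. N (\<lambda>z. f z - h n z)) \<longlonglongrightarrow> 0"
  shows "approximable (\<lambda>t. S t f)"
    and "\<And>g. g \<in> A \<Longrightarrow> (\<lambda>t. N (\<lambda>z. S t f z - g z)) \<in> borel_measurable unit_interval"
proof -
  have hA: "h n \<in> A" for n
    by (rule continuous_on_cball_A(1)[OF h])
  \<comment> \<open>Stated for arbitrary functions because it is applied a second time, to
    \<open>f - h n\<close> with the approximants \<open>h m - h n\<close>, in order to show that the
    error is measurable in \<open>t\<close>.\<close>
  have meas: "(\<lambda>t. N (\<lambda>z. S t f z - g z)) \<in> borel_measurable unit_interval"
    if f: "f \<in> A" and h: "\<And>n::nat. continuous_on (cball 0 1) (h n)" "\<And>n. h n holomorphic_on disk"
    and lim: "(\<lambda>n. N (\<lambda>z. f z - h n z)) \<longlonglongrightarrow> 0" and g: "g \<in> A" for f h g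
  proof (rule borel_measurable_LIMSEQ_metric)
    have hA: "h n \<in> A" for n
      by (rule continuous_on_cball_A(1)[OF h])
    show "(\<lambda>t. N (\<lambda>z. S t (h n) z - g z)) \<in> borel_measurable unit_interval" for n
      by (rule continuous_A_measurable[OF S_continuous[OF h] g])
    fix t :: real assume "t \<in> space unit_interval"
    then have t: "t \<in> {0<..<1}" by simp
    have "(\<lambda>n. N (\<lambda>z. S t (h n) z - g z) - N (\<lambda>z. S t f z - g z)) \<longlonglongrightarrow> 0"
    proof (rule Lim_null_comparison)
      show "(\<lambda>n. opn t * N (\<lambda>z. f z - h n z)) \<longlonglongrightarrow> 0"
        by (rule tendsto_mult_right_zero[OF lim])
      show "eventually (\<lambda>n. norm (N (\<lambda>z. S t (h n) z - g z) - N (\<lambda>z. S t f z - g z)) \<le> opn t * N (\<lambda>z. f z - h n z)) sequentially"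
      proof (intro always_eventually allI)
        fix n
        have "\<bar>N (\<lambda>z. S t (h n) z - g z) - N (\<lambda>z. S t f z - g z)\<bar> \<le> N (\<lambda>z. (S t (h n) z - g z) - (S t f z - g z))"
          by (intro N_abs_diff L_diff A_L S_A t hA f g)
        also have "\<dots> = N (\<lambda>z. S t (h n) z - S t f z)"
          by simp
        also have "\<dots> \<le> opn t * N (\<lambda>z. h n z - f z)"
          unfolding S_diff by (intro norm_S_le t A_diff hA f)
        finally show "norm (N (\<lambda>z. S t (h n) z - g z) - N (\<lambda>z. S t f z - g z)) \<le> opn t * N (\<lambda>z. f z - h n z)"
          by (simp add: N_minus_commute[of f])
      qed
    qed
    then show "(\<lambda>n. N (\<lambda>z. S t (h n) z - g z)) \<longlonglongrightarrow> N (\<lambda>z. S t f z - g z)"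
      by (rule LIM_zero_cancel)
  qed
  show m: "(\<lambda>t. N (\<lambda>z. S t f z - g z)) \<in> borel_measurable unit_interval" if "g \<in> A" for g
    by (rule meas[OF f h lim that])
  have int_b: "integrable unit_interval (\<lambda>t. opn t * N (\<lambda>z. f z - h n z))" for n
    using opn_integrable by simp
  have le: "N (\<lambda>z. S t f z - S t (h n) z) \<le> opn t * N (\<lambda>z. f z - h n z)" if "t \<in> {0<..<1}" for t n
    unfolding S_diff by (intro norm_S_le that A_diff hA f)
  have int: "integrable unit_interval (\<lambda>t. N (\<lambda>z. S t f z - S t (h n) z))" for n
  proof (rule Bochner_Integration.integrable_bound[OF int_b[of n]])
    have "(\<lambda>t. N (\<lambda>z. S t (\<lambda>z. f z - h n z) z - 0)) \<in> borel_measurable unit_interval"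
    proof (rule meas[where h = "\<lambda>m z. h m z - h n z"])
      have "N (\<lambda>z. (f z - h n z) - (h m z - h n z)) = N (\<lambda>z. f z - h m z)" for m
        by simp
      then show "(\<lambda>m. N (\<lambda>z. (f z - h n z) - (h m z - h n z))) \<longlonglongrightarrow> 0"
        using lim by simp
    qed (intro A_diff f hA continuous_intros holomorphic_intros h A_zero)+
    then show "(\<lambda>t. N (\<lambda>z. S t f z - S t (h n) z)) \<in> borel_measurable unit_interval"
      by (simp add: S_diff)
    show "AE t in unit_interval. norm (N (\<lambda>z. S t f z - S t (h n) z)) \<le> norm (opn t * N (\<lambda>z. f z - h n z))"
      using order_trans[OF le abs_ge_self] by (intro AE_I2) simp
  qed
  show "approximable (\<lambda>t. S t f)"
  proof (rule approximable_limit)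
    show "approximable (\<lambda>t. S t (h n))" for n
    proof (rule continuous_A_approximable[OF S_continuous[OF h]])
      show "integrable unit_interval (\<lambda>t. opn t * N (h n))"
        using opn_integrable by simp
    qed (intro norm_S_le hA)
    show "(\<lambda>n. LINT t|unit_interval. N (\<lambda>z. S t f z - S t (h n) z)) \<longlonglongrightarrow> 0"
    proof (rule Lim_null_comparison)
      show "(\<lambda>n. (LINT t|unit_interval. opn t) * N (\<lambda>z. f z - h n z)) \<longlonglongrightarrow> 0"
        by (rule tendsto_mult_right_zero[OF lim])
      have "(LINT t|unit_interval. N (\<lambda>z. S t f z - S t (h n) z)) \<le> (LINT t|unit_interval. opn t * N (\<lambda>z. f z - h n z))" for n
        using le by (intro integral_mono int int_b) auto
      then show "eventually (\<lambda>n. norm (LINT t|unit_interval. N (\<lambda>z. S t f z - S t (h n) z)) \<le> (LINT t|unit_interval. opn t) * N (\<lambda>z. f z - h n z)) sequentially"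
        by (intro always_eventually allI) simp
    qed
  qed (use S_A f m int in auto)
qed

end

section \<open>The limits along the test functions\<close>

text \<open>The pole is moved out of the closed disk to \<open>1 + \<delta>\<close>. This increases
  the distance from every point of the disk, so the shifted kernel stays below the original one in
  modulus, and dominated convergence can take \<delta> to zero.\<close>

definition shifted_kernel :: "real \<Rightarrow> real \<Rightarrow> complex \<Rightarrow> complex" where
  "shifted_kernel \<delta> c z = (of_real (1 + \<delta>) - z) powr (- of_real c)"

lemma shifted_kernel_cball:
  assumes \<delta>: "\<delta> > 0"
  shows "continuous_on (cball 0 1) (shifted_kernel \<delta> c)" "shifted_kernel \<delta> c holomorphic_on disk"
proof -
  have nr: "of_real (1 + \<delta>) - z \<notin> \<real>\<^sub>\<le>\<^sub>0" if "Re z < 1 + \<delta>" for z :: complex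
    using that by (auto simp: complex_nonpos_Reals_iff)
  have hol: "shifted_kernel \<delta> c holomorphic_on {z. Re z < 1 + \<delta>}"
    unfolding shifted_kernel_def by (intro holomorphic_intros nr) simp
  have sub: "cball 0 1 \<subseteq> {z. Re z < 1 + \<delta>}"
    using \<delta> complex_Re_le_cmod by (force intro: order_le_less_trans)
  then show "continuous_on (cball 0 1) (shifted_kernel \<delta> c)"
    by (rule continuous_on_subset[OF holomorphic_on_imp_continuous_on[OF hol]])
  have "disk \<subseteq> {z. Re z < 1 + \<delta>}"
    using sub by force
  then show "shifted_kernel \<delta> c holomorphic_on disk"
    by (rule holomorphic_on_subset[OF hol])
qed

lemma cmod_shifted_kernel_le:
  assumes z: "z \<in> disk" and \<delta>: "\<delta> > 0" and c: "c \<ge> 0"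
  shows "cmod (shifted_kernel \<delta> c z) \<le> cmod (cauchy_kernel c z)"
proof -
  have Re: "Re (1 - z) > 0"
    by (rule Re_one_minus_disk[OF z])
  have "(cmod (1 - z))\<^sup>2 \<le> (cmod (of_real (1 + \<delta>) - z))\<^sup>2"
    unfolding cmod_power2 using Re \<delta> by (auto intro!: power_mono)
  then have le: "cmod (1 - z) \<le> cmod (of_real (1 + \<delta>) - z)"
    by simp
  have nz: "0 < cmod (1 - z)"
    using Re by auto
  have "cmod (of_real (1 + \<delta>) - z) powr (- c) \<le> cmod (1 - z) powr (- c)"
    using nz le c by (intro powr_mono2') auto
  moreover have "cmod (shifted_kernel \<delta> c z) = cmod (of_real (1 + \<delta>) - z) powr (- c)"
    unfolding shifted_kernel_def using nz le by (intro cmod_powr_of_real) auto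
  ultimately show ?thesis
    using cmod_cauchy_kernel[OF one_notin_disk(1)[OF z], of c] by linarith
qed

lemma shifted_kernel_tendsto:
  assumes z: "z \<in> disk"
  shows "(\<lambda>n. shifted_kernel (inverse (real (Suc n))) c z) \<longlonglongrightarrow> cauchy_kernel c z"
proof -
  have nr: "of_real (1 + 0) - z \<notin> \<real>\<^sub>\<le>\<^sub>0"
    using Re_one_minus_disk[OF z] by (auto simp: complex_nonpos_Reals_iff)
  have "(\<lambda>n. (of_real (1 + inverse (real (Suc n))) - z) powr (- of_real c)) \<longlonglongrightarrow> (of_real (1 + 0) - z) powr (- of_real c)"
    by (intro tendsto_powr_complex tendsto_intros LIMSEQ_inverse_real_of_nat nr)
  then show ?thesis
    by (simp add: shifted_kernel_def cauchy_kernel_def)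
qed

context bergman
begin

lemma kernel_combination_approx:
  assumes c: "\<alpha> / p < c" "c < crit"
  obtains h :: "nat \<Rightarrow> complex \<Rightarrow> complex" where
    "\<And>n. continuous_on (cball 0 1) (h n)" "\<And>n. h n holomorphic_on disk"
    "(\<lambda>n. N (\<lambda>z. (a * cauchy_kernel c z + b * cauchy_kernel c (- z)) - h n z)) \<longlonglongrightarrow> 0"
proof
  let ?k = "\<lambda>n. shifted_kernel (inverse (real (Suc n))) c"
  let ?h = "\<lambda>n z. a * ?k n z + b * ?k n (- z)"
  have c0: "c \<ge> 0"
    using c crit_pos(3) by linarith
  have \<delta>: "inverse (real (Suc n)) > 0" for n
    by simp
  have k: "continuous_on (cball 0 1) (?k n)" "?k n holomorphic_on disk" for n
    using shifted_kernel_cball[OF \<delta>] by auto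
  have k': "continuous_on (cball 0 1) (\<lambda>z. ?k n (- z))" "(\<lambda>z. ?k n (- z)) holomorphic_on disk" for n
  proof -
    have "uminus ` cball 0 1 \<subseteq> cball (0::complex) 1" "uminus ` disk \<subseteq> disk"
      by auto
    then show "continuous_on (cball 0 1) (\<lambda>z. ?k n (- z))" "(\<lambda>z. ?k n (- z)) holomorphic_on disk"
      using continuous_on_compose2[OF k(1) continuous_on_minus[OF continuous_on_id]]
        holomorphic_on_compose_gen[OF holomorphic_on_minus[OF holomorphic_on_ident] k(2)]
      unfolding o_def by blast+
  qed
  show h: "continuous_on (cball 0 1) (?h n)" "?h n holomorphic_on disk" for n
    by (intro continuous_intros holomorphic_intros k k')+
  have K: "cauchy_kernel c \<in> L" "(\<lambda>z. cauchy_kernel c (- z)) \<in> L"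
    using c by (auto intro!: A_L cauchy_kernel_A cauchy_kernel_reflect_A)
  let ?g = "\<lambda>z. complex_of_real (cmod (2 * (a * cauchy_kernel c z))) + complex_of_real (cmod (2 * (b * cauchy_kernel c (- z))))"
  show "(\<lambda>n. N (\<lambda>z. (a * cauchy_kernel c z + b * cauchy_kernel c (- z)) - ?h n z)) \<longlonglongrightarrow> 0"
  proof (rule N_tendsto_0_dominated)
    have abs: "(\<lambda>z. complex_of_real (cmod (f z))) \<in> L" if "f \<in> L" for f
      using LpD(1)[OF that] by (intro N_mono(1)[OF _ that]) auto
    show "?g \<in> L"
      by (intro L_add abs L_cmult K)
    have "?h n \<in> borel_measurable \<mu>" for n
      using h(2) by (intro measurable_dA_of_continuous holomorphic_on_imp_continuous_on)
    then show "(\<lambda>z. (a * cauchy_kernel c z + b * cauchy_kernel c (- z)) - ?h n z) \<in> borel_measurable \<mu>" for n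
      using cauchy_kernel_measurable[of c] by measurable
    fix z :: complex assume z: "z \<in> disk"
    then have z': "- z \<in> disk" by simp
    show "cmod ((a * cauchy_kernel c z + b * cauchy_kernel c (- z)) - ?h n z) \<le> cmod (?g z)" for n
    proof -
      have 1: "cmod (a * (cauchy_kernel c w - ?k n w)) \<le> cmod (2 * (a * cauchy_kernel c w))" if "w \<in> disk" for a w
      proof -
        have "cmod (cauchy_kernel c w - ?k n w) \<le> 2 * cmod (cauchy_kernel c w)"
          using norm_triangle_ineq4[of "cauchy_kernel c w" "?k n w"] cmod_shifted_kernel_le[OF that \<delta> c0, of n] by linarith
        from mult_left_mono[OF this norm_ge_zero[of a]] show ?thesis
          by (simp add: norm_mult mult.left_commute)
      qed
      have "(a * cauchy_kernel c z + b * cauchy_kernel c (- z)) - ?h n z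
          = a * (cauchy_kernel c z - ?k n z) + b * (cauchy_kernel c (- z) - ?k n (- z))"
        by (simp add: algebra_simps)
      also have "cmod \<dots> \<le> cmod (2 * (a * cauchy_kernel c z)) + cmod (2 * (b * cauchy_kernel c (- z)))"
        by (intro norm_triangle_le add_mono 1 z z')
      also have "\<dots> = cmod (?g z)"
        by (subst of_real_add[symmetric], subst norm_of_real) simp
      finally show ?thesis .
    qed
    have "(\<lambda>n. (a * cauchy_kernel c z + b * cauchy_kernel c (- z)) - ?h n z)
        \<longlonglongrightarrow> (a * cauchy_kernel c z + b * cauchy_kernel c (- z)) - (a * cauchy_kernel c z + b * cauchy_kernel c (- z))"
      by (intro tendsto_intros shifted_kernel_tendsto z z')
    then show "(\<lambda>n. (a * cauchy_kernel c z + b * cauchy_kernel c (- z)) - ?h n z) \<longlonglongrightarrow> 0"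
      by simp
  qed
qed

end

section \<open>Boundary data of the family\<close>

context weighted_family
begin

lemma u_bval:
  assumes "t \<in> {0<..<1}" "\<xi> = 1 \<or> \<xi> = -1"
  shows "(u t \<longlongrightarrow> bval (u t) \<xi>) (at \<xi> within disk)"
  using assms directions by (intro extends_near_pm1_tendsto) (auto simp: has_directions_pm1_def)

text \<open>For a self-map of the disk the angular derivative at a fixed boundary point is real and
  nonnegative; the lower bound (iv) of condition W excludes zero.\<close>

lemma \<phi>_boundary:
  assumes t: "t \<in> {0<..<1}" and \<xi>: "\<xi> = 1 \<or> \<xi> = -1"
  shows "((\<lambda>z. (\<xi> - \<phi> t z) / (\<xi> - z)) \<longlongrightarrow> bval (deriv (\<phi> t)) \<xi>) (at \<xi> within disk)"
    and "\<exists>d>0. bval (deriv (\<phi> t)) \<xi> = of_real d"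
proof -
  let ?D = "bval (deriv (\<phi> t)) \<xi>"
  have \<xi>1: "cmod \<xi> = 1" using \<xi> by auto
  have D: "(deriv (\<phi> t) \<longlongrightarrow> ?D) (at \<xi> within disk)"
    using t directions \<xi> by (intro extends_near_pm1_tendsto) (auto simp: has_directions_pm1_def)
  have "(\<phi> t \<longlongrightarrow> \<xi>) (at \<xi> within disk)"
    using t directions \<xi> by (auto simp: has_directions_pm1_def)
  from difference_quotient_tendsto[OF familyD(1)[OF t] \<xi>1 D this]
  show lim: "((\<lambda>z. (\<xi> - \<phi> t z) / (\<xi> - z)) \<longlongrightarrow> ?D) (at \<xi> within disk)" .
  note D0 = angular_derivative_nonneg[OF familyD(2)[OF t] \<xi>1 lim]
  obtain \<epsilon> where \<epsilon>: "\<epsilon> > 0" and gt: "(INF t'\<in>{0<..<1} \<inter> ball t \<epsilon>. INF z\<in>U \<epsilon> \<inter> disk. ereal (cmod (deriv (\<phi> t') z))) > 0" (is "?I > 0")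
    using cond_W t unfolding condition_W_def by blast
  obtain m where m: "0 < ereal m" "ereal m < ?I"
    using ereal_dense2[OF gt] by auto
  have "ereal m \<le> ereal (cmod (deriv (\<phi> t) z))" if "z \<in> disk" "z \<in> U \<epsilon>" for z
    using that t \<epsilon> by (intro order_trans[OF less_imp_le[OF m(2)]] INF_lower2[of t] INF_lower) auto
  then have ge: "m \<le> cmod (deriv (\<phi> t) z)" if "z \<in> disk" "z \<in> U \<epsilon>" for z
    using that by simp
  have "eventually (\<lambda>z. z \<in> U \<epsilon>) (at \<xi> within disk)"
    using \<xi> \<epsilon> by (intro topological_tendstoD[OF tendsto_ident_at]) (auto simp: U_def)
  then have "eventually (\<lambda>z. m \<le> cmod (deriv (\<phi> t) z)) (at \<xi> within disk)"
    using ge by (auto simp: eventually_at_filter elim!: eventually_mono)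
  then have "m \<le> cmod ?D"
    by (rule tendsto_lowerbound[OF tendsto_norm[OF D] _ at_within_disk_neq_bot[OF \<xi>1]])
  then have "?D \<noteq> 0" using m(1) by auto
  moreover have "?D = of_real (Re ?D)"
    using D0 by (simp add: complex_eq_iff)
  ultimately show "\<exists>d>0. ?D = of_real d"
    using D0(2) by (metis less_eq_real_def of_real_0)
qed

text \<open>Property (c) of the directions controls points outside a set
  \<open>U \<epsilon>'\<close>. The part of that set around the opposite point
  \<open>- \<xi>\<close> escapes it, but it is mapped within distance 1 of \<open>- \<xi>\<close>,
  which is itself at distance 2 from \<open>\<xi>\<close>.\<close>

lemma \<phi>_away:
  assumes t: "t \<in> {0<..<1}" and \<xi>: "\<xi> = 1 \<or> \<xi> = -1" and \<epsilon>: "\<epsilon> > 0"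
  shows "\<exists>\<delta>>0. \<forall>z\<in>disk - ball \<xi> \<epsilon>. \<delta> \<le> cmod (\<xi> - \<phi> t z)"
proof -
  have "(\<phi> t \<longlongrightarrow> - \<xi>) (at (- \<xi>) within disk)"
    using t directions \<xi> by (auto simp: has_directions_pm1_def)
  then have "eventually (\<lambda>z. dist (\<phi> t z) (- \<xi>) < 1) (at (- \<xi>) within disk)"
    by (rule tendstoD) simp
  then obtain \<epsilon>1 where \<epsilon>1: "\<epsilon>1 > 0" "\<And>z. z \<in> disk \<Longrightarrow> z \<noteq> - \<xi> \<Longrightarrow> dist z (- \<xi>) < \<epsilon>1 \<Longrightarrow> dist (\<phi> t z) (- \<xi>) < 1"
    unfolding eventually_at by blast
  \<comment> \<open>Since \<epsilon>' is at most \<epsilon>, a point of \<open>U \<epsilon>'\<close>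
    outside \<open>ball \<xi> \<epsilon>\<close> has to be near \<open>- \<xi>\<close>.\<close>
  define \<epsilon>' where "\<epsilon>' = min \<epsilon> \<epsilon>1"
  have \<epsilon>': "\<epsilon>' > 0" using \<epsilon> \<epsilon>1 by (simp add: \<epsilon>'_def)
  have "closure (\<phi> t ` (disk - U \<epsilon>')) \<inter> sphere 0 1 = {}"
    using t directions \<epsilon>' by (auto simp: has_directions_pm1_def)
  moreover have "\<xi> \<in> sphere 0 1" using \<xi> by auto
  ultimately have "\<xi> \<notin> closure (\<phi> t ` (disk - U \<epsilon>'))" by blast
  then obtain \<delta> where \<delta>: "\<delta> > 0" "\<And>z. z \<in> disk - U \<epsilon>' \<Longrightarrow> \<delta> \<le> dist (\<phi> t z) \<xi>"
    unfolding closure_approachable by (auto simp: not_less)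
  have "min \<delta> 1 \<le> cmod (\<xi> - \<phi> t z)" if z: "z \<in> disk - ball \<xi> \<epsilon>" for z
  proof (cases "z \<in> U \<epsilon>'")
    case True
    then have "dist z (- \<xi>) < \<epsilon>1"
      using z \<xi> by (auto simp: U_def \<epsilon>'_def dist_commute)
    moreover have "z \<noteq> - \<xi>" using z \<xi> by auto
    ultimately have "cmod (\<phi> t z + \<xi>) < 1"
      using \<epsilon>1(2)[of z] z by (simp add: dist_norm)
    moreover have "cmod (2 * \<xi>) \<le> cmod (\<xi> - \<phi> t z) + cmod (\<phi> t z + \<xi>)"
      using norm_triangle_ineq[of "\<xi> - \<phi> t z" "\<phi> t z + \<xi>"] by (simp add: algebra_simps)
    moreover have "cmod (2 * \<xi>) = 2" using \<xi> by auto
    ultimately show ?thesis by linarith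
  next
    case False
    then show ?thesis
      using \<delta>(2)[of z] z by (simp add: dist_norm norm_minus_commute)
  qed
  then show ?thesis
    using \<delta>(1) by (intro exI[of _ "min \<delta> 1"]) auto
qed

lemma S_kernel_asymp:
  assumes t: "t \<in> {0<..<1}"
  defines "v \<equiv> bval (u t) 1 * of_real (Re (bval (deriv (\<phi> t)) 1) powr (- crit))"
    and "w \<equiv> bval (u t) (-1) * of_real (Re (bval (deriv (\<phi> t)) (-1)) powr (- crit))"
  shows "((\<lambda>c. N (\<lambda>z. u t z * cauchy_kernel c (\<phi> t z) - v * cauchy_kernel c z) / N (cauchy_kernel c)) \<longlongrightarrow> 0) (at_left crit)"
    and "((\<lambda>c. N (\<lambda>z. u t z * cauchy_kernel c (- \<phi> t z) - w * cauchy_kernel c (- z)) / N (cauchy_kernel c)) \<longlongrightarrow> 0) (at_left crit)"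
proof -
  have uL: "u t \<in> L" and \<phi>c: "continuous_on disk (\<phi> t)"
    using familyD[OF t] by (auto intro: A_L holomorphic_on_imp_continuous_on)
  obtain d where d: "d > 0" "bval (deriv (\<phi> t)) 1 = of_real d"
    using \<phi>_boundary(2)[OF t, of 1] by blast
  obtain d' where d': "d' > 0" "bval (deriv (\<phi> t)) (-1) = of_real d'"
    using \<phi>_boundary(2)[OF t, of "-1"] by blast
  show "((\<lambda>c. N (\<lambda>z. u t z * cauchy_kernel c (\<phi> t z) - v * cauchy_kernel c z) / N (cauchy_kernel c)) \<longlongrightarrow> 0) (at_left crit)"
    unfolding v_def d(2) Re_complex_of_real
  proof (rule weighted_comp_kernel_asymp[OF uL u_bval[OF t] \<phi>c familyD(2)[OF t] _ d(1)])
    show "((\<lambda>z. (1 - \<phi> t z) / (1 - z)) \<longlongrightarrow> of_real d) (at 1 within disk)"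
      using \<phi>_boundary(1)[OF t, of 1] d(2) by simp
  qed (use \<phi>_away[OF t, of 1] in auto)
  have neg: "- 1 - a = - (1 + a)" for a :: complex
    by simp
  have flip: "(1 + a) / (1 + b) = (- 1 - a) / (- 1 - b)" for a b :: complex
    unfolding neg by (simp only: minus_divide_divide)
  have flip': "cmod (1 + a) = cmod (- 1 - a)" for a
    unfolding neg by (simp only: norm_minus_cancel)
  show "((\<lambda>c. N (\<lambda>z. u t z * cauchy_kernel c (- \<phi> t z) - w * cauchy_kernel c (- z)) / N (cauchy_kernel c)) \<longlongrightarrow> 0) (at_left crit)"
    unfolding w_def d'(2) Re_complex_of_real
  proof (rule weighted_comp_kernel_asymp_reflect[OF uL u_bval[OF t] \<phi>c familyD(2)[OF t] _ d'(1)])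
    show "((\<lambda>z. (1 + \<phi> t z) / (1 + z)) \<longlongrightarrow> of_real d') (at (-1) within disk)"
      using \<phi>_boundary(1)[OF t, of "-1"] d'(2) unfolding flip by simp
    show "\<exists>\<delta>>0. \<forall>z\<in>disk - ball (-1) \<epsilon>. \<delta> \<le> cmod (1 + \<phi> t z)" if "\<epsilon> > 0" for \<epsilon>
      using \<phi>_away[OF t _ that, of "-1"] unfolding flip' by simp
  qed simp
qed

text \<open>Boundary values are limits along a sequence on the radius towards \<open>\<xi>\<close>.
  For the derivative the limit of difference quotients is taken, so that measurability in
  \<open>t\<close> is required of the values of \<phi> only.\<close>

lemma bval_measurable:
  assumes \<xi>: "\<xi> = 1 \<or> \<xi> = -1"
  shows "(\<lambda>t. bval (u t) \<xi>) \<in> borel_measurable unit_interval"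
    and "(\<lambda>t. bval (deriv (\<phi> t)) \<xi>) \<in> borel_measurable unit_interval"
proof -
  define x where "x n = \<xi> * of_real (1 - inverse (real (Suc n)))" for n
  have \<xi>1: "cmod \<xi> = 1" using \<xi> by auto
  have x_disk: "x n \<in> disk" for n
  proof -
    have "inverse (real (Suc n)) > 0" "inverse (real (Suc n)) \<le> 1"
      by (auto simp: inverse_eq_divide)
    then have "\<bar>1 - inverse (real (Suc n))\<bar> < 1"
      by linarith
    then show ?thesis
      using \<xi>1 by (simp only: x_def norm_mult norm_of_real mem_ball_0) simp
  qed
  have "x \<longlonglongrightarrow> \<xi> * of_real (1 - 0)"
    unfolding x_def by (intro tendsto_intros LIMSEQ_inverse_real_of_nat)
  moreover have "x n \<noteq> \<xi>" for n
    using x_disk[of n] \<xi>1 by auto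
  ultimately have lim: "filterlim x (at \<xi> within disk) sequentially"
    unfolding filterlim_at using x_disk by simp
  show "(\<lambda>t. bval (u t) \<xi>) \<in> borel_measurable unit_interval"
  proof (rule borel_measurable_LIMSEQ_metric[OF u_measurable[OF x_disk]])
    fix t assume "t \<in> space unit_interval"
    then show "(\<lambda>n. u t (x n)) \<longlonglongrightarrow> bval (u t) \<xi>"
      using filterlim_compose[OF u_bval[OF _ \<xi>] lim] by simp
  qed
  show "(\<lambda>t. bval (deriv (\<phi> t)) \<xi>) \<in> borel_measurable unit_interval"
  proof (rule borel_measurable_LIMSEQ_metric)
    show "(\<lambda>t. (\<xi> - \<phi> t (x n)) / (\<xi> - x n)) \<in> borel_measurable unit_interval" for n
      using \<phi>_measurable[OF x_disk] by measurable
    fix t assume "t \<in> space unit_interval"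
    then show "(\<lambda>n. (\<xi> - \<phi> t (x n)) / (\<xi> - x n)) \<longlonglongrightarrow> bval (deriv (\<phi> t)) \<xi>"
      using filterlim_compose[OF \<phi>_boundary(1)[OF _ \<xi>] lim] by simp
  qed
qed

end

section \<open>Normalised kernels and limiting coefficients\<close>

locale weighted_family_theta = weighted_family +
  fixes \<theta> :: real
  assumes theta: "\<theta> \<in> {0..1}"
begin

text \<open>The limit of \<open>gN c / N (cauchy_kernel c)\<close>, and the p-th root of the
  denominator that \<open>Theta_pos\<close> and \<open>Theta_neg\<close> share.\<close>

definition \<kappa> :: real where "\<kappa> = lp2 (of_real \<theta>) (of_real (1 - \<theta>))"

abbreviation "gN c \<equiv> N (g_hat c \<theta>)"
abbreviation "g c \<equiv> g_test p \<alpha> c \<theta>"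
abbreviation "Tp t \<equiv> Theta_pos p \<alpha> \<theta> (u t) (\<phi> t)"
abbreviation "Tn t \<equiv> Theta_neg p \<alpha> \<theta> (u t) (\<phi> t)"

text \<open>Scaled by \<open>\<kappa> / gN c\<close> rather than by the reciprocal of the kernel
  norm: the test function is then exactly \<open>\<theta> / \<kappa>\<close> times
  \<open>E1 c\<close> plus \<open>(1 - \<theta>) / \<kappa>\<close> times \<open>E2 c\<close>, and
  the norms still tend to one.\<close>

definition E1 :: "real \<Rightarrow> complex \<Rightarrow> complex" where
  "E1 c z = of_real (\<kappa> / gN c) * cauchy_kernel c z"

definition E2 :: "real \<Rightarrow> complex \<Rightarrow> complex" where
  "E2 c z = of_real (\<kappa> / gN c) * cauchy_kernel c (- z)"

abbreviation V :: "real \<Rightarrow> real \<Rightarrow> complex \<Rightarrow> complex" where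
  "V c t \<equiv> \<lambda>z. Tp t * E1 c z + Tn t * E2 c z"

lemma \<kappa>_pos: "\<kappa> > 0"
  using lp2_nonneg[of "of_real \<theta>" "of_real (1 - \<theta>)"] lp2_eq_0_iff[of "of_real \<theta>" "of_real (1 - \<theta>)"]
  unfolding \<kappa>_def by (cases "\<theta> = 0") (auto simp: less_le)

lemma \<kappa>_eq: "\<kappa> = (\<theta> powr p + (1 - \<theta>) powr p) powr (1 / p)"
  using theta unfolding \<kappa>_def lp2_def norm_of_real by simp

text \<open>The leading factor of \<open>Theta_pos\<close> equals
  \<open>\<theta> / \<kappa>\<close>, the coefficient of \<open>E1\<close> in the test function. The
  boundary derivative is a positive real, so \<open>Re\<close> turns the complex power into a real
  one, which is also the form suited to measurability.\<close>

lemma Theta_eq: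
  assumes t: "t \<in> {0<..<1}"
  shows "Tp t = of_real (\<theta> / \<kappa>) * (bval (u t) 1 * of_real (Re (bval (deriv (\<phi> t)) 1) powr (- crit)))"
    and "Tn t = of_real ((1 - \<theta>) / \<kappa>) * (bval (u t) (-1) * of_real (Re (bval (deriv (\<phi> t)) (-1)) powr (- crit)))"
proof -
  obtain d where d: "d > 0" "bval (deriv (\<phi> t)) 1 = of_real d"
    using \<phi>_boundary(2)[OF t, of 1] by blast
  obtain d' where d': "d' > 0" "bval (deriv (\<phi> t)) (-1) = of_real d'"
    using \<phi>_boundary(2)[OF t, of "-1"] by blast
  have root: "(x powr p / (\<theta> powr p + (1 - \<theta>) powr p)) powr (1 / p) = x / \<kappa>" if "x \<ge> 0" for x
    using that p by (simp add: \<kappa>_eq powr_divide powr_powr)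
  have pw: "complex_of_real d powr of_real ((2 + \<alpha>) / p) = of_real (d powr crit)" if "d > 0" for d
    using that powr_of_real[of d "(2 + \<alpha>) / p"] by (simp add: crit_def)
  show "Tp t = of_real (\<theta> / \<kappa>) * (bval (u t) 1 * of_real (Re (bval (deriv (\<phi> t)) 1) powr (- crit)))"
    using theta unfolding Theta_pos_def d(2) pw[OF d(1)] Re_complex_of_real
    by (subst root) (auto simp: powr_minus divide_inverse)
  show "Tn t = of_real ((1 - \<theta>) / \<kappa>) * (bval (u t) (-1) * of_real (Re (bval (deriv (\<phi> t)) (-1)) powr (- crit)))"
    using theta unfolding Theta_neg_def d'(2) pw[OF d'(1)] Re_complex_of_real
    by (subst root) (auto simp: powr_minus divide_inverse)
qed

lemma Theta_measurable:
  "Tp \<in> borel_measurable unit_interval" "Tn \<in> borel_measurable unit_interval"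
proof -
  have [measurable]: "(\<lambda>t. bval (u t) 1) \<in> borel_measurable unit_interval"
    "(\<lambda>t. bval (deriv (\<phi> t)) 1) \<in> borel_measurable unit_interval"
    "(\<lambda>t. bval (u t) (-1)) \<in> borel_measurable unit_interval"
    "(\<lambda>t. bval (deriv (\<phi> t)) (-1)) \<in> borel_measurable unit_interval"
    using bval_measurable by blast+
  have "(\<lambda>t. of_real (\<theta> / \<kappa>) * (bval (u t) 1 * of_real (Re (bval (deriv (\<phi> t)) 1) powr (- crit)))) \<in> borel_measurable unit_interval"
    by measurable
  then show "Tp \<in> borel_measurable unit_interval"
    using Theta_eq(1) by (subst measurable_cong) auto
  have "(\<lambda>t. of_real ((1 - \<theta>) / \<kappa>) * (bval (u t) (-1) * of_real (Re (bval (deriv (\<phi> t)) (-1)) powr (- crit)))) \<in> borel_measurable unit_interval"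
    by measurable
  then show "Tn \<in> borel_measurable unit_interval"
    using Theta_eq(2) by (subst measurable_cong) auto
qed

lemma g_hat_fun: "g_hat c \<theta> = (\<lambda>z. of_real \<theta> * cauchy_kernel c z + of_real (1 - \<theta>) * cauchy_kernel c (- z))"
  by (rule ext) (rule g_hat_eq)

lemma gN_ratio: "((\<lambda>c. gN c / N (cauchy_kernel c)) \<longlongrightarrow> \<kappa>) (at_left crit)"
  unfolding g_hat_fun \<kappa>_def by (rule norm_kernel_combination)

lemma gN_ratio': "((\<lambda>c. N (cauchy_kernel c) / gN c) \<longlongrightarrow> 1 / \<kappa>) (at_left crit)"
  using tendsto_inverse[OF gN_ratio] \<kappa>_pos by (simp add: inverse_eq_divide)

lemma gN_pos: "eventually (\<lambda>c. gN c > 0) (at_left crit)"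
  using order_tendstoD(1)[OF gN_ratio \<kappa>_pos]
proof eventually_elim
  case (elim c)
  then show ?case
    using bergman_norm_nonneg[of p \<alpha> "g_hat c \<theta>"] unfolding zero_less_divide_iff by (meson not_less)
qed

lemma E_A:
  assumes "\<alpha> / p < c" "c < crit"
  shows "E1 c \<in> A" "E2 c \<in> A"
  unfolding E1_def E2_def by (intro A_cmult cauchy_kernel_A cauchy_kernel_reflect_A assms)+

lemma E_norm: "((\<lambda>c. N (\<lambda>z. a * E1 c z + b * E2 c z)) \<longlongrightarrow> lp2 a b) (at_left crit)"
proof -
  have "((\<lambda>c. \<kappa> * (N (cauchy_kernel c) / gN c) * (N (\<lambda>z. a * cauchy_kernel c z + b * cauchy_kernel c (- z)) / N (cauchy_kernel c)))
      \<longlongrightarrow> \<kappa> * (1 / \<kappa>) * lp2 a b) (at_left crit)"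
    by (intro tendsto_intros gN_ratio' norm_kernel_combination)
  moreover have "eventually (\<lambda>c. \<kappa> * (N (cauchy_kernel c) / gN c) * (N (\<lambda>z. a * cauchy_kernel c z + b * cauchy_kernel c (- z)) / N (cauchy_kernel c))
      = N (\<lambda>z. a * E1 c z + b * E2 c z)) (at_left crit)"
    using gN_pos norm_kernel_eventually_ge[of 1]
  proof eventually_elim
    case (elim c)
    have "(\<lambda>z. a * E1 c z + b * E2 c z) = (\<lambda>z. of_real (\<kappa> / gN c) * (a * cauchy_kernel c z + b * cauchy_kernel c (- z)))"
      unfolding E1_def E2_def by (simp only: distrib_left mult.left_commute)
    then have "N (\<lambda>z. a * E1 c z + b * E2 c z) = \<kappa> / gN c * N (\<lambda>z. a * cauchy_kernel c z + b * cauchy_kernel c (- z))"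
      using \<kappa>_pos elim by (simp only: N_cmult norm_of_real) simp
    then show ?case
      using elim by simp
  qed
  ultimately have "((\<lambda>c. N (\<lambda>z. a * E1 c z + b * E2 c z)) \<longlongrightarrow> \<kappa> * (1 / \<kappa>) * lp2 a b) (at_left crit)"
    by (rule Lim_transform_eventually)
  then show ?thesis
    using \<kappa>_pos by simp
qed

text \<open>The error is the combination of the errors for the two kernels with weights
  \<open>\<theta>\<close> and \<open>1 - \<theta>\<close>, divided by \<open>gN c\<close>. As
  \<open>gN c\<close> is of the order of the kernel norm, the relative errors of the two kernels
  decide.\<close>

lemma S_asymp:
  assumes t: "t \<in> {0<..<1}"
  shows "((\<lambda>c. N (\<lambda>z. S t (g c) z - V c t z)) \<longlongrightarrow> 0) (at_left crit)"
proof -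
  define v where "v = bval (u t) 1 * of_real (Re (bval (deriv (\<phi> t)) 1) powr (- crit))"
  define w where "w = bval (u t) (-1) * of_real (Re (bval (deriv (\<phi> t)) (-1)) powr (- crit))"
  have T: "Tp t = of_real (\<theta> / \<kappa>) * v" "Tn t = of_real ((1 - \<theta>) / \<kappa>) * w"
    using Theta_eq[OF t] by (simp_all add: v_def w_def)
  let ?D1 = "\<lambda>c z. u t z * cauchy_kernel c (\<phi> t z) - v * cauchy_kernel c z"
  let ?D2 = "\<lambda>c z. u t z * cauchy_kernel c (- \<phi> t z) - w * cauchy_kernel c (- z)"
  show ?thesis
  proof (rule Lim_null_comparison)
    have "((\<lambda>c. N (cauchy_kernel c) / gN c * (\<theta> * (N (?D1 c) / N (cauchy_kernel c)) + (1 - \<theta>) * (N (?D2 c) / N (cauchy_kernel c))))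
        \<longlongrightarrow> 1 / \<kappa> * (\<theta> * 0 + (1 - \<theta>) * 0)) (at_left crit)"
      using S_kernel_asymp[OF t] by (intro tendsto_intros gN_ratio') (auto simp: v_def w_def)
    then show "((\<lambda>c. N (cauchy_kernel c) / gN c * (\<theta> * (N (?D1 c) / N (cauchy_kernel c)) + (1 - \<theta>) * (N (?D2 c) / N (cauchy_kernel c))))
        \<longlongrightarrow> 0) (at_left crit)"
      by simp
    show "eventually (\<lambda>c. norm (N (\<lambda>z. S t (g c) z - V c t z)) \<le>
        N (cauchy_kernel c) / gN c * (\<theta> * (N (?D1 c) / N (cauchy_kernel c)) + (1 - \<theta>) * (N (?D2 c) / N (cauchy_kernel c)))) (at_left crit)"
      using gN_pos norm_kernel_eventually_ge[of 1] eventually_crit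
    proof eventually_elim
      case (elim c)
      have K: "cauchy_kernel c \<in> A" "(\<lambda>z. cauchy_kernel c (- z)) \<in> A"
        using elim by (auto intro!: cauchy_kernel_A cauchy_kernel_reflect_A)
      have D: "?D1 c \<in> L" "?D2 c \<in> L"
        using L_diff[OF A_L[OF S_A[OF t K(1)]] L_cmult[OF A_L[OF K(1)], of v]]
          L_diff[OF A_L[OF S_A[OF t K(2)]] L_cmult[OF A_L[OF K(2)], of w]]
        by (simp_all add: weighted_comp_def)
      have "S t (g c) z - V c t z = of_real (1 / gN c) * (of_real \<theta> * ?D1 c z + of_real (1 - \<theta>) * ?D2 c z)" for z
      proof -
        have 1: "Tp t * E1 c z = of_real (1 / gN c) * (of_real \<theta> * (v * cauchy_kernel c z))"
          using \<kappa>_pos by (simp add: T E1_def)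
        have 2: "Tn t * E2 c z = of_real (1 / gN c) * (of_real (1 - \<theta>) * (w * cauchy_kernel c (- z)))"
          using \<kappa>_pos by (simp add: T E2_def)
        have 3: "S t (g c) z = of_real (1 / gN c) * (u t z * (of_real \<theta> * cauchy_kernel c (\<phi> t z) + of_real (1 - \<theta>) * cauchy_kernel c (- \<phi> t z)))"
          by (simp add: weighted_comp_def g_test_def g_hat_eq)
        show ?thesis
          unfolding 1 2 3 by (simp only: ring_distribs) (simp add: algebra_simps)
      qed
      then have "N (\<lambda>z. S t (g c) z - V c t z) = 1 / gN c * N (\<lambda>z. of_real \<theta> * ?D1 c z + of_real (1 - \<theta>) * ?D2 c z)"
        using elim(1) by (simp only: N_cmult norm_of_real) simp
      also have "\<dots> \<le> 1 / gN c * (\<theta> * N (?D1 c) + (1 - \<theta>) * N (?D2 c))"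
      proof (rule mult_left_mono)
        have "N (\<lambda>z. of_real \<theta> * ?D1 c z + of_real (1 - \<theta>) * ?D2 c z) \<le> cmod (of_real \<theta>) * N (?D1 c) + cmod (of_real (1 - \<theta>)) * N (?D2 c)"
          unfolding N_cmult[symmetric] by (intro N_triangle L_cmult D)
        then show "N (\<lambda>z. of_real \<theta> * ?D1 c z + of_real (1 - \<theta>) * ?D2 c z) \<le> \<theta> * N (?D1 c) + (1 - \<theta>) * N (?D2 c)"
          using theta by (simp only: norm_of_real) simp
      qed (use elim in simp)
      also have "\<dots> = N (cauchy_kernel c) / gN c * (\<theta> * (N (?D1 c) / N (cauchy_kernel c)) + (1 - \<theta>) * (N (?D2 c) / N (cauchy_kernel c)))"
      proof -
        have *: "1 / G * (\<theta> * x + (1 - \<theta>) * y) = k / G * (\<theta> * (x / k) + (1 - \<theta>) * (y / k))" if "k \<noteq> 0" for G k x y :: real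
        proof -
          have "\<theta> * (x / k) + (1 - \<theta>) * (y / k) = (\<theta> * x + (1 - \<theta>) * y) / k"
            by (simp add: add_divide_distrib)
          then show ?thesis using that by simp
        qed
        have "N (cauchy_kernel c) \<noteq> 0"
          using elim by linarith
        then show ?thesis by (rule *)
      qed
      finally show ?case by simp
    qed
  qed
qed

text \<open>Fixes one left neighbourhood of \<open>crit\<close> for all later estimates, so that
  sequences tending to \<open>crit\<close> can be kept inside it from their first term on. The bound
  2 could be any number above 1, the limit of both norms.\<close>

lemma good_parameters:
  obtains b where "b < crit" "\<And>c. b < c \<Longrightarrow> c < crit \<Longrightarrow>
    \<alpha> / p < c \<and> gN c > 0 \<and> N (E1 c) \<le> 2 \<and> N (E2 c) \<le> 2"
proof -
  have l: "lp2 1 0 = 1" "lp2 0 1 = 1"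
    using p by (auto simp: lp2_def)
  have "eventually (\<lambda>c. N (E1 c) < 2) (at_left crit)" "eventually (\<lambda>c. N (E2 c) < 2) (at_left crit)"
    using order_tendstoD(2)[OF E_norm[of 1 0], of 2] order_tendstoD(2)[OF E_norm[of 0 1], of 2] by (simp_all add: l)
  then have "eventually (\<lambda>c. \<alpha> / p < c \<and> gN c > 0 \<and> N (E1 c) \<le> 2 \<and> N (E2 c) \<le> 2) (at_left crit)"
    using eventually_crit gN_pos by eventually_elim auto
  then show thesis
    using that unfolding eventually_at_left[OF crit_pos(2)] by blast
qed

lemma g_norm:
  assumes "\<alpha> / p < c" "c < crit" "gN c > 0"
  shows "g c \<in> A" "N (g c) = 1"
proof -
  have g: "g c = (\<lambda>z. of_real (1 / gN c) * g_hat c \<theta> z)"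
    by (rule ext) (simp add: g_test_def)
  show "g c \<in> A"
    unfolding g g_hat_fun by (intro A_cmult A_add_scale cauchy_kernel_A cauchy_kernel_reflect_A assms)
  show "N (g c) = 1"
    unfolding g N_cmult norm_of_real using assms by simp
qed

lemma S_g_norm_le:
  assumes "\<alpha> / p < c" "c < crit" "gN c > 0" "t \<in> {0<..<1}"
  shows "N (S t (g c)) \<le> opn t"
  using norm_S_le[OF assms(4) g_norm(1)[OF assms(1-3)]] g_norm(2)[OF assms(1-3)] by simp

lemma S_g_approx:
  assumes "\<alpha> / p < c" "c < crit"
  shows "approximable (\<lambda>t. S t (g c))"
    and "\<And>h. h \<in> A \<Longrightarrow> (\<lambda>t. N (\<lambda>z. S t (g c) z - h z)) \<in> borel_measurable unit_interval"
proof -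
  have g: "g c = (\<lambda>z. of_real (\<theta> / gN c) * cauchy_kernel c z + of_real ((1 - \<theta>) / gN c) * cauchy_kernel c (- z))"
    by (rule ext) (simp add: g_test_def g_hat_eq add_divide_distrib)
  have gA: "g c \<in> A"
    unfolding g by (intro A_add_scale cauchy_kernel_A cauchy_kernel_reflect_A assms)
  obtain h where h: "\<And>n. continuous_on (cball 0 1) (h n)" "\<And>n. h n holomorphic_on disk"
    "(\<lambda>n. N (\<lambda>z. g c z - h n z)) \<longlonglongrightarrow> 0"
    using kernel_combination_approx[OF assms] unfolding g by blast
  show "approximable (\<lambda>t. S t (g c))" "\<And>h. h \<in> A \<Longrightarrow> (\<lambda>t. N (\<lambda>z. S t (g c) z - h z)) \<in> borel_measurable unit_interval"
    using S_approximable[OF gA h] by blast+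
qed

lemma S_g_norm_tendsto:
  assumes t: "t \<in> {0<..<1}"
  shows "((\<lambda>c. N (S t (g c))) \<longlongrightarrow> lp2 (Tp t) (Tn t)) (at_left crit)"
proof -
  have "((\<lambda>c. N (S t (g c)) - N (V c t)) \<longlongrightarrow> 0) (at_left crit)"
  proof (rule Lim_null_comparison[OF _ S_asymp[OF t]])
    show "eventually (\<lambda>c. norm (N (S t (g c)) - N (V c t)) \<le> N (\<lambda>z. S t (g c) z - V c t z)) (at_left crit)"
      using eventually_crit gN_pos
    proof eventually_elim
      case (elim c)
      then show ?case
        unfolding real_norm_def by (intro N_abs_diff A_L S_A[OF t] A_add_scale g_norm E_A) auto
    qed
  qed
  from tendsto_add[OF this E_norm[of "Tp t" "Tn t"]] show ?thesis by simp
qed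

text \<open>The operator bound for the normalised test functions survives the limit, so the
  integrable operator norm also dominates the coefficients.\<close>

lemma lp2_Theta_le:
  assumes t: "t \<in> {0<..<1}"
  shows "lp2 (Tp t) (Tn t) \<le> opn t"
proof (rule tendsto_upperbound[OF S_g_norm_tendsto[OF t]])
  show "eventually (\<lambda>c. N (S t (g c)) \<le> opn t) (at_left crit)"
    using eventually_crit gN_pos by eventually_elim (use t in \<open>auto intro!: S_g_norm_le\<close>)
qed simp

lemma Theta_integrable: "integrable unit_interval Tp" "integrable unit_interval Tn"
proof -
  have "norm (Tp t) \<le> norm (opn t)" "norm (Tn t) \<le> norm (opn t)" if "t \<in> {0<..<1}" for t
    using lp2_Theta_le[OF that] cmod_le_lp2(1)[of "Tp t" "Tn t"] cmod_le_lp2(2)[of "Tn t" "Tp t"] by auto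
  then show "integrable unit_interval Tp" "integrable unit_interval Tn"
    by (auto intro!: Bochner_Integration.integrable_bound[OF opn_integrable] Theta_measurable AE_I2)
qed

lemma S_g_diff_integrable:
  assumes c: "\<alpha> / p < c" "c < crit" "gN c > 0" and E: "N (E1 c) \<le> 2" "N (E2 c) \<le> 2"
  shows "integrable unit_interval (\<lambda>t. N (\<lambda>z. S t (g c) z - V c t z))"
    and "\<And>t. t \<in> {0<..<1} \<Longrightarrow> N (\<lambda>z. S t (g c) z - V c t z) \<le> 5 * opn t"
proof -
  note gA = g_norm(1)[OF c] and EA = E_A[OF c(1,2)]
  have VA: "V c t \<in> A" for t
    by (rule A_add_scale[OF EA])
  show le: "N (\<lambda>z. S t (g c) z - V c t z) \<le> 5 * opn t" if t: "t \<in> {0<..<1}" for t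
  proof -
    have T: "cmod (Tp t) \<le> opn t" "cmod (Tn t) \<le> opn t"
      using lp2_Theta_le[OF t] cmod_le_lp2(1)[of "Tp t" "Tn t"] cmod_le_lp2(2)[of "Tn t" "Tp t"] by auto
    have "N (\<lambda>z. S t (g c) z - V c t z) \<le> N (S t (g c)) + N (V c t)"
      by (intro N_diff_le A_L S_A[OF t] gA VA)
    also have "N (V c t) \<le> cmod (Tp t) * N (E1 c) + cmod (Tn t) * N (E2 c)"
      unfolding N_cmult[symmetric] by (intro N_triangle L_cmult A_L EA)
    \<comment> \<open>Two multiples of \<open>opn t\<close> come from each of the two kernels; with
      the one from the image of the test function this makes five.\<close>
    also have "\<dots> \<le> opn t * 2 + opn t * 2"
      using T E by (intro add_mono mult_mono) (auto intro: order_trans[OF norm_ge_zero])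
    also have "N (S t (g c)) \<le> opn t"
      by (rule S_g_norm_le[OF c t])
    finally show ?thesis by simp
  qed
  \<comment> \<open>Both terms of the difference vary with \<open>t\<close>. Replacing
    \<open>V c\<close> by simple functions that converge pointwise reduces measurability to
    distances from fixed elements.\<close>
  obtain s where s: "\<And>n::nat. simple_A (s n)" "\<And>t. t \<in> {0<..<1} \<Longrightarrow> (\<lambda>n. N (\<lambda>z. V c t z - s n t z)) \<longlonglongrightarrow> 0"
    using has_bergman_integral_combination(2)[OF Theta_integrable EA] by blast
  have "(\<lambda>t. N (\<lambda>z. S t (g c) z - V c t z)) \<in> borel_measurable unit_interval"
  proof (rule borel_measurable_LIMSEQ_metric)
    show "(\<lambda>t. N (\<lambda>z. S t (g c) z - s n t z)) \<in> borel_measurable unit_interval" for n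
      by (rule norm_diff_simple_measurable[OF S_g_approx(2)[OF c(1,2)] s(1)])
    fix t assume "t \<in> space unit_interval"
    then have t: "t \<in> {0<..<1}" by simp
    have "(\<lambda>n. N (\<lambda>z. S t (g c) z - s n t z) - N (\<lambda>z. S t (g c) z - V c t z)) \<longlonglongrightarrow> 0"
    proof (rule Lim_null_comparison[OF _ s(2)[OF t]])
      show "eventually (\<lambda>n. norm (N (\<lambda>z. S t (g c) z - s n t z) - N (\<lambda>z. S t (g c) z - V c t z)) \<le> N (\<lambda>z. V c t z - s n t z)) sequentially"
      proof (intro always_eventually allI)
        fix n
        have L: "S t (g c) \<in> L" "s n t \<in> L" "V c t \<in> L"
          using S_A[OF t gA] simple_A_in[OF s(1) t] VA A_L by auto
        have "\<bar>N (\<lambda>z. S t (g c) z - s n t z) - N (\<lambda>z. S t (g c) z - V c t z)\<bar> \<le> N (\<lambda>z. (S t (g c) z - s n t z) - (S t (g c) z - V c t z))"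
          by (intro N_abs_diff L_diff L)
        then show "norm (N (\<lambda>z. S t (g c) z - s n t z) - N (\<lambda>z. S t (g c) z - V c t z)) \<le> N (\<lambda>z. V c t z - s n t z)"
          by simp
      qed
    qed
    then show "(\<lambda>n. N (\<lambda>z. S t (g c) z - s n t z)) \<longlonglongrightarrow> N (\<lambda>z. S t (g c) z - V c t z)"
      by (rule LIM_zero_cancel)
  qed
  then show "integrable unit_interval (\<lambda>t. N (\<lambda>z. S t (g c) z - V c t z))"
  proof (rule Bochner_Integration.integrable_bound[rotated])
    show "integrable unit_interval (\<lambda>t. 5 * opn t)"
      using opn_integrable by simp
    show "AE t in unit_interval. norm (N (\<lambda>z. S t (g c) z - V c t z)) \<le> norm (5 * opn t)"
      using order_trans[OF le abs_ge_self] by (intro AE_I2) simp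
  qed
qed

text \<open>Dominated convergence in \<open>t\<close> with the majorant \<open>5 * opn t\<close>,
  which does not depend on \<open>c\<close>. As that theorem concerns sequences, the one-sided limit
  is tested along sequences in the good range.\<close>

lemma integral_diff_tendsto:
  "((\<lambda>c. LINT t|unit_interval. N (\<lambda>z. S t (g c) z - V c t z)) \<longlongrightarrow> 0) (at_left crit)"
proof -
  obtain b where b: "b < crit" "\<And>c. b < c \<Longrightarrow> c < crit \<Longrightarrow>
    \<alpha> / p < c \<and> gN c > 0 \<and> N (E1 c) \<le> 2 \<and> N (E2 c) \<le> 2"
    using good_parameters by blast
  show ?thesis
  proof (rule tendsto_at_left_sequentially[OF b(1)])
    fix c :: "nat \<Rightarrow> real"
    assume c: "\<And>n. c n < crit" "\<And>n. b < c n" "c \<longlonglongrightarrow> crit"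
    have good: "\<alpha> / p < c n" "c n < crit" "gN (c n) > 0" "N (E1 (c n)) \<le> 2" "N (E2 (c n)) \<le> 2" for n
      using b(2)[OF c(2) c(1)] c(1) by auto
    have filt: "filterlim c (at_left crit) sequentially"
      using c by (auto simp: filterlim_at less_le)
    have "(\<lambda>n. LINT t|unit_interval. N (\<lambda>z. S t (g (c n)) z - V (c n) t z)) \<longlonglongrightarrow> (LINT t|unit_interval. 0)"
    proof (rule integral_dominated_convergence)
      show "integrable unit_interval (\<lambda>t. 5 * opn t)"
        using opn_integrable by simp
      show "AE t in unit_interval. (\<lambda>n. N (\<lambda>z. S t (g (c n)) z - V (c n) t z)) \<longlonglongrightarrow> 0"
        using filterlim_compose[OF S_asymp filt] by (intro AE_I2) simp
      show "AE t in unit_interval. norm (N (\<lambda>z. S t (g (c n)) z - V (c n) t z)) \<le> 5 * opn t" for n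
        using S_g_diff_integrable(2)[OF good] by (intro AE_I2) simp
      show "(\<lambda>t. N (\<lambda>z. S t (g (c n)) z - V (c n) t z)) \<in> borel_measurable unit_interval" for n
        using S_g_diff_integrable(1)[OF good] by (rule borel_measurable_integrable)
    qed simp
    then show "(\<lambda>n. LINT t|unit_interval. N (\<lambda>z. S t (g (c n)) z - V (c n) t z)) \<longlonglongrightarrow> 0"
      by simp
  qed
qed

lemma integral_norm_tendsto:
  "((\<lambda>c. LINT t|unit_interval. N (S t (g c))) \<longlongrightarrow> (LINT t|unit_interval. lp2 (Tp t) (Tn t))) (at_left crit)"
proof -
  obtain b where b: "b < crit" "\<And>c. b < c \<Longrightarrow> c < crit \<Longrightarrow>
    \<alpha> / p < c \<and> gN c > 0 \<and> N (E1 c) \<le> 2 \<and> N (E2 c) \<le> 2"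
    using good_parameters by blast
  show ?thesis
  proof (rule tendsto_at_left_sequentially[OF b(1)])
    fix c :: "nat \<Rightarrow> real"
    assume c: "\<And>n. c n < crit" "\<And>n. b < c n" "c \<longlonglongrightarrow> crit"
    have good: "\<alpha> / p < c n" "c n < crit" "gN (c n) > 0" for n
      using b(2)[OF c(2) c(1)] c(1) by auto
    have filt: "filterlim c (at_left crit) sequentially"
      using c by (auto simp: filterlim_at less_le)
    show "(\<lambda>n. LINT t|unit_interval. N (S t (g (c n)))) \<longlonglongrightarrow> (LINT t|unit_interval. lp2 (Tp t) (Tn t))"
    proof (rule integral_dominated_convergence[OF _ _ opn_integrable])
      show "AE t in unit_interval. (\<lambda>n. N (S t (g (c n)))) \<longlonglongrightarrow> lp2 (Tp t) (Tn t)"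
        using filterlim_compose[OF S_g_norm_tendsto filt] by (intro AE_I2) simp
      show "AE t in unit_interval. norm (N (S t (g (c n)))) \<le> opn t" for n
        using S_g_norm_le[OF good] by (intro AE_I2) simp
      show "(\<lambda>t. N (S t (g (c n)))) \<in> borel_measurable unit_interval" for n
        using S_g_approx(2)[OF good(1,2) A_zero] by simp
      show "(\<lambda>t. lp2 (Tp t) (Tn t)) \<in> borel_measurable unit_interval"
        using lp2_integrable[OF Theta_integrable] by (rule borel_measurable_integrable)
    qed
  qed
qed

text \<open>The family \<open>V c\<close> has an explicit integral, the same combination of kernels
  with integrated coefficients. The two integrals differ in norm by at most the mean difference of
  the families, so \<open>E_norm\<close> determines the limit.\<close>

lemma norm_integral_tendsto:
  "((\<lambda>c. N (bergman_integral p \<alpha> (\<lambda>t. S t (g c)))) \<longlongrightarrow>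
     lp2 (LINT t|unit_interval. Tp t) (LINT t|unit_interval. Tn t)) (at_left crit)"
proof -
  let ?a = "LINT t|unit_interval. Tp t" and ?b = "LINT t|unit_interval. Tn t"
  let ?G = "\<lambda>c. bergman_integral p \<alpha> (\<lambda>t. S t (g c))" and ?V = "\<lambda>c z. ?a * E1 c z + ?b * E2 c z"
  obtain b where b: "b < crit" "\<And>c. b < c \<Longrightarrow> c < crit \<Longrightarrow>
    \<alpha> / p < c \<and> gN c > 0 \<and> N (E1 c) \<le> 2 \<and> N (E2 c) \<le> 2"
    using good_parameters by blast
  have "((\<lambda>c. N (?G c) - N (?V c)) \<longlongrightarrow> 0) (at_left crit)"
  proof (rule Lim_null_comparison[OF _ integral_diff_tendsto])
    have "eventually (\<lambda>c. b < c \<and> c < crit) (at_left crit)"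
      using b(1) by (auto simp: eventually_at_left)
    then show "eventually (\<lambda>c. norm (N (?G c) - N (?V c)) \<le> (LINT t|unit_interval. N (\<lambda>z. S t (g c) z - V c t z))) (at_left crit)"
    proof eventually_elim
      case (elim c)
      then have good: "\<alpha> / p < c" "c < crit" "gN c > 0" "N (E1 c) \<le> 2" "N (E2 c) \<le> 2"
        using b(2)[of c] by auto
      \<comment> \<open>The choice in \<open>bergman_integral\<close> has the defining property only
        because some integral exists.\<close>
      obtain G where "has_bergman_integral p \<alpha> (\<lambda>t. S t (g c)) G"
        using approximable_has_integral[OF S_g_approx(1)[OF good(1,2)]] by blast
      then have G: "has_bergman_integral p \<alpha> (\<lambda>t. S t (g c)) (?G c)"
        unfolding bergman_integral_def by (rule someI[of "has_bergman_integral p \<alpha> (\<lambda>t. S t (g c))"])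
      have V: "has_bergman_integral p \<alpha> (V c) (?V c)"
        by (rule has_bergman_integral_combination(1)[OF Theta_integrable E_A[OF good(1,2)]])
      have "\<bar>N (?G c) - N (?V c)\<bar> \<le> N (\<lambda>z. ?G c z - ?V c z)"
        using G V by (intro N_abs_diff A_L) (auto simp: has_bergman_integral_def)
      also have "\<dots> \<le> (LINT t|unit_interval. N (\<lambda>z. S t (g c) z - V c t z))"
        by (rule norm_bergman_integral_diff_le[OF G V S_g_diff_integrable(1)[OF good]])
      finally show ?case by simp
    qed
  qed
  from tendsto_add[OF this E_norm[of ?a ?b]] show ?thesis by simp
qed

end

theorem proposition3p3:
  fixes p \<alpha> \<theta> :: real
    and u \<phi> :: "real \<Rightarrow> complex \<Rightarrow> complex"
  assumes "p > 1" and "\<alpha> \<ge> 0"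
    and "weighted_comp_family p \<alpha> u \<phi>"
    and "has_directions_pm1 u \<phi>"
    and "condition_W p \<alpha> u \<phi>"
    and "\<theta> \<in> {0..1}"
  shows
    "(\<exists>L. ((\<lambda>c. bergman_norm p \<alpha> (bergman_integral p \<alpha>
               (\<lambda>t. weighted_comp (u t) (\<phi> t) (g_test p \<alpha> c \<theta>))))
             \<longlongrightarrow> L) (at_left ((2 + \<alpha>) / p)) \<and>
          ((\<lambda>c. LINT t|unit_interval. bergman_norm p \<alpha>
               (weighted_comp (u t) (\<phi> t) (g_test p \<alpha> c \<theta>)))
             \<longlongrightarrow> L) (at_left ((2 + \<alpha>) / p)))
     \<longleftrightarrow>
     (\<exists>M \<subseteq> {0<..<1}. M \<in> sets lebesgue \<and> negligible ({0<..<1} - M) \<and>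
        (\<forall>t0\<in>M.
           (\<forall>t\<in>M. \<exists>l::real. l \<ge> 0 \<and>
              Theta_neg p \<alpha> \<theta> (u t) (\<phi> t) = of_real l * Theta_neg p \<alpha> \<theta> (u t0) (\<phi> t0) \<and>
              Theta_pos p \<alpha> \<theta> (u t) (\<phi> t) = of_real l * Theta_pos p \<alpha> \<theta> (u t0) (\<phi> t0)) \<or>
           (Theta_neg p \<alpha> \<theta> (u t0) (\<phi> t0) = 0 \<and> Theta_pos p \<alpha> \<theta> (u t0) (\<phi> t0) = 0)))"
    (is "?lhs \<longleftrightarrow> ?rhs")
proof -
  interpret weighted_family_theta p \<alpha> u \<phi> \<theta>
    by unfold_locales (use assms in auto)
  note lims = norm_integral_tendsto[unfolded crit_def] integral_norm_tendsto[unfolded crit_def]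
  \<comment> \<open>Both limits exist in any case, so a common limit exists exactly when their two
    values agree.\<close>
  have "?lhs \<longleftrightarrow> lp2 (LINT t|unit_interval. Tp t) (LINT t|unit_interval. Tn t) = (LINT t|unit_interval. lp2 (Tp t) (Tn t))"
  proof
    assume ?lhs
    then show "lp2 (LINT t|unit_interval. Tp t) (LINT t|unit_interval. Tn t) = (LINT t|unit_interval. lp2 (Tp t) (Tn t))"
      using tendsto_unique[OF trivial_limit_at_left_real lims(1)]
        tendsto_unique[OF trivial_limit_at_left_real lims(2)] by blast
  next
    assume "lp2 (LINT t|unit_interval. Tp t) (LINT t|unit_interval. Tn t) = (LINT t|unit_interval. lp2 (Tp t) (Tn t))"
    then show ?lhs
      using lims by auto
  qed
  also have "\<dots> \<longleftrightarrow> ?rhs"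
    by (rule lp2_integral_eq_iff[OF Theta_integrable])
  finally show ?thesis .
qed

end
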